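(* Let $R=(R^{\lambda\alpha}_{\beta\mu})$, $\lambda,\mu,\alpha,\beta\in\{0,1,2,3\}$, be an admissible deformation matrix, let $\mathcal{A}(\mathbb{S}^7_R)$ be the coordinate $*$-algebra of the associated noncommutative seven-sphere, and let $\mathcal{A}(\mathbb{S}^4_R)\subset \mathcal{A}(\mathbb{S}^7_R)$ be the subalgebra of the associated four-sphere. Suppose that the action of $\mathrm{SU}(2)\simeq \mathrm{U}_1(\mathbb{H})$ given on generators by $$\alpha_w: \begin{pmatrix} x_2\\ x_1\end{pmatrix}\mapsto \begin{pmatrix} x_2 w\\ x_1 w\end{pmatrix},\qquad w\in \mathrm{U}_1(\mathbb{H}),$$ is an action by $*$-automorphisms of $\mathcal{A}(\mathbb{S}^7_R)$. Let $H=\mathcal{A}(\mathrm{SU}(2))$ and let $\delta:\mathcal{A}(\mathbb{S}^7_R)\to \mathcal{A}(\mathbb{S}^7_R)\otimes H$ be the corresponding coaction. Then the canonical map $$\chi:\ \mathcal{A}(\mathbb{S}^7_R)\otimes_{\mathcal{A}(\mathbb{S}^4_R)}\mathcal{A}(\mathbb{S}^7_R)\to \mathcal{A}(\mathbb{S}^7_R)\otimes H,\qquad \chi(p'\otimes p)=p'\,\delta(p),$$ is bijective.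
   Context: Repeated up-down indices are summed; all algebras are unital associative over $\mathbb{C}$. **The algebra $\mathcal{A}_R$.** Given complex numbers $R^{\lambda\alpha}_{\beta\mu}$ with all indices in $\{0,1,2,3\}$, $\mathcal{A}_R$ is the $*$-algebra generated by hermitian elements $x_1^\lambda$, $x_2^\alpha$ ($\lambda,\alpha\in\{0,1,2,3\}$) with relations $$x_1^\lambda x_1^\mu=x_1^\mu x_1^\lambda,\quad x_2^\alpha x_2^\beta=x_2^\beta x_2^\alpha,\quad x_1^\lambda x_2^\alpha=R^{\lambda\alpha}_{\beta\mu}\,x_2^\beta x_1^\mu,\quad x_2^\alpha x_1^\lambda=\overline{R}^{\lambda\alpha}_{\beta\mu}\,x_1^\mu x_2^\beta ,$$ where $\overline{R}^{\lambda\alpha}_{\beta\mu}$ is the complex conjugate of $R^{\lambda\alpha}_{\beta\mu}$. **Admissible deformation matrix.** $R$ is required to satisfy: (i) $\overline{R}^{\lambda\alpha}_{\beta\mu}R^{\mu\beta}_{\gamma\nu}=\delta^\lambda_\nu\delta^\alpha_\gamma$; (ii) writing all the relations above as $x^ax^b=\mathcal{R}^{ab}_{cd}x^cx^d$, where $x^a$ runs over all eight generators (so $\mathcal{R}$ is an endomorphism of $V\otimes V$, with $V$ the span of the generators, given by the flip on pairs of generators from the same set and by $R$, resp. $\overline{R}$, on mixed pairs), $\mathcal{R}$ satisfies the Yang–Baxter equation $(\mathcal{R}\otimes I)(I\otimes\mathcal{R})(\mathcal{R}\otimes I)=(I\otimes\mathcal{R})(\mathcal{R}\otimes I)(I\otimes\mathcal{R})$;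 (iii) the elements $(x_1)^2=\sum_\lambda (x_1^\lambda)^2$ and $(x_2)^2=\sum_\alpha (x_2^\alpha)^2$ are central in $\mathcal{A}_R$. **Seven-sphere.** $\mathcal{A}(\mathbb{S}^7_R)=\mathcal{A}_R/\big((x_1)^2+(x_2)^2-1\big)$. **Quaternions.** $\mathbb{H}$ has real basis $e_0=1,e_1,e_2,e_3$ with $e_ae_b=-\delta_{ab}+\sum_{c=1}^3\varepsilon_{abc}e_c$ for $a,b\in\{1,2,3\}$. $\mathrm{U}_1(\mathbb{H})$ is the group of unit quaternions, identified with $\mathrm{SU}(2)$. Put $x_1=\sum_\mu x_1^\mu e_\mu$ and $x_2=\sum_\alpha x_2^\alpha e_\alpha$, quaternions with entries in $\mathcal{A}(\mathbb{S}^7_R)$ (the $e_\mu$ commute with the entries); the $*$-operation is conjugation of quaternions ($e_0^*=e_0$, $e_k^*=-e_k$) combined with the $*$ of $\mathcal{A}(\mathbb{S}^7_R)$ on entries. Thus $x_iw$ denotes the quaternion product, and $\alpha_w(x_i^\mu)$ is the $e_\mu$-component of $x_iw$. **Four-sphere.** Define $Y^4=\|x_2\|^2-\|x_1\|^2$, where $\|x_i\|^2=\sum_\mu (x_i^\mu)^2$, and $Y^0,\dots,Y^3\in\mathcal{A}(\mathbb{S}^7_R)$ by $Y=\sum_{\mu=0}^3Y^\mu e_\mu=2\,x_2x_1^*$. Then $\mathcal{A}(\mathbb{S}^4_R)$ is the $*$-subalgebra of $\mathcal{A}(\mathbb{S}^7_R)$ generated by $Y^0,Y^1,Y^2,Y^3,Y^4$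 (equivalently, by the entries of the projection $\begin{pmatrix} x_2x_2^*&x_2x_1^*\\ x_1x_2^*&x_1x_1^*\end{pmatrix}$). **Coaction.** $H=\mathcal{A}(\mathrm{SU}(2))$ is the commutative Hopf algebra of complex polynomial functions on $\mathrm{SU}(2)\simeq \mathrm{U}_1(\mathbb{H})=\{w=w^\rho e_\rho:\sum_\rho (w^\rho)^2=1\}$, generated by the coordinate functions $w^0,w^1,w^2,w^3$. The right coaction $\delta$ is the algebra ($*$-)homomorphism dual to the action $\alpha$: $\delta(x_i^\mu)=\sum_{\nu,\rho}m^\mu_{\nu\rho}\,x_i^\nu\otimes w^\rho$ for $i=1,2$, where $e_\nu e_\rho=\sum_\mu m^\mu_{\nu\rho}e_\mu$. In the formula for $\chi$, $p'\,\delta(p)$ means $(p'\otimes 1)\delta(p)$. *)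

theory Defs
  imports
    "HOL-Algebra.Free_Abelian_Groups"
    "HOL-Algebra.Generated_Groups"
    "HOL-Algebra.Group_Action"
    "HOL-Algebra.Module"
    "HOL-Algebra.QuotRing"
    "HOL-Algebra.Subrings"
    "HOL-Library.Numeral_Type"
    Complex_Main
begin

section \<open>Complex \<open>*\<close>-algebras\<close>

text \<open>
  \<open>smult\<close> is the action of the complex scalars. The HOL-Algebra locale for algebras requires a
  commutative multiplication, so only the record of operations is used here.
\<close>

record 'a star_alg = "(complex, 'a) module" +
  star :: "'a \<Rightarrow> 'a"

definition star_hom ::
    "('a, 'm) star_alg_scheme \<Rightarrow> ('b, 'n) star_alg_scheme \<Rightarrow> ('a \<Rightarrow> 'b) set" where
  "star_hom A B = {f \<in> ring_hom A B.
     (\<forall>c. \<forall>x\<in>carrier A. f (c \<odot>\<^bsub>A\<^esub> x) = c \<odot>\<^bsub>B\<^esub> f x) \<and>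
     (\<forall>x\<in>carrier A. f (star A x) = star B (f x))}"

definition star_subalgebra :: "'a set \<Rightarrow> ('a, 'm) star_alg_scheme \<Rightarrow> bool" where
  "star_subalgebra T A \<longleftrightarrow> subring T A \<and>
     (\<forall>c. \<forall>x\<in>T. c \<odot>\<^bsub>A\<^esub> x \<in> T) \<and> (\<forall>x\<in>T. star A x \<in> T)"

definition generated_star_subalgebra :: "('a, 'm) star_alg_scheme \<Rightarrow> 'a set \<Rightarrow> 'a set" where
  "generated_star_subalgebra A S = \<Inter> {T. star_subalgebra T A \<and> S \<subseteq> T}"

text \<open>
  Quotient by a two-sided \<open>*\<close>-ideal. As in \<^const>\<open>rcoset_mult\<close>, the unions run over cosets which
  all coincide.
\<close>

definition star_quotient :: "('a, 'm) star_alg_scheme \<Rightarrow> 'a set \<Rightarrow> 'a set star_alg" where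
  "star_quotient A J =
     \<lparr>carrier = carrier (A Quot J), mult = mult (A Quot J), one = one (A Quot J),
      zero = zero (A Quot J), add = add (A Quot J),
      smult = (\<lambda>c X. \<Union>x\<in>X. J +>\<^bsub>A\<^esub> (c \<odot>\<^bsub>A\<^esub> x)),
      star = (\<lambda>X. \<Union>x\<in>X. J +>\<^bsub>A\<^esub> star A x)\<rparr>"


section \<open>Quaternions\<close>

text \<open>The index set \<open>{0, 1, 2, 3}\<close> is the numeral type \<open>4\<close>.\<close>

definition levi_civita :: "4 \<Rightarrow> 4 \<Rightarrow> 4 \<Rightarrow> real" where
  "levi_civita a b c =
     (if (a, b, c) \<in> {(1, 2, 3), (2, 3, 1), (3, 1, 2)} then 1
      else if (a, b, c) \<in> {(2, 1, 3), (1, 3, 2), (3, 2, 1)} then - 1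
      else 0)"

text \<open>\<open>quat_coeff \<mu> \<nu> \<rho>\<close> is the coefficient of \<open>e\<^sub>\<mu>\<close> in the product \<open>e\<^sub>\<nu> e\<^sub>\<rho>\<close>.\<close>

definition quat_coeff :: "4 \<Rightarrow> 4 \<Rightarrow> 4 \<Rightarrow> real" where
  "quat_coeff \<mu> \<nu> \<rho> =
     (if \<nu> = 0 then of_bool (\<mu> = \<rho>)
      else if \<rho> = 0 then of_bool (\<mu> = \<nu>)
      else if \<mu> = 0 then - of_bool (\<nu> = \<rho>)
      else levi_civita \<nu> \<rho> \<mu>)"

text \<open>The group of unit quaternions, a quaternion being given by its four real components.\<close>

definition U1H :: "(4 \<Rightarrow> real) monoid" where
  "U1H = \<lparr>carrier = {w. (\<Sum>\<rho>\<in>UNIV. (w \<rho>)\<^sup>2) = 1},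
          monoid.mult = (\<lambda>v w \<mu>. \<Sum>\<nu>\<in>UNIV. \<Sum>\<rho>\<in>UNIV. quat_coeff \<mu> \<nu> \<rho> * v \<nu> * w \<rho>),
          one = (\<lambda>\<mu>. of_bool (\<mu> = 0))\<rparr>"

text \<open>Quaternions with entries in a \<open>*\<close>-algebra, again as families of four components.\<close>

definition quat_mult ::
    "('a, 'm) star_alg_scheme \<Rightarrow> (4 \<Rightarrow> 'a) \<Rightarrow> (4 \<Rightarrow> 'a) \<Rightarrow> (4 \<Rightarrow> 'a)" where
  "quat_mult A p q = (\<lambda>\<mu>. \<Oplus>\<^bsub>A\<^esub>\<nu>\<in>UNIV. \<Oplus>\<^bsub>A\<^esub>\<rho>\<in>UNIV.
     complex_of_real (quat_coeff \<mu> \<nu> \<rho>) \<odot>\<^bsub>A\<^esub> (p \<nu> \<otimes>\<^bsub>A\<^esub> q \<rho>))"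

definition quat_star :: "('a, 'm) star_alg_scheme \<Rightarrow> (4 \<Rightarrow> 'a) \<Rightarrow> (4 \<Rightarrow> 'a)" where
  "quat_star A p = (\<lambda>\<mu>. if \<mu> = 0 then star A (p \<mu>) else \<ominus>\<^bsub>A\<^esub> star A (p \<mu>))"

definition quat_of_real :: "('a, 'm) star_alg_scheme \<Rightarrow> (4 \<Rightarrow> real) \<Rightarrow> (4 \<Rightarrow> 'a)" where
  "quat_of_real A w = (\<lambda>\<mu>. complex_of_real (w \<mu>) \<odot>\<^bsub>A\<^esub> \<one>\<^bsub>A\<^esub>)"

definition sq_norm :: "('a, 'm) star_alg_scheme \<Rightarrow> (4 \<Rightarrow> 'a) \<Rightarrow> 'a" where
  "sq_norm A p = (\<Oplus>\<^bsub>A\<^esub>\<mu>\<in>UNIV. p \<mu> \<otimes>\<^bsub>A\<^esub> p \<mu>)"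


section \<open>The free \<open>*\<close>-algebra on eight hermitian generators\<close>

datatype gen = X1 "4" | X2 "4"

instance gen :: finite
proof
  have "(UNIV :: gen set) = range X1 \<union> range X2"
    by (auto intro: gen.exhaust)
  then show "finite (UNIV :: gen set)"
    by (metis finite_Un finite_imageI finite_class.finite_UNIV)
qed

text \<open>
  With lists as the free monoid, the multiplication of \<open>gen list \<Rightarrow>\<^sub>0 complex\<close> is the convolution
  product, i.e. this type is the free algebra (noncommutative polynomials).
\<close>

instantiation list :: (type) monoid_add
begin

definition zero_list :: "'a list" where "0 = []"

definition plus_list :: "'a list \<Rightarrow> 'a list \<Rightarrow> 'a list" where "xs + ys = xs @ ys"

instance
  by standard (simp_all add: zero_list_def plus_list_def)

end

type_synonym free = "gen list \<Rightarrow>\<^sub>0 complex"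

abbreviation scalar :: "complex \<Rightarrow> free" where
  "scalar c \<equiv> Poly_Mapping.single [] c"

definition free_alg :: "free star_alg" where
  "free_alg =
     \<lparr>carrier = UNIV, mult = (*), one = 1, zero = 0, add = (+),
      smult = (\<lambda>c f. scalar c * f),
      star = (\<lambda>f. Poly_Mapping.map_key rev (Poly_Mapping.map cnj f))\<rparr>"

definition free_gen :: "gen \<Rightarrow> free" where
  "free_gen a = Poly_Mapping.single [a] 1"


section \<open>The algebra of a deformation matrix\<close>

text \<open>\<open>R \<lambda> \<alpha> \<beta> \<mu>\<close> stands for \<open>R\<close> with upper indices \<open>\<lambda> \<alpha>\<close> and lower indices \<open>\<beta> \<mu>\<close>.\<close>

type_synonym deformation = "4 \<Rightarrow> 4 \<Rightarrow> 4 \<Rightarrow> 4 \<Rightarrow> complex"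

definition relations :: "deformation \<Rightarrow> free set" where
  "relations R =
     {free_gen (X1 l) * free_gen (X1 m) - free_gen (X1 m) * free_gen (X1 l) | l m. True} \<union>
     {free_gen (X2 a) * free_gen (X2 b) - free_gen (X2 b) * free_gen (X2 a) | a b. True} \<union>
     {free_gen (X1 l) * free_gen (X2 a)
        - (\<Sum>b\<in>UNIV. \<Sum>m\<in>UNIV. scalar (R l a b m) * (free_gen (X2 b) * free_gen (X1 m)))
        | l a. True} \<union>
     {free_gen (X2 a) * free_gen (X1 l)
        - (\<Sum>b\<in>UNIV. \<Sum>m\<in>UNIV. scalar (cnj (R l a b m)) * (free_gen (X1 m) * free_gen (X2 b)))
        | l a. True}"

text \<open>
  The set of relations is closed under the involution of \<^const>\<open>free_alg\<close> (the last two families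
  are adjoint to each other), so the two-sided ideal it generates is a \<open>*\<close>-ideal.
\<close>

definition deformed_ideal :: "deformation \<Rightarrow> free set" where
  "deformed_ideal R = Idl\<^bsub>free_alg\<^esub> (relations R)"

definition deformed_alg :: "deformation \<Rightarrow> free set star_alg" where
  "deformed_alg R = star_quotient free_alg (deformed_ideal R)"

definition deformed_gen :: "deformation \<Rightarrow> gen \<Rightarrow> free set" where
  "deformed_gen R a = deformed_ideal R +>\<^bsub>free_alg\<^esub> free_gen a"

text \<open>\<open>full_matrix R a b c d\<close> is the coefficient of \<open>x\<^sup>c x\<^sup>d\<close> in the reordering of \<open>x\<^sup>a x\<^sup>b\<close>.\<close>

fun full_matrix :: "deformation \<Rightarrow> gen \<Rightarrow> gen \<Rightarrow> gen \<Rightarrow> gen \<Rightarrow> complex" where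
  "full_matrix R (X1 l) (X1 m) (X1 n) (X1 k) = of_bool (n = m \<and> k = l)"
| "full_matrix R (X2 a) (X2 b) (X2 c) (X2 d) = of_bool (c = b \<and> d = a)"
| "full_matrix R (X1 l) (X2 a) (X2 b) (X1 m) = R l a b m"
| "full_matrix R (X2 a) (X1 l) (X1 m) (X2 b) = cnj (R l a b m)"
| "full_matrix R _ _ _ _ = 0"

type_synonym triple_matrix = "gen \<times> gen \<times> gen \<Rightarrow> gen \<times> gen \<times> gen \<Rightarrow> complex"

definition triple_mult :: "triple_matrix \<Rightarrow> triple_matrix \<Rightarrow> triple_matrix" where
  "triple_mult M N = (\<lambda>s t. \<Sum>u\<in>UNIV. M s u * N u t)"

text \<open>\<open>full_matrix R\<close> acting on the first two, resp. the last two, of three tensor factors.\<close>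

definition matrix_12 :: "deformation \<Rightarrow> triple_matrix" where
  "matrix_12 R = (\<lambda>(a, b, c) (d, e, f). full_matrix R a b d e * of_bool (c = f))"

definition matrix_23 :: "deformation \<Rightarrow> triple_matrix" where
  "matrix_23 R = (\<lambda>(a, b, c) (d, e, f). of_bool (a = d) * full_matrix R b c e f)"

definition yang_baxter :: "deformation \<Rightarrow> bool" where
  "yang_baxter R \<longleftrightarrow>
     triple_mult (triple_mult (matrix_12 R) (matrix_23 R)) (matrix_12 R) =
     triple_mult (triple_mult (matrix_23 R) (matrix_12 R)) (matrix_23 R)"

definition central :: "('a, 'm) ring_scheme \<Rightarrow> 'a \<Rightarrow> bool" where
  "central A z \<longleftrightarrow> z \<in> carrier A \<and> (\<forall>y\<in>carrier A. z \<otimes>\<^bsub>A\<^esub> y = y \<otimes>\<^bsub>A\<^esub> z)"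

definition admissible :: "deformation \<Rightarrow> bool" where
  "admissible R \<longleftrightarrow>
     (\<forall>l a n c. (\<Sum>b\<in>UNIV. \<Sum>m\<in>UNIV. cnj (R l a b m) * R m b c n) = of_bool (l = n \<and> a = c)) \<and>
     yang_baxter R \<and>
     central (deformed_alg R) (sq_norm (deformed_alg R) (\<lambda>l. deformed_gen R (X1 l))) \<and>
     central (deformed_alg R) (sq_norm (deformed_alg R) (\<lambda>a. deformed_gen R (X2 a)))"


section \<open>The noncommutative spheres\<close>

definition sphere_ideal :: "deformation \<Rightarrow> free set set" where
  "sphere_ideal R = Idl\<^bsub>deformed_alg R\<^esub>
     {(sq_norm (deformed_alg R) (\<lambda>l. deformed_gen R (X1 l))
       \<oplus>\<^bsub>deformed_alg R\<^esub> sq_norm (deformed_alg R) (\<lambda>a. deformed_gen R (X2 a)))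
       \<ominus>\<^bsub>deformed_alg R\<^esub> \<one>\<^bsub>deformed_alg R\<^esub>}"

definition seven_sphere :: "deformation \<Rightarrow> free set set star_alg" where
  "seven_sphere R = star_quotient (deformed_alg R) (sphere_ideal R)"

definition sphere_gen :: "deformation \<Rightarrow> gen \<Rightarrow> free set set" where
  "sphere_gen R a = sphere_ideal R +>\<^bsub>deformed_alg R\<^esub> deformed_gen R a"

text \<open>\<open>quat_x R X1\<close> and \<open>quat_x R X2\<close> are the quaternions \<open>x\<^sub>1\<close> and \<open>x\<^sub>2\<close>.\<close>

definition quat_x :: "deformation \<Rightarrow> (4 \<Rightarrow> gen) \<Rightarrow> 4 \<Rightarrow> free set set" where
  "quat_x R i = (\<lambda>\<mu>. sphere_gen R (i \<mu>))"

definition quat_Y :: "deformation \<Rightarrow> 4 \<Rightarrow> free set set" where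
  "quat_Y R = (\<lambda>\<mu>. 2 \<odot>\<^bsub>seven_sphere R\<^esub>
     quat_mult (seven_sphere R) (quat_x R X2) (quat_star (seven_sphere R) (quat_x R X1)) \<mu>)"

definition last_Y :: "deformation \<Rightarrow> free set set" where
  "last_Y R = sq_norm (seven_sphere R) (quat_x R X2)
     \<ominus>\<^bsub>seven_sphere R\<^esub> sq_norm (seven_sphere R) (quat_x R X1)"

definition four_sphere :: "deformation \<Rightarrow> free set set set" where
  "four_sphere R = generated_star_subalgebra (seven_sphere R) (insert (last_Y R) (range (quat_Y R)))"

definition unit_quaternion_action ::
    "deformation \<Rightarrow> ((4 \<Rightarrow> real) \<Rightarrow> free set set \<Rightarrow> free set set) \<Rightarrow> bool" where
  "unit_quaternion_action R \<alpha> \<longleftrightarrow>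
     group_action U1H (carrier (seven_sphere R)) \<alpha> \<and>
     (\<forall>w\<in>carrier U1H. \<alpha> w \<in> star_hom (seven_sphere R) (seven_sphere R) \<and>
        (\<forall>i\<in>{X1, X2}. \<forall>\<mu>. \<alpha> w (quat_x R i \<mu>) =
           quat_mult (seven_sphere R) (quat_x R i) (quat_of_real (seven_sphere R) w) \<mu>))"


section \<open>Tensor products\<close>

text \<open>
  \<open>tensor_group M N S r l\<close> is the tensor product of the additive groups of \<open>M\<close> and \<open>N\<close>, balanced
  over the set \<open>S\<close> acting on \<open>M\<close> from the right by \<open>r\<close> and on \<open>N\<close> from the left by \<open>l\<close>: the free
  abelian group on pairs modulo the subgroup generated by the usual relations. Its group operation
  is written multiplicatively.
\<close>

definition tensor_relations ::
    "('a, 'm) ring_scheme \<Rightarrow> ('b, 'n) ring_scheme \<Rightarrow> 's set \<Rightarrow> ('a \<Rightarrow> 's \<Rightarrow> 'a) \<Rightarrow> ('s \<Rightarrow> 'b \<Rightarrow> 'b)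
     \<Rightarrow> ('a \<times> 'b \<Rightarrow>\<^sub>0 int) set" where
  "tensor_relations M N S r l =
     {frag_of (m \<oplus>\<^bsub>M\<^esub> m', n) - frag_of (m, n) - frag_of (m', n) | m m' n.
        m \<in> carrier M \<and> m' \<in> carrier M \<and> n \<in> carrier N} \<union>
     {frag_of (m, n \<oplus>\<^bsub>N\<^esub> n') - frag_of (m, n) - frag_of (m, n') | m n n'.
        m \<in> carrier M \<and> n \<in> carrier N \<and> n' \<in> carrier N} \<union>
     {frag_of (r m s, n) - frag_of (m, l s n) | m s n.
        m \<in> carrier M \<and> s \<in> S \<and> n \<in> carrier N}"

definition tensor_kernel ::
    "('a, 'm) ring_scheme \<Rightarrow> ('b, 'n) ring_scheme \<Rightarrow> 's set \<Rightarrow> ('a \<Rightarrow> 's \<Rightarrow> 'a) \<Rightarrow> ('s \<Rightarrow> 'b \<Rightarrow> 'b)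
     \<Rightarrow> ('a \<times> 'b \<Rightarrow>\<^sub>0 int) set" where
  "tensor_kernel M N S r l =
     generate (free_Abelian_group (carrier M \<times> carrier N)) (tensor_relations M N S r l)"

definition tensor_group ::
    "('a, 'm) ring_scheme \<Rightarrow> ('b, 'n) ring_scheme \<Rightarrow> 's set \<Rightarrow> ('a \<Rightarrow> 's \<Rightarrow> 'a) \<Rightarrow> ('s \<Rightarrow> 'b \<Rightarrow> 'b)
     \<Rightarrow> ('a \<times> 'b \<Rightarrow>\<^sub>0 int) set monoid" where
  "tensor_group M N S r l =
     free_Abelian_group (carrier M \<times> carrier N) Mod tensor_kernel M N S r l"

definition tensor_class ::
    "('a, 'm) ring_scheme \<Rightarrow> ('b, 'n) ring_scheme \<Rightarrow> 's set \<Rightarrow> ('a \<Rightarrow> 's \<Rightarrow> 'a) \<Rightarrow> ('s \<Rightarrow> 'b \<Rightarrow> 'b)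
     \<Rightarrow> ('a \<times> 'b \<Rightarrow>\<^sub>0 int) \<Rightarrow> ('a \<times> 'b \<Rightarrow>\<^sub>0 int) set" where
  "tensor_class M N S r l t =
     tensor_kernel M N S r l #>\<^bsub>free_Abelian_group (carrier M \<times> carrier N)\<^esub> t"

definition subring_tensor_group ::
    "('a, 'm) ring_scheme \<Rightarrow> 'a set \<Rightarrow> ('a \<times> 'a \<Rightarrow>\<^sub>0 int) set monoid" where
  "subring_tensor_group P B = tensor_group P P B (\<otimes>\<^bsub>P\<^esub>) (\<otimes>\<^bsub>P\<^esub>)"

definition subring_tensor ::
    "('a, 'm) ring_scheme \<Rightarrow> 'a set \<Rightarrow> 'a \<Rightarrow> 'a \<Rightarrow> ('a \<times> 'a \<Rightarrow>\<^sub>0 int) set" where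
  "subring_tensor P B p q = tensor_class P P B (\<otimes>\<^bsub>P\<^esub>) (\<otimes>\<^bsub>P\<^esub>) (frag_of (p, q))"

text \<open>
  The tensor product over the complex numbers of two \<open>*\<close>-algebras, with product
  \<open>(a \<otimes> b)(a' \<otimes> b') = aa' \<otimes> bb'\<close> and involution \<open>(a \<otimes> b)\<^sup>* = a\<^sup>* \<otimes> b\<^sup>*\<close> extended
  additively to formal sums.
\<close>

definition complex_tensor_class ::
    "('a, 'm) star_alg_scheme \<Rightarrow> ('b, 'n) star_alg_scheme
     \<Rightarrow> ('a \<times> 'b \<Rightarrow>\<^sub>0 int) \<Rightarrow> ('a \<times> 'b \<Rightarrow>\<^sub>0 int) set" where
  "complex_tensor_class A B = tensor_class A B UNIV (\<lambda>a c. c \<odot>\<^bsub>A\<^esub> a) (\<lambda>c b. c \<odot>\<^bsub>B\<^esub> b)"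

definition complex_tensor ::
    "('a, 'm) star_alg_scheme \<Rightarrow> ('b, 'n) star_alg_scheme \<Rightarrow> 'a \<Rightarrow> 'b \<Rightarrow> ('a \<times> 'b \<Rightarrow>\<^sub>0 int) set" where
  "complex_tensor A B a b = complex_tensor_class A B (frag_of (a, b))"

definition formal_mult ::
    "('a, 'm) star_alg_scheme \<Rightarrow> ('b, 'n) star_alg_scheme
     \<Rightarrow> ('a \<times> 'b \<Rightarrow>\<^sub>0 int) \<Rightarrow> ('a \<times> 'b \<Rightarrow>\<^sub>0 int) \<Rightarrow> ('a \<times> 'b \<Rightarrow>\<^sub>0 int)" where
  "formal_mult A B s t =
     frag_extend (\<lambda>(a, b). frag_extend (\<lambda>(a', b'). frag_of (a \<otimes>\<^bsub>A\<^esub> a', b \<otimes>\<^bsub>B\<^esub> b')) t) s"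

definition tensor_alg ::
    "('a, 'm) star_alg_scheme \<Rightarrow> ('b, 'n) star_alg_scheme \<Rightarrow> ('a \<times> 'b \<Rightarrow>\<^sub>0 int) set star_alg" where
  "tensor_alg A B =
     (let T = tensor_group A B UNIV (\<lambda>a c. c \<odot>\<^bsub>A\<^esub> a) (\<lambda>c b. c \<odot>\<^bsub>B\<^esub> b)
      in \<lparr>carrier = carrier T,
          mult = (\<lambda>X Y. \<Union>s\<in>X. \<Union>t\<in>Y. complex_tensor_class A B (formal_mult A B s t)),
          one = complex_tensor A B \<one>\<^bsub>A\<^esub> \<one>\<^bsub>B\<^esub>,
          zero = \<one>\<^bsub>T\<^esub>,
          add = (\<otimes>\<^bsub>T\<^esub>),
          smult = (\<lambda>c X. \<Union>t\<in>X.
            complex_tensor_class A B (frag_extend (\<lambda>(a, b). frag_of (c \<odot>\<^bsub>A\<^esub> a, b)) t)),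
          star = (\<lambda>X. \<Union>t\<in>X.
            complex_tensor_class A B (frag_extend (\<lambda>(a, b). frag_of (star A a, star B b)) t))\<rparr>)"


section \<open>The coaction and the canonical map\<close>

definition function_alg :: "'x set \<Rightarrow> ('x \<Rightarrow> complex) star_alg" where
  "function_alg U =
     \<lparr>carrier = extensional U,
      mult = (\<lambda>f g. \<lambda>w\<in>U. f w * g w), one = (\<lambda>w\<in>U. 1),
      zero = (\<lambda>w\<in>U. 0), add = (\<lambda>f g. \<lambda>w\<in>U. f w + g w),
      smult = (\<lambda>c f. \<lambda>w\<in>U. c * f w), star = (\<lambda>f. \<lambda>w\<in>U. cnj (f w))\<rparr>"

definition coord :: "4 \<Rightarrow> (4 \<Rightarrow> real) \<Rightarrow> complex" where
  "coord \<rho> = (\<lambda>w\<in>carrier U1H. complex_of_real (w \<rho>))"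

text \<open>Polynomial functions on \<open>SU(2)\<close>, identified with the unit quaternions.\<close>

definition SU2_alg :: "((4 \<Rightarrow> real) \<Rightarrow> complex) star_alg" where
  "SU2_alg = function_alg (carrier U1H)
     \<lparr>carrier := generated_star_subalgebra (function_alg (carrier U1H)) (range coord)\<rparr>"

definition coaction ::
    "deformation \<Rightarrow> (free set set \<Rightarrow> (free set set \<times> ((4 \<Rightarrow> real) \<Rightarrow> complex) \<Rightarrow>\<^sub>0 int) set) \<Rightarrow> bool"
  where
  "coaction R \<delta> \<longleftrightarrow>
     \<delta> \<in> star_hom (seven_sphere R) (tensor_alg (seven_sphere R) SU2_alg) \<and>
     (\<forall>i\<in>{X1, X2}. \<forall>\<mu>. \<delta> (quat_x R i \<mu>) =
        (\<Oplus>\<^bsub>tensor_alg (seven_sphere R) SU2_alg\<^esub>\<nu>\<in>UNIV.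
         \<Oplus>\<^bsub>tensor_alg (seven_sphere R) SU2_alg\<^esub>\<rho>\<in>UNIV.
           complex_of_real (quat_coeff \<mu> \<nu> \<rho>) \<odot>\<^bsub>tensor_alg (seven_sphere R) SU2_alg\<^esub>
             complex_tensor (seven_sphere R) SU2_alg (quat_x R i \<nu>) (coord \<rho>)))"

text \<open>An additive map is determined by its values on the elements \<open>p' \<otimes> p\<close>.\<close>

definition canonical_map ::
    "deformation \<Rightarrow> (free set set \<Rightarrow> (free set set \<times> ((4 \<Rightarrow> real) \<Rightarrow> complex) \<Rightarrow>\<^sub>0 int) set)
     \<Rightarrow> ((free set set \<times> free set set \<Rightarrow>\<^sub>0 int) set
         \<Rightarrow> (free set set \<times> ((4 \<Rightarrow> real) \<Rightarrow> complex) \<Rightarrow>\<^sub>0 int) set) \<Rightarrow> bool"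
  where
  "canonical_map R \<delta> \<chi> \<longleftrightarrow>
     \<chi> \<in> hom (subring_tensor_group (seven_sphere R) (four_sphere R))
             (add_monoid (tensor_alg (seven_sphere R) SU2_alg)) \<and>
     (\<forall>p'\<in>carrier (seven_sphere R). \<forall>p\<in>carrier (seven_sphere R).
        \<chi> (subring_tensor (seven_sphere R) (four_sphere R) p' p) =
          complex_tensor (seven_sphere R) SU2_alg p' \<one>\<^bsub>SU2_alg\<^esub>
            \<otimes>\<^bsub>tensor_alg (seven_sphere R) SU2_alg\<^esub> \<delta> p)"

end

theory Submission
  imports Defs "HOL-Library.Multiset"
begin

text \<open>
  The right-hand side of the canonical map is handled through evaluation. A unit quaternion \<open>v\<close> turns
  \<open>a \<otimes> h\<close> into \<open>h(v) a\<close>, and an element of \<open>A(S\<^sup>7) \<otimes> H\<close> is determined by the function of \<open>v\<close> that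
  it gives in this way: if \<open>a\<^sub>1 \<otimes> h\<^sub>1 + \<dots> + a\<^sub>n \<otimes> h\<^sub>n\<close> evaluates to zero everywhere and \<open>h\<^sub>1(u) \<noteq> 0\<close>, the
  equation at \<open>u\<close> eliminates \<open>a\<^sub>1\<close> (\<open>ev_injective\<close>). So the tensor product becomes an algebra of functions
  with values in \<open>A(S\<^sup>7)\<close>. The coaction of \<open>p\<close> is the function \<open>v \<mapsto> \<alpha>\<^sub>v(p)\<close>; it exists because that function comes
  from a tensor when \<open>p\<close> is a generator, hence for every \<open>p\<close> (\<open>polynomial_orbits\<close>). The canonical map
  sends \<open>p' \<otimes> p\<close> to \<open>v \<mapsto> p' \<alpha>\<^sub>v(p)\<close>, and it is well defined because \<open>\<alpha>\<^sub>v\<close> fixes the four-sphere: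
  \<open>(x\<^sub>2 v)(x\<^sub>1 v)\<^sup>* = x\<^sub>2 x\<^sub>1\<^sup>*\<close>.

  Surjectivity rests on \<open>x\<^sub>1\<^sup>* x\<^sub>1 + x\<^sub>2\<^sup>* x\<^sub>2 = 1\<close>: it writes the quaternion \<open>v\<close> as
  \<open>x\<^sub>1\<^sup>* (x\<^sub>1 v) + x\<^sub>2\<^sup>* (x\<^sub>2 v)\<close>, so the coordinates of \<open>v\<close> are in the image, and products of functions that
  multiply the image into itself do so again (\<open>image_multiplier_poly\<close>).

  Injectivity is the main point. Write \<open>x = x\<^sub>1\<close>, \<open>y = x\<^sub>2\<close>, \<open>r = \<parallel>x\<parallel>\<^sup>2\<close> and \<open>b = y x\<^sup>*\<close>; the entries of \<open>x\<close> commute with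
  each other and \<open>r\<close> is central.

  \<^item> Applying \<open>\<alpha>\<^sub>v\<close> to the exchange relation between \<open>x\<close> and \<open>y\<close> gives an identity that is quadratic in
    \<open>v\<close> and holds for every unit quaternion. Such an identity stays true when commuting elements are
    substituted for the coordinates of \<open>v\<close> (\<open>sphere_substitution\<close>). Substituting \<open>x\<^sup>*\<close> yields
    \<open>x b\<^sup>a x\<^sup>* = \<Sum>\<^sub>c R\<^sup>\<cdot>\<^sup>a\<^sub>c\<^sub>0 b\<^sup>c r\<close> (\<open>conj_pair\<close>).

  \<^item> Hence \<open>x b x\<^sup>*\<close> has entries in the four-sphere for every \<open>b\<close> in it, after multiplication with a power of
    \<open>r\<close> (\<open>conj_x_mem_B\<close>). As \<open>x b r = (x b x\<^sup>*) x\<close> and \<open>y r = (y x\<^sup>*) x\<close>, a power of \<open>r\<close> moves every word of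
    length \<open>n\<close> in the generators into the left module over the four-sphere spanned by the words of length
    \<open>n\<close> in the entries of \<open>x\<close> alone (\<open>r_power_mem_graded_span\<close>).

  \<^item> So an element of the balanced tensor product becomes \<open>\<Sum> a\<^sub>I \<otimes> x\<^sup>I\<close> after multiplication with a power of
    \<open>r\<close>. If the canonical map kills it, then \<open>\<Sum> a\<^sub>I (x v)\<^sup>I = 0\<close> for all unit quaternions \<open>v\<close>. Now
    \<open>x\<^sup>* \<otimes> x\<close>, whose entries commute, is substituted for \<open>v\<close>: since \<open>x x\<^sup>* = r\<close>, this turns \<open>(x v)\<^sup>I\<close> into
    \<open>r\<^sup>n \<otimes> x\<^sup>I\<close>, and \<open>\<Sum> a\<^sub>I r\<^sup>n \<otimes> x\<^sup>I = 0\<close> follows (\<open>vanishing_imp_torsion\<close>).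

  Thus the kernel consists of elements killed by a power of \<open>\<parallel>x\<^sub>1\<parallel>\<^sup>2\<close> and, exchanging the two quaternions,
  by a power of \<open>\<parallel>x\<^sub>2\<parallel>\<^sup>2\<close>. As \<open>\<parallel>x\<^sub>1\<parallel>\<^sup>2 + \<parallel>x\<^sub>2\<parallel>\<^sup>2 = 1\<close>, the kernel is zero (\<open>comaximal_powers\<close>).

  Computations take place in the free algebra, modulo the kernel \<open>J\<close> of the projection to \<open>A(S\<^sup>7)\<close>, and in
  the group of formal sums of pairs, modulo the relations of a tensor product. This keeps sums over
  indices within the type classes of rings and abelian groups.
\<close>

section \<open>Star algebras and their quotients\<close>

locale star_algebra = ring A for A :: "('a, 'm) star_alg_scheme" (structure) +
  assumes smult_closed [simp, intro]: "x \<in> carrier A \<Longrightarrow> c \<odot> x \<in> carrier A"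
    and smult_add: "\<lbrakk>x \<in> carrier A; y \<in> carrier A\<rbrakk> \<Longrightarrow> c \<odot> (x \<oplus> y) = c \<odot> x \<oplus> c \<odot> y"
    and smult_add_scalar: "x \<in> carrier A \<Longrightarrow> (c + d) \<odot> x = c \<odot> x \<oplus> d \<odot> x"
    and smult_smult: "x \<in> carrier A \<Longrightarrow> c \<odot> (d \<odot> x) = (c * d) \<odot> x"
    and smult_one: "x \<in> carrier A \<Longrightarrow> 1 \<odot> x = x"
    and smult_mult: "\<lbrakk>x \<in> carrier A; y \<in> carrier A\<rbrakk> \<Longrightarrow> c \<odot> (x \<otimes> y) = (c \<odot> x) \<otimes> y"
    and mult_smult: "\<lbrakk>x \<in> carrier A; y \<in> carrier A\<rbrakk> \<Longrightarrow> c \<odot> (x \<otimes> y) = x \<otimes> (c \<odot> y)"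
    and star_closed [simp, intro]: "x \<in> carrier A \<Longrightarrow> star A x \<in> carrier A"
    and star_add: "\<lbrakk>x \<in> carrier A; y \<in> carrier A\<rbrakk> \<Longrightarrow> star A (x \<oplus> y) = star A x \<oplus> star A y"
    and star_mult: "\<lbrakk>x \<in> carrier A; y \<in> carrier A\<rbrakk> \<Longrightarrow> star A (x \<otimes> y) = star A y \<otimes> star A x"
    and star_smult: "x \<in> carrier A \<Longrightarrow> star A (c \<odot> x) = cnj c \<odot> star A x"
    and star_star: "x \<in> carrier A \<Longrightarrow> star A (star A x) = x"
begin

lemma star_zero: "star A \<zero> = \<zero>"
  by (metis add.r_cancel_one' star_add star_closed zero_closed l_zero)

lemma star_minus: "x \<in> carrier A \<Longrightarrow> star A (\<ominus> x) = \<ominus> star A x"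
  by (metis a_inv_closed minus_equality l_neg star_add star_closed star_zero)

lemma smult_ideal: "ideal J A \<Longrightarrow> x \<in> J \<Longrightarrow> c \<odot> x \<in> J"
  using ideal.I_l_closed[of J A x "c \<odot> \<one>"] ideal.Icarr[of J A x] smult_mult[of \<one> x c] by simp

lemma smult_minus: "x \<in> carrier A \<Longrightarrow> c \<odot> (\<ominus> x) = \<ominus> (c \<odot> x)"
proof -
  assume x: "x \<in> carrier A"
  have "c \<odot> \<zero> = c \<odot> \<zero> \<oplus> c \<odot> \<zero>"
    by (metis l_zero smult_add zero_closed)
  then have "c \<odot> \<zero> = \<zero>"
    by (metis add.r_cancel_one' smult_closed zero_closed)
  then show ?thesis using x
    by (metis a_inv_closed minus_equality l_neg smult_add smult_closed)
qed

text \<open>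
  The elements of the ideal whose adjoint also lies in the ideal form an ideal again, so it suffices to
  look at the generators.
\<close>

lemma genideal_star_closed:
  assumes S: "S \<subseteq> carrier A" and star_S: "\<And>s. s \<in> S \<Longrightarrow> star A s \<in> Idl S"
    and x: "x \<in> Idl S"
  shows "star A x \<in> Idl S"
proof -
  interpret I: ideal "Idl S" A using genideal_ideal[OF S] .
  let ?T = "{x \<in> carrier A. star A x \<in> Idl S}"
  have "ideal ?T A"
  proof (rule idealI[OF ring_axioms])
    show "subgroup ?T (add_monoid A)"
      by (rule add.subgroupI) (auto simp: star_add star_minus I.a_closed star_zero intro!: exI[of _ \<zero>])
  qed (auto simp: star_mult I.I_l_closed I.I_r_closed)
  moreover have "S \<subseteq> ?T" using S star_S by auto
  ultimately have "Idl S \<subseteq> ?T" by (rule genideal_minimal)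
  then show ?thesis using x by auto
qed

end

lemma ring_same_operations:
  assumes "ring A" "carrier B = carrier A" "(\<otimes>\<^bsub>B\<^esub>) = (\<otimes>\<^bsub>A\<^esub>)" "one B = one A"
    "zero B = zero A" "add B = add A"
  shows "ring B"
proof -
  interpret ring A by fact
  show ?thesis
  proof (rule ringI)
    show "abelian_group B"
    proof (rule abelian_groupI)
      show "\<exists>y\<in>carrier B. y \<oplus>\<^bsub>B\<^esub> x = \<zero>\<^bsub>B\<^esub>" if "x \<in> carrier B" for x
        using that l_neg[of x] a_inv_closed[of x] unfolding assms(2-6) by blast
    qed (simp_all add: assms(2-6) a_ac)
    show "Group.monoid B"
      by (rule monoidI) (simp_all add: assms(2-6) m_assoc)
  qed (simp_all add: assms(2-6) l_distr r_distr)
qed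

lemma coset_eq_iff:
  assumes "ideal J A" "x \<in> carrier A" "y \<in> carrier A"
  shows "J +>\<^bsub>A\<^esub> x = J +>\<^bsub>A\<^esub> y \<longleftrightarrow> x \<ominus>\<^bsub>A\<^esub> y \<in> J"
proof -
  interpret ideal J A by fact
  have "J +>\<^bsub>A\<^esub> x = J +>\<^bsub>A\<^esub> y \<longleftrightarrow> x \<in> J +>\<^bsub>A\<^esub> y"
    using a_rcos_self[OF assms(2)] a_repr_independence'[OF _ assms(3), of x] by blast
  then show ?thesis
    using a_rcos_module_minus[OF ring_axioms] assms(2,3) by simp
qed

text \<open>
  The quotient and tensor algebras define their operations as unions over all representatives of a class.
  This reduces such a union to one representative.
\<close>

lemma UN_const_on:
  assumes "x \<in> X" "\<And>y. y \<in> X \<Longrightarrow> F y = F x"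
  shows "(\<Union>y\<in>X. F y) = F x"
  using assms by blast

lemma star_quotient_algebra:
  fixes A :: "('a, 'm) star_alg_scheme" (structure)
  assumes "star_algebra A" "ideal J A" and J: "\<And>x. x \<in> J \<Longrightarrow> star A x \<in> J"
  shows "star_algebra (star_quotient A J)" (is "star_algebra ?Q")
    and "(+>\<^bsub>A\<^esub>) J \<in> star_hom A (star_quotient A J)"
    and "carrier (star_quotient A J) = (+>\<^bsub>A\<^esub>) J ` carrier A"
proof -
  interpret star_algebra A by fact
  interpret ideal J A by fact
  let ?p = "(+>) J"
  have eq: "J +> x = J +> y" if "x \<ominus> y \<in> J" "x \<in> carrier A" "y \<in> carrier A" for x y
    using coset_eq_iff[OF assms(2)] that by blast
  have mem: "y \<in> carrier A \<and> y \<ominus> x \<in> J" if "y \<in> J +> x" "x \<in> carrier A" for x y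
    using that a_rcos_module_minus[OF ring_axioms] a_r_coset_subset_G[OF a_subset] by blast
  have self: "x \<in> J +> x" if "x \<in> carrier A" for x
    using that by (rule a_rcos_self)
  have add: "?p x \<oplus>\<^bsub>?Q\<^esub> ?p y = ?p (x \<oplus> y)" if "x \<in> carrier A" "y \<in> carrier A" for x y
    using that by (simp add: star_quotient_def FactRing_def a_rcos_sum)
  have mult: "?p x \<otimes>\<^bsub>?Q\<^esub> ?p y = ?p (x \<otimes> y)" if "x \<in> carrier A" "y \<in> carrier A" for x y
    using that by (simp add: star_quotient_def FactRing_def rcoset_mult_add)
  have one: "\<one>\<^bsub>?Q\<^esub> = ?p \<one>" by (simp add: star_quotient_def FactRing_def)
  have smult: "c \<odot>\<^bsub>?Q\<^esub> ?p x = ?p (c \<odot> x)" if x: "x \<in> carrier A" for c x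
  proof -
    have "J +> (c \<odot> y) = J +> (c \<odot> x)" if y: "y \<in> J +> x" for y
    proof (rule eq)
      have "c \<odot> y \<ominus> c \<odot> x = c \<odot> (y \<ominus> x)"
        using mem[OF y x] x by (simp add: a_minus_def smult_add smult_minus)
      then show "c \<odot> y \<ominus> c \<odot> x \<in> J"
        using smult_ideal[OF assms(2)] mem[OF y x] by simp
    qed (use mem[OF y x] x in auto)
    then have "(\<Union>y\<in>J +> x. J +> (c \<odot> y)) = J +> (c \<odot> x)"
      by (rule UN_const_on[OF self[OF x]])
    then show ?thesis by (simp add: star_quotient_def)
  qed
  have star: "star ?Q (?p x) = ?p (star A x)" if x: "x \<in> carrier A" for x
  proof -
    have "J +> star A y = J +> star A x" if y: "y \<in> J +> x" for y
    proof (rule eq)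
      have "star A y \<ominus> star A x = star A (y \<ominus> x)"
        using mem[OF y x] x by (simp add: a_minus_def star_add star_minus)
      then show "star A y \<ominus> star A x \<in> J"
        using J mem[OF y x] by simp
    qed (use mem[OF y x] x in auto)
    then have "(\<Union>y\<in>J +> x. J +> star A y) = J +> star A x"
      by (rule UN_const_on[OF self[OF x]])
    then show ?thesis by (simp add: star_quotient_def)
  qed
  show carrier: "carrier ?Q = ?p ` carrier A"
    by (auto simp: star_quotient_def FactRing_def A_RCOSETS_def RCOSETS_def a_r_coset_def)
  have "ring ?Q"
    by (rule ring_same_operations[OF quotient_is_ring]) (auto simp: star_quotient_def)
  then interpret Q: ring ?Q .
  show "?p \<in> star_hom A ?Q"
    by (auto simp: star_hom_def ring_hom_def carrier simp del: One_nat_def simp flip: add mult one smult star)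
  show "star_algebra ?Q"
    by unfold_locales
      (auto simp: carrier add mult one smult star smult_add smult_add_scalar smult_smult smult_one
        star_add star_mult star_smult star_star simp flip: smult_mult mult_smult)
qed

section \<open>The free algebra\<close>

lemma UNIV_4: "(UNIV :: 4 set) = {0, 1, 2, 3}"
proof -
  have "card {0, 1, 2, 3 :: 4} = CARD(4)"
    by simp
  then show ?thesis
    by (metis card_subset_eq finite_class.finite_UNIV subset_UNIV)
qed

lemma sum_4: "(\<Sum>i\<in>(UNIV :: 4 set). f i) = f 0 + f 1 + f 2 + f 3"
proof -
  have "(0::4) \<notin> {1, 2, 3}" "(1::4) \<notin> {2, 3}" "(2::4) \<notin> {3}"
    by simp_all
  then show ?thesis
    unfolding UNIV_4 by (simp only: sum.insert finite_insert finite.emptyI sum.empty empty_iff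
      not_False_eq_True simp_thms add.assoc add_0_right)
qed

lemma all_4: "(\<forall>i::4. P i) \<longleftrightarrow> P 0 \<and> P 1 \<and> P 2 \<and> P 3"
proof -
  have "(\<forall>i::4. P i) \<longleftrightarrow> (\<forall>i\<in>{0, 1, 2, 3}. P i)"
    unfolding UNIV_4[symmetric] by blast
  then show ?thesis by simp
qed

lemma scalar_add: "scalar (c + d) = scalar c + scalar d"
  by (simp add: single_add)

lemma scalar_mult: "scalar (c * d) = scalar c * scalar d"
  by (simp add: mult_single plus_list_def)

lemma scalar_diff: "scalar (c - d) = scalar c - scalar d"
  by (simp add: single_diff)

lemma scalar_uminus: "scalar (- c) = - scalar c"
  by (simp add: single_uminus)

lemma scalar_1: "scalar 1 = 1"
  by (metis single_one zero_list_def)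

lemma free_additive_induct [case_names single add]:
  fixes f :: free
  assumes "\<And>u c. P (Poly_Mapping.single u c)" "\<And>f g. P f \<Longrightarrow> P g \<Longrightarrow> P (f + g)"
  shows "P f"
proof (induction f rule: update_induct)
  case const
  show ?case using assms(1)[of "[]" 0] by simp
next
  case (update f a b)
  then have "Poly_Mapping.update a b f = Poly_Mapping.single a b + f"
    by (intro poly_mapping_eqI) (auto simp: lookup_update lookup_add lookup_single when_def in_keys_iff)
  then show ?case using assms update by simp
qed

lemma scalar_commute: "f * scalar c = scalar c * (f :: free)"
  by (induction f rule: free_additive_induct)
    (auto simp: mult_single plus_list_def distrib_left distrib_right mult.commute)

lemma scalar_left_commute: "f * (scalar c * g) = scalar c * (f * (g :: free))"
  by (metis mult.assoc scalar_commute)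

lemma free_induct [case_names scalar gen_mult add]:
  fixes f :: free
  assumes scalar: "\<And>c. P (scalar c)"
    and gen_mult: "\<And>a f. P f \<Longrightarrow> P (free_gen a * f)"
    and add: "\<And>f g. P f \<Longrightarrow> P g \<Longrightarrow> P (f + g)"
  shows "P f"
proof (induction f rule: free_additive_induct)
  case (single u c)
  show ?case
  proof (induction u)
    case (Cons a u)
    then show ?case
      using gen_mult[of "Poly_Mapping.single u c" a] by (simp add: free_gen_def mult_single plus_list_def)
  qed (rule scalar)
qed (rule add)

text \<open>
  Real scalars: the structure constants of the quaternions and the coordinates of a unit quaternion are real.
\<close>

abbreviation rs :: "real \<Rightarrow> free" where "rs t \<equiv> scalar (complex_of_real t)"

abbreviation free_star :: "free \<Rightarrow> free" where "free_star \<equiv> star free_alg"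

lemma map_key_rev_single: "Poly_Mapping.map_key rev (Poly_Mapping.single u c) = Poly_Mapping.single (rev u) c"
  by (metis inj_on_rev map_key_single rev_rev_ident)

lemma free_star_single: "free_star (Poly_Mapping.single u c) = Poly_Mapping.single (rev u) (cnj c)"
  by (simp add: free_alg_def map_key_rev_single)

lemma free_star_scalar: "free_star (scalar c) = scalar (cnj c)"
  by (simp add: free_star_single)

lemma free_star_gen: "free_star (free_gen a) = free_gen a"
  by (simp add: free_gen_def free_star_single)

lemma free_star_add: "free_star (f + g) = free_star f + free_star g"
proof -
  have "Poly_Mapping.map cnj (f + g) = Poly_Mapping.map cnj f + Poly_Mapping.map cnj g"
    by (intro poly_mapping_eqI)
      (simp add: lookup_add Poly_Mapping.map.rep_eq when_def flip: complex_cnj_add)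
  then show ?thesis by (simp add: free_alg_def map_key_plus)
qed

lemma free_star_mult: "free_star (f * g) = free_star g * free_star f"
proof (induction f rule: free_additive_induct)
  case (single u c)
  show ?case
    by (induction g rule: free_additive_induct)
      (auto simp: mult_single free_star_single free_star_add plus_list_def distrib_left distrib_right
        mult.commute)
qed (auto simp: distrib_left distrib_right free_star_add)

lemma free_star_star: "free_star (free_star f) = f"
  by (induction f rule: free_additive_induct) (auto simp: free_star_single free_star_add)

lemma free_star_0: "free_star 0 = 0"
  using free_star_scalar[of 0] by simp

lemma free_star_1: "free_star 1 = 1"
  using free_star_scalar[of 1] by (simp add: scalar_1)

lemma free_star_minus: "free_star (- f) = - free_star f"
  by (metis add_eq_0_iff free_star_0 free_star_add)

lemma free_star_sum: "free_star (sum f I) = (\<Sum>i\<in>I. free_star (f i))"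
  by (induction I rule: infinite_finite_induct) (auto simp: free_star_add free_star_0)

lemma free_alg_simps [simp]:
  "carrier free_alg = UNIV" "(\<otimes>\<^bsub>free_alg\<^esub>) = (*)" "one free_alg = 1" "zero free_alg = 0"
  "add free_alg = (+)" "smult free_alg c f = scalar c * f"
  by (simp_all add: free_alg_def)

interpretation free_alg: star_algebra free_alg
proof -
  have "ring free_alg"
  proof (rule ringI)
    show "abelian_group free_alg"
    proof (rule abelian_groupI)
      show "\<exists>y\<in>carrier free_alg. y \<oplus>\<^bsub>free_alg\<^esub> x = \<zero>\<^bsub>free_alg\<^esub>" for x
        by (rule bexI[of _ "- x"]) simp_all
    qed (simp_all add: add_ac)
    show "Group.monoid free_alg" by (rule monoidI) (simp_all add: mult.assoc)
  qed (simp_all add: distrib_left distrib_right)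
  then interpret ring free_alg .
  show "star_algebra free_alg"
  proof unfold_locales
    fix f g :: free and c
    show "c \<odot>\<^bsub>free_alg\<^esub> (f \<otimes>\<^bsub>free_alg\<^esub> g) = f \<otimes>\<^bsub>free_alg\<^esub> (c \<odot>\<^bsub>free_alg\<^esub> g)"
      by (simp add: mult.assoc[symmetric] scalar_commute)
    show "free_star (c \<odot>\<^bsub>free_alg\<^esub> f) = cnj c \<odot>\<^bsub>free_alg\<^esub> free_star f"
      by (simp add: free_star_mult free_star_scalar scalar_commute)
  qed (simp_all add: distrib_left distrib_right scalar_add scalar_mult mult.assoc scalar_1
      free_star_add free_star_mult free_star_star)
qed

lemma free_alg_minus [simp]: "\<ominus>\<^bsub>free_alg\<^esub> f = - f" "f \<ominus>\<^bsub>free_alg\<^esub> g = f - g"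
proof -
  show 1: "\<ominus>\<^bsub>free_alg\<^esub> f = - f" for f
    using free_alg.minus_equality[of "- f" f] by simp
  show "f \<ominus>\<^bsub>free_alg\<^esub> g = f - g"
    by (simp add: a_minus_def 1)
qed


definition subst :: "(gen \<Rightarrow> free) \<Rightarrow> free \<Rightarrow> free" where
  "subst s f = (\<Sum>u\<in>Poly_Mapping.keys f. scalar (Poly_Mapping.lookup f u) * prod_list (map s u))"

lemma subst_single: "subst s (Poly_Mapping.single u c) = scalar c * prod_list (map s u)"
  by (simp add: subst_def)

lemma subst_add: "subst s (f + g) = subst s f + subst s g"
proof -
  let ?K = "Poly_Mapping.keys f \<union> Poly_Mapping.keys g"
  have *: "subst s h = (\<Sum>u\<in>?K. scalar (Poly_Mapping.lookup h u) * prod_list (map s u))"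
    if "Poly_Mapping.keys h \<subseteq> ?K" for h
    unfolding subst_def by (rule sum.mono_neutral_left) (use that in \<open>auto simp: in_keys_iff\<close>)
  show ?thesis
    using keys_add[of f g] by (simp add: * lookup_add scalar_add distrib_right sum.distrib)
qed

lemma subst_mult: "subst s (f * g) = subst s f * subst s g"
proof (induction f rule: free_additive_induct)
  case (single u c)
  show ?case
  proof (induction g rule: free_additive_induct)
    case (single v d)
    have "Poly_Mapping.single u c * Poly_Mapping.single v d = Poly_Mapping.single (u @ v) (c * d)"
      by (simp add: mult_single plus_list_def)
    then show ?case
      by (simp add: subst_single scalar_mult mult.assoc scalar_left_commute[of "prod_list (map s u)"])
  qed (auto simp: distrib_left subst_add)
qed (auto simp: distrib_right subst_add)

lemma subst_scalar [simp]: "subst s (scalar c) = scalar c"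
  by (simp add: subst_single)

lemma subst_gen [simp]: "subst s (free_gen a) = s a"
  by (simp add: free_gen_def subst_single scalar_1)

lemma subst_1 [simp]: "subst s 1 = 1"
  using subst_scalar[of s 1] by (simp add: scalar_1)

lemma subst_0 [simp]: "subst s 0 = 0"
  using subst_scalar[of s 0] by simp

lemma subst_uminus: "subst s (- f) = - subst s f"
  by (metis add_eq_0_iff subst_0 subst_add)

lemma subst_sum: "subst s (sum f I) = (\<Sum>i\<in>I. subst s (f i))"
  by (induction I rule: infinite_finite_induct) (auto simp: subst_add)

lemma subst_star:
  assumes "\<And>a. free_star (s a) = s a"
  shows "subst s (free_star f) = free_star (subst s f)"
proof (induction f rule: free_induct)
  case (gen_mult a f)
  then show ?case by (simp add: free_star_mult subst_mult free_star_gen assms)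
qed (auto simp: free_star_scalar free_star_add subst_add)

section \<open>Congruences modulo subgroups and ideals\<close>

definition cong_mod :: "'g::ab_group_add \<Rightarrow> 'g set \<Rightarrow> 'g \<Rightarrow> bool" (\<open>(_/ \<simeq>[_] _)\<close> [51, 0, 51] 50) where
  "a \<simeq>[K] b \<longleftrightarrow> a - b \<in> K"


lemma eq_cong_trans [trans]: "a = b \<Longrightarrow> b \<simeq>[K] c \<Longrightarrow> a \<simeq>[K] c"
  and cong_eq_trans [trans]: "a \<simeq>[K] b \<Longrightarrow> b = c \<Longrightarrow> a \<simeq>[K] c"
  by simp_all

locale ab_subgroup =
  fixes K :: "'g::ab_group_add set"
  assumes zero_mem: "0 \<in> K" and diff_mem: "a \<in> K \<Longrightarrow> b \<in> K \<Longrightarrow> a - b \<in> K"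
begin

lemma uminus_mem: "a \<in> K \<Longrightarrow> - a \<in> K"
  using diff_mem[OF zero_mem] by simp

lemma add_mem: "a \<in> K \<Longrightarrow> b \<in> K \<Longrightarrow> a + b \<in> K"
  using diff_mem[of a "- b"] uminus_mem by simp

lemma sum_mem: "(\<And>i. i \<in> I \<Longrightarrow> f i \<in> K) \<Longrightarrow> sum f I \<in> K"
  by (induction I rule: infinite_finite_induct) (auto intro: zero_mem add_mem)

lemma cong_refl [simp, intro]: "a \<simeq>[K] a"
  by (simp add: cong_mod_def zero_mem)

lemma cong_sym: "a \<simeq>[K] b \<Longrightarrow> b \<simeq>[K] a"
  using uminus_mem[of "a - b"] by (simp add: cong_mod_def)

lemma cong_trans [trans]: "a \<simeq>[K] b \<Longrightarrow> b \<simeq>[K] c \<Longrightarrow> a \<simeq>[K] c"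
  using add_mem[of "a - b" "b - c"] by (simp add: cong_mod_def)

lemma cong_0: "a \<simeq>[K] 0 \<longleftrightarrow> a \<in> K"
  by (simp add: cong_mod_def)

lemma cong_mem: "a \<simeq>[K] b \<Longrightarrow> b \<in> K \<Longrightarrow> a \<in> K"
  using add_mem[of "a - b" b] by (simp add: cong_mod_def)

lemma cong_add: "a \<simeq>[K] b \<Longrightarrow> c \<simeq>[K] d \<Longrightarrow> a + c \<simeq>[K] b + d"
  using add_mem[of "a - b" "c - d"] by (simp add: cong_mod_def algebra_simps)

lemma cong_uminus: "a \<simeq>[K] b \<Longrightarrow> - a \<simeq>[K] - b"
  using uminus_mem[of "a - b"] by (simp add: cong_mod_def)

lemma cong_sum: "(\<And>i. i \<in> I \<Longrightarrow> f i \<simeq>[K] g i) \<Longrightarrow> sum f I \<simeq>[K] sum g I"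
  using sum_mem[of I "\<lambda>i. f i - g i"] by (simp add: cong_mod_def sum_subtractf)

text \<open>
  Maps that are additive only modulo a subgroup, such as a tensor symbol in one of its arguments, still
  commute with sums.
\<close>

lemma additive_0:
  fixes \<Phi> :: "'v::ab_group_add \<Rightarrow> 'g"
  assumes "\<And>a b. \<Phi> (a + b) \<simeq>[K] \<Phi> a + \<Phi> b"
  shows "\<Phi> 0 \<in> K"
  using uminus_mem[of "- \<Phi> 0"] assms[of 0 0] by (simp add: cong_mod_def)

lemma additive_sum:
  fixes \<Phi> :: "'v::ab_group_add \<Rightarrow> 'g"
  assumes add: "\<And>a b. \<Phi> (a + b) \<simeq>[K] \<Phi> a + \<Phi> b"
  shows "\<Phi> (sum f I) \<simeq>[K] (\<Sum>i\<in>I. \<Phi> (f i))"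
proof (induction I rule: infinite_finite_induct)
  case (insert i I)
  have "\<Phi> (f i + sum f I) \<simeq>[K] \<Phi> (f i) + (\<Sum>i\<in>I. \<Phi> (f i))"
    using cong_trans[OF add cong_add[OF cong_refl insert.IH]] .
  then show ?case using insert.hyps by simp
qed (use additive_0[OF add] in \<open>simp_all add: cong_0\<close>)

lemma additive_sum_list:
  fixes \<Phi> :: "'v::ab_group_add \<Rightarrow> 'g"
  assumes add: "\<And>a b. \<Phi> (a + b) \<simeq>[K] \<Phi> a + \<Phi> b"
  shows "\<Phi> (\<Sum>i\<leftarrow>is. f i) \<simeq>[K] (\<Sum>i\<leftarrow>is. \<Phi> (f i))"
proof (induction "is")
  case (Cons i "is")
  then show ?case using cong_trans[OF add cong_add[OF cong_refl Cons.IH]] by simp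
qed (use additive_0[OF add] in \<open>simp add: cong_0\<close>)

end

locale free_ideal = ab_subgroup J for J :: "free set" +
  assumes left_mem: "a \<in> J \<Longrightarrow> f * a \<in> J" and right_mem: "a \<in> J \<Longrightarrow> a * f \<in> J"
begin

lemma cong_mult: "a \<simeq>[J] b \<Longrightarrow> c \<simeq>[J] d \<Longrightarrow> a * c \<simeq>[J] b * d"
  using add_mem[OF right_mem[of "a - b" c] left_mem[of "c - d" b]]
  by (simp add: cong_mod_def algebra_simps)

lemma cong_mult_left: "c \<simeq>[J] d \<Longrightarrow> a * c \<simeq>[J] a * d"
  and cong_mult_right: "a \<simeq>[J] b \<Longrightarrow> a * c \<simeq>[J] b * c"
  by (auto intro: cong_mult)

lemma scalar_cancel:
  assumes "scalar c * a \<in> J" "c \<noteq> 0"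
  shows "a \<in> J"
proof -
  have "scalar (inverse c) * (scalar c * a) \<in> J" by (rule left_mem) fact
  then show ?thesis
    using assms(2) by (simp add: scalar_1 flip: mult.assoc scalar_mult)
qed

end

section \<open>Quaternions over the free algebra\<close>

definition free_quat_mult :: "(4 \<Rightarrow> free) \<Rightarrow> (4 \<Rightarrow> free) \<Rightarrow> 4 \<Rightarrow> free" (infixl \<open>\<bullet>\<close> 70) where
  "p \<bullet> q = (\<lambda>\<mu>. \<Sum>\<nu>\<in>UNIV. \<Sum>\<rho>\<in>UNIV. rs (quat_coeff \<mu> \<nu> \<rho>) * (p \<nu> * q \<rho>))"

definition conj_sign :: "4 \<Rightarrow> real" where
  "conj_sign \<mu> = (if \<mu> = 0 then 1 else - 1)"

definition quat_conj :: "(4 \<Rightarrow> free) \<Rightarrow> 4 \<Rightarrow> free" where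
  "quat_conj p = (\<lambda>\<mu>. rs (conj_sign \<mu>) * p \<mu>)"

definition quat_real :: "(4 \<Rightarrow> real) \<Rightarrow> 4 \<Rightarrow> free" where
  "quat_real v = (\<lambda>\<mu>. rs (v \<mu>))"

definition quat_scalar :: "free \<Rightarrow> 4 \<Rightarrow> free" where
  "quat_scalar a = (\<lambda>\<mu>. if \<mu> = 0 then a else 0)"

definition norm_sq :: "(4 \<Rightarrow> free) \<Rightarrow> free" where
  "norm_sq p = (\<Sum>\<mu>\<in>UNIV. p \<mu> * p \<mu>)"

definition unit_sphere :: "(4 \<Rightarrow> real) set" where
  "unit_sphere = {v. (\<Sum>\<rho>\<in>UNIV. (v \<rho>)\<^sup>2) = 1}"

lemma quat_mult_components:
  "(p \<bullet> q) 0 = p 0 * q 0 - p 1 * q 1 - p 2 * q 2 - p 3 * q 3"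
  "(p \<bullet> q) 1 = p 0 * q 1 + p 1 * q 0 + p 2 * q 3 - p 3 * q 2"
  "(p \<bullet> q) 2 = p 0 * q 2 + p 2 * q 0 + p 3 * q 1 - p 1 * q 3"
  "(p \<bullet> q) 3 = p 0 * q 3 + p 3 * q 0 + p 1 * q 2 - p 2 * q 1"
  by (simp_all add: free_quat_mult_def sum_4 quat_coeff_def levi_civita_def scalar_1 scalar_uminus)

lemma quat_eqI:
  fixes p q :: "4 \<Rightarrow> free"
  assumes "p 0 = q 0" "p 1 = q 1" "p 2 = q 2" "p 3 = q 3"
  shows "p = q"
proof
  have "\<forall>i. p i = q i" unfolding all_4 using assms by blast
  then show "p i = q i" for i by blast
qed

lemma quat_conj_components:
  "quat_conj p 0 = p 0" "quat_conj p 1 = - p 1" "quat_conj p 2 = - p 2" "quat_conj p 3 = - p 3"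
  by (simp_all add: quat_conj_def conj_sign_def scalar_1 scalar_uminus)

lemma quat_scalar_components:
  "quat_scalar a 0 = a" "quat_scalar a 1 = 0" "quat_scalar a 2 = 0" "quat_scalar a 3 = 0"
  by (simp_all add: quat_scalar_def)

lemma quat_mult_assoc: "p \<bullet> q \<bullet> s = p \<bullet> (q \<bullet> s)"
  by (rule quat_eqI) (simp_all only: quat_mult_components algebra_simps)

lemma quat_scalar_mult: "quat_scalar a \<bullet> q = (\<lambda>\<mu>. a * q \<mu>)"
  by (rule quat_eqI) (simp_all add: quat_mult_components quat_scalar_components)

lemma quat_mult_scalar: "q \<bullet> quat_scalar a = (\<lambda>\<mu>. q \<mu> * a)"
  by (rule quat_eqI) (simp_all add: quat_mult_components quat_scalar_components)

lemma quat_mult_left_scalar: "((\<lambda>\<mu>. a * p \<mu>) \<bullet> q) \<mu> = a * (p \<bullet> q) \<mu>"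
  using quat_mult_assoc[of "quat_scalar a" p q] by (simp add: quat_scalar_mult)

text \<open>
  For general entries the conjugation does not reverse products; here the entries of the second factor are
  central.
\<close>

lemma quat_mult_conj_real:
  "quat_conj (p \<bullet> quat_real v) = quat_conj (quat_real v) \<bullet> quat_conj p"
  by (rule quat_eqI)
    (simp_all add: quat_mult_components quat_conj_components quat_real_def scalar_commute[of "p _"] algebra_simps)

lemma quat_real_conj:
  assumes "v \<in> unit_sphere"
  shows "quat_real v \<bullet> quat_conj (quat_real v) = quat_scalar 1"
    and "quat_conj (quat_real v) \<bullet> quat_real v = quat_scalar 1"
proof -
  have "rs (v 0) * rs (v 0) + rs (v 1) * rs (v 1) + rs (v 2) * rs (v 2) + rs (v 3) * rs (v 3)
    = rs (\<Sum>\<rho>\<in>UNIV. (v \<rho>)\<^sup>2)"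
    by (simp add: sum_4 power2_eq_square scalar_add flip: scalar_mult)
  also have "\<dots> = 1"
    using assms by (simp add: unit_sphere_def scalar_1)
  finally have *: "rs (v 0) * rs (v 0) + rs (v 1) * rs (v 1) + rs (v 2) * rs (v 2) + rs (v 3) * rs (v 3) = 1" .
  have commute: "rs a * rs b = rs b * rs a" for a b
    by (simp add: mult.commute flip: scalar_mult)
  note swaps = commute[of "v 3" "v 2"] commute[of "v 3" "v 1"] commute[of "v 2" "v 1"]
    commute[of "v 1" "v 0"] commute[of "v 2" "v 0"] commute[of "v 3" "v 0"]
  show "quat_real v \<bullet> quat_conj (quat_real v) = quat_scalar 1"
    by (rule quat_eqI) (simp_all add: quat_mult_components quat_conj_components
        quat_scalar_components quat_real_def * swaps)
  show "quat_conj (quat_real v) \<bullet> quat_real v = quat_scalar 1"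
    by (rule quat_eqI) (simp_all add: quat_mult_components quat_conj_components
        quat_scalar_components quat_real_def * swaps)
qed

text \<open>
  Conjugation of quaternions reverses products, expressed in structure constants.
\<close>

lemma conj_sign_quat_coeff:
  "conj_sign \<nu> * conj_sign \<rho> * quat_coeff \<mu> \<nu> \<rho> = conj_sign \<mu> * quat_coeff \<mu> \<rho> \<nu>"
proof -
  have "\<forall>\<mu> \<nu> \<rho>. conj_sign \<nu> * conj_sign \<rho> * quat_coeff \<mu> \<nu> \<rho> = conj_sign \<mu> * quat_coeff \<mu> \<rho> \<nu>"
    unfolding all_4 by (simp add: conj_sign_def quat_coeff_def levi_civita_def)
  then show ?thesis by blast
qed

lemma sum_mult_distrib_free:
  "(\<Sum>i\<in>I. f i) * g = (\<Sum>i\<in>I. f i * (g::free))" "g * (\<Sum>i\<in>I. f i) = (\<Sum>i\<in>I. g * f i)"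
  by (simp_all add: sum_distrib_left sum_distrib_right)

section \<open>Substitution into identities on the unit sphere\<close>

definition words :: "nat \<Rightarrow> 4 list set" where
  "words n = {I. length I = n}"

lemma finite_words [simp]: "finite (words n)"
  using finite_lists_length_eq[of "UNIV :: 4 set" n] by (simp add: words_def)

lemma sum_words_0: "sum f (words 0) = f []"
  by (simp add: words_def)

lemma sum_words_Suc: "sum f (words (Suc n)) = (\<Sum>i\<in>UNIV. \<Sum>I\<in>words n. f (i # I))"
proof -
  have "words (Suc n) = (\<lambda>(i, I). i # I) ` (UNIV \<times> words n)"
    by (auto simp: words_def length_Suc_conv image_iff)
  moreover have "inj_on (\<lambda>(i, I). i # I) (UNIV \<times> words n)"
    by (auto simp: inj_on_def)
  ultimately show ?thesis
    by (simp add: sum.reindex sum.cartesian_product comp_def case_prod_unfold)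
qed

text \<open>
  Linear independence of pairwise distinct characters of the multiplicative monoid of positive vectors.
  Comparing the relation at \<open>v w\<close> with \<open>\<chi>\<^sub>d(w)\<close> times the relation at \<open>v\<close> removes the character \<open>\<chi>\<^sub>d\<close>.
\<close>

lemma (in free_ideal) independent_characters:
  fixes \<chi> :: "'e \<Rightarrow> (4 \<Rightarrow> real) \<Rightarrow> real"
  assumes "finite E"
    and mult: "\<And>e v w. e \<in> E \<Longrightarrow> \<chi> e (\<lambda>\<rho>. v \<rho> * w \<rho>) = \<chi> e v * \<chi> e w"
    and one: "\<And>e. e \<in> E \<Longrightarrow> \<chi> e (\<lambda>_. 1) = 1"
    and distinct: "\<And>e e'. e \<in> E \<Longrightarrow> e' \<in> E \<Longrightarrow> e \<noteq> e' \<Longrightarrow> \<exists>v. (\<forall>\<rho>. v \<rho> > 0) \<and> \<chi> e v \<noteq> \<chi> e' v"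
    and vanish: "\<And>v. (\<forall>\<rho>. v \<rho> > 0) \<Longrightarrow> (\<Sum>e\<in>E. rs (\<chi> e v) * u e) \<in> J"
    and "e \<in> E"
  shows "u e \<in> J"
  using assms
proof (induction E arbitrary: u e rule: finite_induct)
  case (insert d E)
  have mem: "u e \<in> J" if e: "e \<in> E" for e
  proof -
    obtain w where w: "\<forall>\<rho>. w \<rho> > 0" "\<chi> e w \<noteq> \<chi> d w"
      using insert.prems(3)[of e d] e insert.hyps(2) by blast
    have "(\<Sum>e\<in>E. rs (\<chi> e v) * (rs (\<chi> e w - \<chi> d w) * u e)) \<in> J" if v: "\<forall>\<rho>. v \<rho> > 0" for v
    proof -
      have "(\<Sum>e\<in>insert d E. rs (\<chi> e (\<lambda>\<rho>. v \<rho> * w \<rho>)) * u e)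
          - rs (\<chi> d w) * (\<Sum>e\<in>insert d E. rs (\<chi> e v) * u e) \<in> J"
        using v w by (intro diff_mem left_mem insert.prems(4)) auto
      also have "(\<Sum>e\<in>insert d E. rs (\<chi> e (\<lambda>\<rho>. v \<rho> * w \<rho>)) * u e)
          - rs (\<chi> d w) * (\<Sum>e\<in>insert d E. rs (\<chi> e v) * u e)
        = (\<Sum>e\<in>insert d E. rs (\<chi> e v * (\<chi> e w - \<chi> d w)) * u e)"
        using insert.prems(1)
        by (simp add: sum_mult_distrib_free sum_subtractf[symmetric] algebra_simps scalar_diff
            del: sum.insert_remove flip: scalar_mult mult.assoc)
      also have "\<dots> = (\<Sum>e\<in>E. rs (\<chi> e v) * (rs (\<chi> e w - \<chi> d w) * u e))"
        using insert.hyps by (simp add: mult.assoc[symmetric] flip: scalar_mult)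
      finally show ?thesis .
    qed
    then have "rs (\<chi> e w - \<chi> d w) * u e \<in> J"
      using insert.prems(1-3) e by (intro insert.IH[of "\<lambda>e. rs (\<chi> e w - \<chi> d w) * u e"]) auto
    then show ?thesis
      by (rule scalar_cancel) (use w(2) in simp)
  qed
  have "(\<Sum>e\<in>insert d E. rs (\<chi> e (\<lambda>_. 1)) * u e) \<in> J"
    by (rule insert.prems(4)) simp
  also have "(\<Sum>e\<in>insert d E. rs (\<chi> e (\<lambda>_. 1)) * u e) = u d + sum u E"
    using insert by (simp add: scalar_1)
  finally have "u d + sum u E - sum u E \<in> J"
    by (rule diff_mem) (rule sum_mem, rule mem)
  then show ?case
    using mem insert.prems(5) by auto
qed simp

text \<open>
  A homogeneous polynomial identity on the unit sphere extends to all positive vectors by scaling. There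
  the monomials are distinct characters, so the coefficients of each monomial add up to an element of
  \<open>J\<close>. Hence the monomial \<open>v\<^sup>Q\<close> may be replaced by anything that depends additively on the coefficient and only
  on the multiset of letters of \<open>Q\<close>, in particular by a product of commuting elements.
\<close>

lemma (in free_ideal) sphere_substitution:
  fixes \<Phi> :: "4 list \<Rightarrow> free \<Rightarrow> 'g::ab_group_add"
  assumes vanish: "\<And>v. v \<in> unit_sphere \<Longrightarrow> (\<Sum>Q\<in>words n. rs (prod_list (map v Q)) * c Q) \<in> J"
    and K: "ab_subgroup K"
    and \<Phi>_add: "\<And>Q a b. \<Phi> Q (a + b) \<simeq>[K] \<Phi> Q a + \<Phi> Q b"
    and \<Phi>_mem: "\<And>Q a. a \<in> J \<Longrightarrow> \<Phi> Q a \<in> K"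
    and \<Phi>_mset: "\<And>Q Q' a. mset Q = mset Q' \<Longrightarrow> \<Phi> Q a \<simeq>[K] \<Phi> Q' a"
  shows "(\<Sum>Q\<in>words n. \<Phi> Q (c Q)) \<in> K"
proof -
  interpret K: ab_subgroup K by fact
  define E where "E = mset ` words n"
  define C where "C e = (\<Sum>Q\<in>{Q \<in> words n. mset Q = e}. c Q)" for e
  have [simp]: "finite E" by (simp add: E_def)
  have homogeneous: "prod_list (map (\<lambda>\<rho>. s * u \<rho>) Q) = s ^ length Q * prod_list (map u Q)"
    for s :: real and u :: "4 \<Rightarrow> real" and Q
    by (induction Q) auto
  have C_mem: "C e \<in> J" if "e \<in> E" for e
  proof (rule independent_characters[where E = E and \<chi> = "\<lambda>e v. prod_mset (image_mset v e)"])
    fix v :: "4 \<Rightarrow> real" assume v: "\<forall>\<rho>. v \<rho> > 0"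
    define s where "s = sqrt (\<Sum>\<rho>\<in>UNIV. (v \<rho>)\<^sup>2)"
    have pos: "(\<Sum>\<rho>\<in>UNIV. (v \<rho>)\<^sup>2) > 0"
      using v by (intro sum_pos zero_less_power) auto
    then have s: "s > 0" "s\<^sup>2 = (\<Sum>\<rho>\<in>UNIV. (v \<rho>)\<^sup>2)"
      by (auto simp: s_def)
    define u where "u \<rho> = v \<rho> / s" for \<rho>
    have "u \<in> unit_sphere"
      using s pos by (simp add: unit_sphere_def u_def power_divide flip: sum_divide_distrib)
    have v_eq: "v = (\<lambda>\<rho>. s * u \<rho>)" using s by (auto simp: u_def)
    have "rs (s ^ n) * (\<Sum>Q\<in>words n. rs (prod_list (map u Q)) * c Q) \<in> J"
      by (rule left_mem) (rule vanish, fact)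
    also have "rs (s ^ n) * (\<Sum>Q\<in>words n. rs (prod_list (map u Q)) * c Q)
      = (\<Sum>Q\<in>words n. rs (prod_list (map v Q)) * c Q)"
      unfolding sum_mult_distrib_free v_eq homogeneous
      by (intro sum.cong refl) (simp add: words_def mult.assoc[symmetric] scalar_mult[symmetric])
    also have "\<dots> = (\<Sum>e\<in>E. \<Sum>Q\<in>{Q \<in> words n. mset Q = e}. rs (prod_list (map v Q)) * c Q)"
      unfolding E_def by (rule sum.image_gen) simp
    also have "\<dots> = (\<Sum>e\<in>E. rs (prod_mset (image_mset v e)) * C e)"
      unfolding C_def sum_mult_distrib_free
      by (intro sum.cong refl) (auto simp flip: prod_mset_prod_list mset_map)
    finally show "(\<Sum>e\<in>E. rs (prod_mset (image_mset v e)) * C e) \<in> J" .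
  next
    fix e e' :: "4 multiset" assume "e \<noteq> e'"
    then obtain \<rho> where \<rho>: "count e \<rho> \<noteq> count e' \<rho>" by (meson multiset_eqI)
    have count: "prod_mset (image_mset (\<lambda>i. if i = \<rho> then 2 else 1) d) = (2::real) ^ count d \<rho>" for d
      by (induction d) auto
    \<comment> \<open>the vector with the entry 2 in a position with different exponents separates two monomials\<close>
    show "\<exists>v. (\<forall>\<rho>. v \<rho> > 0) \<and> prod_mset (image_mset v e) \<noteq> (prod_mset (image_mset v e') :: real)"
      using \<rho> by (intro exI[of _ "\<lambda>i. if i = \<rho> then 2 else 1"]) (simp add: count)
  qed (use that in \<open>simp_all add: prod_mset.distrib\<close>)
  have "(\<Sum>Q\<in>words n. \<Phi> Q (c Q)) = (\<Sum>e\<in>E. \<Sum>Q\<in>{Q \<in> words n. mset Q = e}. \<Phi> Q (c Q))"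
    unfolding E_def by (rule sum.image_gen) simp
  moreover have "(\<Sum>Q\<in>{Q \<in> words n. mset Q = e}. \<Phi> Q (c Q)) \<in> K" if "e \<in> E" for e
  proof -
    obtain Q0 where Q0: "mset Q0 = e" using ex_mset by blast
    have "(\<Sum>Q\<in>{Q \<in> words n. mset Q = e}. \<Phi> Q (c Q)) \<simeq>[K] (\<Sum>Q\<in>{Q \<in> words n. mset Q = e}. \<Phi> Q0 (c Q))"
      by (intro K.cong_sum \<Phi>_mset) (simp add: Q0)
    also have "\<dots> \<simeq>[K] \<Phi> Q0 (C e)"
      unfolding C_def by (rule K.cong_sym, rule K.additive_sum) (rule \<Phi>_add)
    finally show ?thesis
      using \<Phi>_mem[OF C_mem[OF that]] by (rule K.cong_mem)
  qed
  ultimately show ?thesis by (simp add: K.sum_mem)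
qed

section \<open>Two quaternions exchanging past each other\<close>

lemma star_subalgebra_free_alg:
  "star_subalgebra T free_alg \<longleftrightarrow> 1 \<in> T \<and> (\<forall>f\<in>T. \<forall>g\<in>T. f + g \<in> T \<and> f * g \<in> T) \<and>
     (\<forall>c. \<forall>f\<in>T. scalar c * f \<in> T) \<and> (\<forall>f\<in>T. free_star f \<in> T)" (is "_ \<longleftrightarrow> ?R")
proof
  assume "star_subalgebra T free_alg"
  then show ?R
    using subringE[of T free_alg] by (simp add: star_subalgebra_def)
next
  assume R: ?R
  have "- f \<in> T" if "f \<in> T" for f
    using R that scalar_uminus[of 1] by (metis mult_1 mult_minus1 scalar_1)
  then have "subring T free_alg"
    using R by (intro free_alg.subringI) auto
  then show "star_subalgebra T free_alg"
    using R by (simp add: star_subalgebra_def)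
qed

text \<open>
  Two lists with the same letters are connected by exchanges of neighbours.
\<close>

lemma mset_eq_swap_induct [consumes 1, case_names refl trans swap cons]:
  assumes "mset xs = mset ys"
    and refl: "\<And>xs. P xs xs"
    and trans: "\<And>xs ys zs. P xs ys \<Longrightarrow> P ys zs \<Longrightarrow> P xs zs"
    and swap: "\<And>a b xs. P (a # b # xs) (b # a # xs)"
    and cons: "\<And>a xs ys. P xs ys \<Longrightarrow> P (a # xs) (a # ys)"
  shows "P xs ys"
  using assms(1)
proof (induction xs arbitrary: ys)
  case Nil
  then show ?case using refl by simp
next
  case (Cons a xs)
  then have "a \<in> set ys" by (metis list.set_intros(1) set_mset_mset)
  then obtain ys1 ys2 where ys: "ys = ys1 @ a # ys2" by (auto simp: in_set_conv_decomp)
  have front: "P (a # us @ ys2) (us @ a # ys2)" for us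
    by (induction us) (auto intro: refl trans swap cons)
  have "mset xs = mset (ys1 @ ys2)" using Cons.prems ys by simp
  then have "P (a # xs) (a # ys1 @ ys2)" by (intro cons Cons.IH)
  then show ?case using front ys trans by blast
qed

definition quat_unit :: "4 \<Rightarrow> 4 \<Rightarrow> free" where
  "quat_unit \<rho> = (\<lambda>\<mu>. of_bool (\<mu> = \<rho>))"

lemma quat_mult_unit: "(p \<bullet> quat_unit \<rho>) \<mu> = (\<Sum>\<nu>\<in>UNIV. rs (quat_coeff \<mu> \<nu> \<rho>) * p \<nu>)"
  unfolding free_quat_mult_def quat_unit_def
  by (intro sum.cong refl) (simp add: of_bool_def if_distrib cong: if_cong)

text \<open>
  Splitting a product along the units separates its two factors, as needed when commuting elements are
  substituted for the right one.
\<close>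

lemma quat_mult_eq_sum: "(p \<bullet> q) \<mu> = (\<Sum>\<rho>\<in>UNIV. (p \<bullet> quat_unit \<rho>) \<mu> * q \<rho>)"
  unfolding quat_mult_unit sum_mult_distrib_free mult.assoc
  unfolding free_quat_mult_def by (rule sum.swap)

lemma quat_mult_real: "(p \<bullet> quat_real v) \<mu> = (\<Sum>\<rho>\<in>UNIV. rs (v \<rho>) * (p \<bullet> quat_unit \<rho>) \<mu>)"
  unfolding quat_mult_eq_sum[of p "quat_real v"] by (simp add: quat_real_def scalar_commute)

lemma sum_swap_pairs:
  "(\<Sum>a\<in>A. \<Sum>b\<in>B. \<Sum>c\<in>C. \<Sum>d\<in>D. f a b c d) = (\<Sum>c\<in>C. \<Sum>d\<in>D. \<Sum>a\<in>A. \<Sum>b\<in>B. f a b c d)"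
  (is "?L = ?R")
proof -
  have "?L = (\<Sum>a\<in>A. \<Sum>c\<in>C. \<Sum>d\<in>D. \<Sum>b\<in>B. f a b c d)"
    by (rule sum.cong[OF refl], subst sum.swap, rule sum.cong[OF refl], rule sum.swap)
  also have "\<dots> = ?R"
    by (subst sum.swap, rule sum.cong[OF refl], rule sum.swap)
  finally show ?thesis .
qed

context free_ideal
begin

lemma cong_quat_mult:
  assumes "\<And>\<mu>. p \<mu> \<simeq>[J] p' \<mu>" "\<And>\<mu>. q \<mu> \<simeq>[J] q' \<mu>"
  shows "(p \<bullet> q) \<mu> \<simeq>[J] (p' \<bullet> q') \<mu>"
  unfolding free_quat_mult_def by (intro cong_sum cong_mult assms cong_refl)

definition commute_mod :: "free \<Rightarrow> free \<Rightarrow> bool" where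
  "commute_mod f g \<longleftrightarrow> f * g \<simeq>[J] g * f"

lemma commute_sym: "commute_mod f g \<Longrightarrow> commute_mod g f"
  unfolding commute_mod_def by (rule cong_sym)

lemma commute_scalar: "commute_mod f (scalar c)"
  by (simp add: commute_mod_def scalar_commute)

lemma commute_1: "commute_mod f 1"
  by (simp add: commute_mod_def)

lemma commute_mult:
  assumes "commute_mod f g" "commute_mod f h"
  shows "commute_mod f (g * h)"
proof -
  have "f * (g * h) \<simeq>[J] g * (f * h)"
    using cong_mult_right[of "f * g" "g * f" h] assms(1) by (simp add: commute_mod_def mult.assoc)
  also have "\<dots> \<simeq>[J] g * (h * f)"
    using assms(2) by (intro cong_mult_left) (simp add: commute_mod_def)
  finally show ?thesis by (simp add: commute_mod_def mult.assoc)
qed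

lemma commute_sum: "(\<And>i. i \<in> I \<Longrightarrow> commute_mod f (g i)) \<Longrightarrow> commute_mod f (sum g I)"
  unfolding commute_mod_def sum_mult_distrib_free by (rule cong_sum)

lemma commute_quat_mult:
  assumes "\<And>\<mu>. commute_mod f (p \<mu>)" "\<And>\<mu>. commute_mod f (q \<mu>)"
  shows "commute_mod f ((p \<bullet> q) \<mu>)"
  unfolding free_quat_mult_def by (intro commute_sum commute_mult commute_scalar assms)

lemma commute_quat_unit: "commute_mod f (quat_unit \<rho> \<mu>)"
  by (simp add: quat_unit_def of_bool_def commute_mod_def)

lemma commute_swap: "commute_mod f g \<Longrightarrow> a * f * g * b \<simeq>[J] a * g * f * b"
  unfolding commute_mod_def mult.assoc[of a f g] mult.assoc[of a g f]
  by (intro cong_mult_left cong_mult_right)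

lemma prod_list_mset_cong:
  assumes "\<And>i j. commute_mod (z i) (z j)" "mset I = mset I'"
  shows "prod_list (map z I) \<simeq>[J] prod_list (map z I')"
  using assms(2)
proof (induction rule: mset_eq_swap_induct)
  case (swap a b xs)
  then show ?case using commute_swap[OF assms(1)[of a b], of 1] by (simp add: mult.assoc)
qed (auto intro: cong_trans cong_mult_left)

end

text \<open>
  One half of the seven-sphere. It is used with \<open>x = x\<^sub>1\<close>, \<open>y = x\<^sub>2\<close> and, for the other half, with
  \<open>x = x\<^sub>2\<close>, \<open>y = x\<^sub>1\<close>. The set \<open>J\<close> is the kernel of the projection to the algebra, and \<open>B\<close> is the
  preimage of the four-sphere, generated by the entries of \<open>y x\<^sup>*\<close> and by \<open>\<parallel>x\<parallel>\<^sup>2\<close>.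
\<close>

locale quaternion_pair = free_ideal J for J +
  fixes x y :: "4 \<Rightarrow> free" and S :: deformation and B :: "free set"
    and act :: "(4 \<Rightarrow> real) \<Rightarrow> free \<Rightarrow> free"
  assumes x_commute: "x \<mu> * x \<nu> \<simeq>[J] x \<nu> * x \<mu>"
    and exchange: "x l * y a \<simeq>[J] (\<Sum>b\<in>UNIV. \<Sum>m\<in>UNIV. scalar (S l a b m) * (y b * x m))"
    and norm_central: "norm_sq x * f \<simeq>[J] f * norm_sq x"
    and x_star: "free_star (x \<mu>) = x \<mu>"
    and generators: "free_gen i \<in> range x \<union> range y"
    and act_add: "act v (f + g) = act v f + act v g"
    and act_mult: "act v (f * g) = act v f * act v g"
    and act_scalar: "act v (scalar c) = scalar c"
    and act_x: "act v (x \<mu>) = (x \<bullet> quat_real v) \<mu>"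
    and act_y: "act v (y \<mu>) = (y \<bullet> quat_real v) \<mu>"
    and act_mem: "v \<in> unit_sphere \<Longrightarrow> f \<in> J \<Longrightarrow> act v f \<in> J"
    and B_subalgebra: "star_subalgebra B free_alg"
    and J_subset_B: "J \<subseteq> B"
    and pair_mem_B: "(y \<bullet> quat_conj x) \<mu> \<in> B"
    and norm_mem_B: "norm_sq x \<in> B"
    and B_minimal: "\<lbrakk>star_subalgebra T free_alg; J \<subseteq> T; \<forall>\<mu>. (y \<bullet> quat_conj x) \<mu> \<in> T; norm_sq x \<in> T\<rbrakk>
      \<Longrightarrow> B \<subseteq> T"
begin

abbreviation z :: "4 \<Rightarrow> free" where "z \<equiv> quat_conj x"
abbreviation r :: free where "r \<equiv> norm_sq x"
abbreviation pair :: "4 \<Rightarrow> free" where "pair \<equiv> y \<bullet> z"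

lemma B_closed:
  "1 \<in> B" "f \<in> B \<Longrightarrow> g \<in> B \<Longrightarrow> f + g \<in> B" "f \<in> B \<Longrightarrow> g \<in> B \<Longrightarrow> f * g \<in> B"
  "f \<in> B \<Longrightarrow> scalar c * f \<in> B" "f \<in> B \<Longrightarrow> free_star f \<in> B"
  using B_subalgebra unfolding star_subalgebra_free_alg by blast+

lemma zero_mem_B: "0 \<in> B"
  using J_subset_B zero_mem by blast

lemma scalar_mem_B: "scalar c \<in> B"
  using B_closed(4)[OF B_closed(1), of c] by simp

lemma sum_mem_B: "(\<And>i. i \<in> I \<Longrightarrow> f i \<in> B) \<Longrightarrow> sum f I \<in> B"
  by (induction I rule: infinite_finite_induct) (auto intro: zero_mem_B B_closed)

lemma cong_mem_B: "f \<simeq>[J] g \<Longrightarrow> g \<in> B \<Longrightarrow> f \<in> B"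
  using B_closed(2)[of "f - g" g] J_subset_B by (auto simp: cong_mod_def)

lemma power_mem_B: "f \<in> B \<Longrightarrow> f ^ n \<in> B"
  by (induction n) (auto intro: B_closed)

lemma quat_mult_mem_B: "(\<And>\<mu>. p \<mu> \<in> B) \<Longrightarrow> (\<And>\<mu>. q \<mu> \<in> B) \<Longrightarrow> (p \<bullet> q) \<mu> \<in> B"
  unfolding free_quat_mult_def by (intro sum_mem_B B_closed)

lemma act_1: "act v 1 = 1"
  using act_scalar[of v 1] by (simp add: scalar_1)

lemma act_0: "act v 0 = 0"
  using act_scalar[of v 0] by simp

lemma act_diff: "act v (f - g) = act v f - act v g"
  using act_add[of v "f - g" g] by simp

lemma act_sum: "act v (sum f I) = (\<Sum>i\<in>I. act v (f i))"
  by (induction I rule: infinite_finite_induct) (auto simp: act_add act_0)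

lemma xx: "commute_mod (x \<mu>) (x \<nu>)"
  by (simp add: commute_mod_def x_commute)

lemma xz: "commute_mod (x \<mu>) (z \<nu>)"
  unfolding quat_conj_def by (intro commute_mult commute_scalar xx)

lemma zx: "commute_mod (z \<mu>) (x \<nu>)"
  by (rule commute_sym) (rule xz)

lemma zz: "commute_mod (z \<mu>) (z \<nu>)"
  unfolding quat_conj_def[of x] by (intro commute_mult commute_scalar commute_sym[OF commute_mult] xx)

lemma r_commute: "commute_mod r f" "commute_mod f r"
  using norm_central[of f] cong_sym[OF norm_central[of f]] by (auto simp: commute_mod_def)

lemma r_power_commute: "commute_mod f (r ^ n)"
  by (induction n) (auto intro: commute_mult r_commute commute_1)

lemma x_mult_z: "(x \<bullet> z) \<mu> \<simeq>[J] quat_scalar r \<mu>"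
proof -
  have comm: "x i * x j - x j * x i \<in> J" for i j
    using x_commute by (simp add: cong_mod_def)
  have "\<forall>\<mu>. (x \<bullet> z) \<mu> - quat_scalar r \<mu> \<in> J"
    unfolding all_4
    using add_mem[OF comm[of 1 0] comm[of 3 2]] add_mem[OF comm[of 2 0] comm[of 1 3]]
      add_mem[OF comm[of 3 0] comm[of 2 1]]
    by (simp add: quat_mult_components quat_conj_components quat_scalar_components norm_sq_def sum_4
      zero_mem algebra_simps)
  then show ?thesis by (simp add: cong_mod_def)
qed

lemma z_mult_x: "(z \<bullet> x) \<mu> \<simeq>[J] quat_scalar r \<mu>"
proof -
  have comm: "x i * x j - x j * x i \<in> J" for i j
    using x_commute by (simp add: cong_mod_def)
  have "\<forall>\<mu>. (z \<bullet> x) \<mu> - quat_scalar r \<mu> \<in> J"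
    unfolding all_4
    using add_mem[OF comm[of 0 1] comm[of 3 2]] add_mem[OF comm[of 0 2] comm[of 1 3]]
      add_mem[OF comm[of 0 3] comm[of 2 1]]
    by (simp add: quat_mult_components quat_conj_components quat_scalar_components norm_sq_def sum_4
      zero_mem algebra_simps)
  then show ?thesis by (simp add: cong_mod_def)
qed

abbreviation xe :: "4 \<Rightarrow> 4 \<Rightarrow> free" where "xe \<rho> \<equiv> x \<bullet> quat_unit \<rho>"
abbreviation ye :: "4 \<Rightarrow> 4 \<Rightarrow> free" where "ye \<rho> \<equiv> y \<bullet> quat_unit \<rho>"

text \<open>
  The exchange relation transformed by \<open>v\<close> is \<open>(x v)\<^sup>l (y v)\<^sup>a = \<Sum> S\<^sup>l\<^sup>a\<^sub>b\<^sub>m (y v)\<^sup>b (x v)\<^sup>m\<close>. When \<open>z = x\<^sup>*\<close> is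
  substituted for \<open>v\<close> on the right, the left-hand side becomes \<open>x (y z)\<^sup>a z\<close> and the right-hand side
  \<open>\<Sum> S\<^sup>l\<^sup>a\<^sub>b\<^sub>m (y z)\<^sup>b (x z)\<^sup>m\<close>, because the entries of \<open>x\<close> and \<open>z\<close> all commute. As \<open>x z = r\<close>, only
  \<open>m = 0\<close> remains.
\<close>

lemma conj_pair:
  "((\<lambda>\<mu>. x \<mu> * pair a) \<bullet> z) l \<simeq>[J] (\<Sum>b\<in>UNIV. scalar (S l a b 0) * (pair b * r))"
proof -
  define c where "c Q = xe (Q ! 0) l * ye (Q ! 1) a
    - (\<Sum>b\<in>UNIV. \<Sum>m\<in>UNIV. scalar (S l a b m) * (ye (Q ! 0) b * xe (Q ! 1) m))" for Q
  have words2: "(\<Sum>Q\<in>words 2. f Q) = (\<Sum>\<rho>\<in>UNIV. \<Sum>\<sigma>\<in>UNIV. f [\<rho>, \<sigma>])" for f :: "4 list \<Rightarrow> free"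
    by (simp add: numeral_2_eq_2 sum_words_Suc sum_words_0)
  have prod2: "(\<Sum>\<rho>\<in>UNIV. rs (v \<rho>) * f \<rho>) * (\<Sum>\<rho>\<in>UNIV. rs (v \<rho>) * g \<rho>)
      = (\<Sum>\<rho>\<in>UNIV. \<Sum>\<sigma>\<in>UNIV. rs (v \<rho> * v \<sigma>) * (f \<rho> * g \<sigma>))" for v :: "4 \<Rightarrow> real" and f g :: "4 \<Rightarrow> free"
    unfolding sum_product
    by (intro sum.cong refl) (simp add: scalar_mult mult.assoc scalar_left_commute[of "f _"])
  have "(\<Sum>Q\<in>words 2. c Q * prod_list (map z Q)) \<in> J"
  proof (rule sphere_substitution[where \<Phi> = "\<lambda>Q f. f * prod_list (map z Q)"])
    fix v assume v: "v \<in> unit_sphere"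
    have "act v (x l * y a - (\<Sum>b\<in>UNIV. \<Sum>m\<in>UNIV. scalar (S l a b m) * (y b * x m))) \<in> J"
      using exchange[of l a] by (intro act_mem v) (simp add: cong_mod_def)
    also have "act v (x l * y a - (\<Sum>b\<in>UNIV. \<Sum>m\<in>UNIV. scalar (S l a b m) * (y b * x m)))
      = (x \<bullet> quat_real v) l * (y \<bullet> quat_real v) a
        - (\<Sum>b\<in>UNIV. \<Sum>m\<in>UNIV. scalar (S l a b m) * ((y \<bullet> quat_real v) b * (x \<bullet> quat_real v) m))"
      by (simp add: act_diff act_mult act_sum act_scalar act_x act_y)
    also have "\<dots> = (\<Sum>\<rho>\<in>UNIV. \<Sum>\<sigma>\<in>UNIV. rs (v \<rho> * v \<sigma>) * (xe \<rho> l * ye \<sigma> a))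
       - (\<Sum>b\<in>UNIV. \<Sum>m\<in>UNIV. \<Sum>\<rho>\<in>UNIV. \<Sum>\<sigma>\<in>UNIV.
           rs (v \<rho> * v \<sigma>) * (scalar (S l a b m) * (ye \<rho> b * xe \<sigma> m)))"
      unfolding quat_mult_real prod2
      unfolding sum_mult_distrib_free
      by (simp only: scalar_left_commute[of "scalar (S l a b m)" for b m])
    also have "(\<Sum>b\<in>UNIV. \<Sum>m\<in>UNIV. \<Sum>\<rho>\<in>UNIV. \<Sum>\<sigma>\<in>UNIV.
           rs (v \<rho> * v \<sigma>) * (scalar (S l a b m) * (ye \<rho> b * xe \<sigma> m)))
      = (\<Sum>\<rho>\<in>UNIV. \<Sum>\<sigma>\<in>UNIV. \<Sum>b\<in>UNIV. \<Sum>m\<in>UNIV.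
           rs (v \<rho> * v \<sigma>) * (scalar (S l a b m) * (ye \<rho> b * xe \<sigma> m)))"
      by (rule sum_swap_pairs)
    finally show "(\<Sum>Q\<in>words 2. rs (prod_list (map v Q)) * c Q) \<in> J"
      unfolding words2 c_def by (simp add: right_diff_distrib sum_subtractf sum_mult_distrib_free)
  next
    fix Q Q' :: "4 list" and f assume "mset Q = mset Q'"
    then show "f * prod_list (map z Q) \<simeq>[J] f * prod_list (map z Q')"
      by (intro cong_mult_left prod_list_mset_cong zz)
  qed (auto simp: distrib_right intro: right_mem ab_subgroup_axioms)
  then have "(\<Sum>\<rho>\<in>UNIV. \<Sum>\<sigma>\<in>UNIV. xe \<rho> l * ye \<sigma> a * (z \<rho> * z \<sigma>))
     \<simeq>[J] (\<Sum>\<rho>\<in>UNIV. \<Sum>\<sigma>\<in>UNIV. (\<Sum>b\<in>UNIV. \<Sum>m\<in>UNIV. scalar (S l a b m) * (ye \<rho> b * xe \<sigma> m)) * (z \<rho> * z \<sigma>))"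
    (is "?L \<simeq>[J] ?R")
    by (simp add: words2 c_def cong_mod_def left_diff_distrib sum_subtractf)
  have "((\<lambda>\<mu>. x \<mu> * pair a) \<bullet> z) l = (\<Sum>\<rho>\<in>UNIV. xe \<rho> l * pair a * z \<rho>)"
    unfolding quat_mult_eq_sum[of "\<lambda>\<mu>. x \<mu> * pair a" z] quat_mult_unit
    by (simp add: sum_mult_distrib_free mult.assoc)
  also have "\<dots> = (\<Sum>\<rho>\<in>UNIV. \<Sum>\<sigma>\<in>UNIV. xe \<rho> l * ye \<sigma> a * (z \<sigma> * z \<rho>))"
    unfolding quat_mult_eq_sum[of y z] by (simp add: sum_mult_distrib_free mult.assoc)
  also have "\<dots> \<simeq>[J] ?L"
    by (intro cong_sum cong_mult_left) (use zz in \<open>simp add: commute_mod_def\<close>)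
  also have "?L \<simeq>[J] ?R" by fact
  also have "?R = (\<Sum>b\<in>UNIV. \<Sum>m\<in>UNIV. \<Sum>\<rho>\<in>UNIV. \<Sum>\<sigma>\<in>UNIV. scalar (S l a b m) * (ye \<rho> b * xe \<sigma> m * z \<rho> * z \<sigma>))"
    unfolding sum_mult_distrib_free mult.assoc by (rule sum_swap_pairs)
  also have "\<dots> \<simeq>[J] (\<Sum>b\<in>UNIV. \<Sum>m\<in>UNIV. \<Sum>\<rho>\<in>UNIV. \<Sum>\<sigma>\<in>UNIV. scalar (S l a b m) * (ye \<rho> b * z \<rho> * xe \<sigma> m * z \<sigma>))"
    by (intro cong_sum cong_mult_left commute_swap commute_sym[OF commute_quat_mult] zx commute_quat_unit)
  also have "\<dots> = (\<Sum>b\<in>UNIV. \<Sum>m\<in>UNIV. scalar (S l a b m) * (pair b * (x \<bullet> z) m))"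
    unfolding quat_mult_eq_sum[of y z] quat_mult_eq_sum[of x z] sum_product
    by (simp add: sum_mult_distrib_free mult.assoc)
  also have "\<dots> \<simeq>[J] (\<Sum>b\<in>UNIV. \<Sum>m\<in>UNIV. scalar (S l a b m) * (pair b * quat_scalar r m))"
    by (intro cong_sum cong_mult_left x_mult_z)
  also have "\<dots> = (\<Sum>b\<in>UNIV. scalar (S l a b 0) * (pair b * r))"
    by (simp add: sum_4 quat_scalar_components)
  finally show ?thesis .
qed

text \<open>
  The quaternion \<open>x b x\<^sup>*\<close> for an element \<open>b\<close> of the algebra.
\<close>

definition conj_x :: "free \<Rightarrow> 4 \<Rightarrow> free" where
  "conj_x b = x \<bullet> quat_scalar b \<bullet> z"

lemma conj_x_pair_mem_B: "conj_x (pair a) l \<in> B"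
proof (rule cong_mem_B)
  show "conj_x (pair a) l \<simeq>[J] (\<Sum>b\<in>UNIV. scalar (S l a b 0) * (pair b * r))"
    using conj_pair[of a l] by (simp add: conj_x_def quat_mult_scalar)
  show "(\<Sum>b\<in>UNIV. scalar (S l a b 0) * (pair b * r)) \<in> B"
    by (intro sum_mem_B B_closed pair_mem_B norm_mem_B)
qed

lemma quat_scalar_mem_B: "f \<in> B \<Longrightarrow> quat_scalar f \<mu> \<in> B"
  by (simp add: quat_scalar_def zero_mem_B)

lemma conj_x_add: "conj_x (b + c) l = conj_x b l + conj_x c l"
  unfolding conj_x_def quat_mult_scalar
  unfolding free_quat_mult_def by (simp add: algebra_simps sum.distrib)

lemma conj_x_scalar: "conj_x (scalar c * b) l = scalar c * conj_x b l"
proof -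
  have "conj_x (scalar c * b) = quat_scalar (scalar c) \<bullet> conj_x b"
    unfolding conj_x_def quat_mult_assoc[symmetric] unfolding quat_scalar_mult quat_mult_scalar
    by (simp add: mult.assoc scalar_left_commute[of "x _"])
  then show ?thesis by (simp add: quat_scalar_mult)
qed

lemma conj_x_star: "conj_x (free_star b) l = rs (conj_sign l) * free_star (conj_x b l)"
proof -
  have sign: "rs (conj_sign i) * (rs (conj_sign i) * f) = f" for i f
    by (simp add: conj_sign_def scalar_1 scalar_uminus)
  have z_star: "free_star (z i) = z i" for i
    by (simp add: quat_conj_def free_star_mult free_star_scalar x_star scalar_commute)
  have x_z: "z i * f * x j = rs (conj_sign i * conj_sign j) * (x i * (f * z j))" for i j f
    unfolding quat_conj_def
    by (simp add: sign scalar_mult mult.assoc scalar_left_commute[of f] scalar_left_commute[of "x _"])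
  have collect: "rs t * (rs u * (rs w * f)) = rs (t * (w * u)) * f" for t u w f
  proof -
    have "rs t * (rs u * (rs w * f)) = scalar (of_real t * of_real u * of_real w) * f"
      by (simp only: scalar_mult mult.assoc)
    also have "of_real t * of_real u * of_real w = complex_of_real (t * (w * u))"
      by simp
    finally show ?thesis .
  qed
  have "free_star (conj_x b l)
    = (\<Sum>\<nu>\<in>UNIV. \<Sum>\<rho>\<in>UNIV. rs (quat_coeff l \<nu> \<rho>) * (z \<rho> * free_star b * x \<nu>))"
    unfolding conj_x_def quat_mult_scalar
    unfolding free_quat_mult_def
    by (simp add: free_star_sum free_star_mult free_star_scalar x_star z_star scalar_commute mult.assoc)
  also have "rs (conj_sign l) * \<dots>
    = (\<Sum>\<nu>\<in>UNIV. \<Sum>\<rho>\<in>UNIV. rs (conj_sign l * (conj_sign \<nu> * conj_sign \<rho> * quat_coeff l \<nu> \<rho>))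
        * (x \<rho> * (free_star b * z \<nu>)))"
    unfolding x_z sum_mult_distrib_free collect by (simp add: mult.commute)
  also have "\<dots> = (\<Sum>\<nu>\<in>UNIV. \<Sum>\<rho>\<in>UNIV. rs (quat_coeff l \<rho> \<nu>) * (x \<rho> * (free_star b * z \<nu>)))"
    unfolding conj_sign_quat_coeff by (simp add: conj_sign_def)
  also have "\<dots> = conj_x (free_star b) l"
    unfolding conj_x_def quat_mult_scalar
    unfolding free_quat_mult_def by (subst sum.swap) (simp add: mult.assoc)
  finally show ?thesis ..
qed

lemma conj_x_central:
  assumes "\<And>\<mu>. commute_mod (x \<mu>) b"
  shows "conj_x b l \<simeq>[J] b * quat_scalar r l"
proof -
  have "conj_x b l \<simeq>[J] (quat_scalar b \<bullet> x \<bullet> z) l"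
    unfolding conj_x_def quat_mult_scalar quat_scalar_mult
    by (intro cong_quat_mult cong_refl) (use assms in \<open>simp add: commute_mod_def\<close>)
  also have "\<dots> = b * (x \<bullet> z) l"
    by (simp add: quat_scalar_mult quat_mult_left_scalar)
  also have "\<dots> \<simeq>[J] b * quat_scalar r l"
    by (intro cong_mult_left x_mult_z)
  finally show ?thesis .
qed

lemma r_power_quat_mult:
  "((\<lambda>\<mu>. r ^ j * p \<mu>) \<bullet> (\<lambda>\<mu>. r ^ k * q \<mu>)) \<mu> \<simeq>[J] r ^ (j + k) * (p \<bullet> q) \<mu>"
proof -
  have "((\<lambda>\<mu>. r ^ j * p \<mu>) \<bullet> (\<lambda>\<mu>. r ^ k * q \<mu>)) \<mu>
      = (quat_scalar (r ^ j) \<bullet> (\<lambda>\<mu>. p \<mu> * r ^ k) \<bullet> q) \<mu>"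
    by (simp only: quat_scalar_mult[symmetric] quat_mult_scalar[symmetric] quat_mult_assoc)
  also have "\<dots> \<simeq>[J] (quat_scalar (r ^ j) \<bullet> (\<lambda>\<mu>. r ^ k * p \<mu>) \<bullet> q) \<mu>"
    using r_power_commute by (intro cong_quat_mult cong_refl) (auto simp: commute_mod_def)
  also have "\<dots> = r ^ (j + k) * (p \<bullet> q) \<mu>"
    by (simp add: quat_scalar_mult quat_mult_left_scalar power_add mult.assoc)
  finally show ?thesis .
qed

lemma r_power_mem_B:
  assumes "r ^ k * f \<in> B" "k \<le> n"
  shows "r ^ n * f \<in> B"
proof -
  have "r ^ n * f = r ^ (n - k) * (r ^ k * f)"
    using assms(2) by (simp add: mult.assoc[symmetric] power_add[symmetric])
  then show ?thesis
    using assms(1) by (simp add: B_closed power_mem_B norm_mem_B)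
qed

text \<open>
  \<open>(x b x\<^sup>*)(x c x\<^sup>*) = x b (x\<^sup>* x) c x\<^sup>*\<close>, and \<open>x\<^sup>* x = r\<close> is central.
\<close>

lemma conj_x_mult: "(conj_x b \<bullet> conj_x c) l \<simeq>[J] r * conj_x (b * c) l"
proof -
  have "conj_x b \<bullet> conj_x c = x \<bullet> quat_scalar b \<bullet> (z \<bullet> x) \<bullet> (quat_scalar c \<bullet> z)"
    by (simp only: conj_x_def quat_mult_assoc)
  then have "(conj_x b \<bullet> conj_x c) l \<simeq>[J] (x \<bullet> quat_scalar b \<bullet> quat_scalar r \<bullet> (quat_scalar c \<bullet> z)) l"
    by (simp only:) (intro cong_quat_mult cong_refl z_mult_x)
  also have "\<dots> \<simeq>[J] (quat_scalar r \<bullet> (x \<bullet> quat_scalar b) \<bullet> (quat_scalar c \<bullet> z)) l"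
    unfolding quat_mult_scalar[of _ r] quat_scalar_mult[of r]
    by (intro cong_quat_mult cong_refl) (use r_commute in \<open>simp add: commute_mod_def\<close>)
  also have "quat_scalar r \<bullet> (x \<bullet> quat_scalar b) \<bullet> (quat_scalar c \<bullet> z)
      = quat_scalar r \<bullet> (x \<bullet> (quat_scalar b \<bullet> quat_scalar c) \<bullet> z)"
    by (simp only: quat_mult_assoc)
  also have "quat_scalar b \<bullet> quat_scalar c = quat_scalar (b * c)"
    unfolding quat_scalar_mult by (simp add: quat_scalar_def fun_eq_iff)
  finally show ?thesis by (simp add: quat_scalar_mult conj_x_def)
qed

text \<open>
  The elements \<open>b\<close> with this property form a star subalgebra, which contains \<open>r\<close> and, by \<open>conj_pair\<close>, the
  entries of \<open>y x\<^sup>*\<close>. The power of \<open>r\<close> is caused by products.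
\<close>

lemma conj_x_mem_B:
  assumes "b \<in> B"
  shows "\<exists>k. \<forall>l. r ^ k * conj_x b l \<in> B"
proof -
  let ?T = "{b. \<exists>k. \<forall>l. r ^ k * conj_x b l \<in> B}"
  have J: "conj_x b l \<in> J" if "b \<in> J" for b l
  proof -
    have "conj_x b l \<simeq>[J] ((\<lambda>\<mu>. 0) \<bullet> z) l"
      unfolding conj_x_def quat_mult_scalar
      by (intro cong_quat_mult cong_refl) (simp add: cong_0 left_mem that)
    then show ?thesis by (simp add: free_quat_mult_def cong_0)
  qed
  have "star_subalgebra ?T free_alg"
    unfolding star_subalgebra_free_alg
  proof (intro conjI ballI allI)
    have "conj_x 1 l \<in> B" for l
      using conj_x_central[OF commute_1, of l]
      by (rule cong_mem_B) (auto intro: B_closed quat_scalar_mem_B norm_mem_B)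
    then show "1 \<in> ?T" by (auto intro!: exI[of _ 0])
  next
    fix f g assume "f \<in> ?T" "g \<in> ?T"
    then obtain j k where j: "\<forall>l. r ^ j * conj_x f l \<in> B" and k: "\<forall>l. r ^ k * conj_x g l \<in> B"
      by auto
    have "r ^ (j + k) * conj_x (f + g) l \<in> B" for l
      unfolding conj_x_add distrib_left
      by (rule B_closed(2)[OF r_power_mem_B[OF spec[OF j]] r_power_mem_B[OF spec[OF k]]]) simp_all
    then show "f + g \<in> ?T" by blast
    have "r ^ (j + k + 1) * conj_x (f * g) l \<in> B" for l
    proof (rule cong_mem_B)
      have "r ^ (j + k + 1) * conj_x (f * g) l = r ^ (j + k) * (r * conj_x (f * g) l)"
        by (simp only: power_add power_one_right mult.assoc)
      also have "\<dots> \<simeq>[J] r ^ (j + k) * (conj_x f \<bullet> conj_x g) l"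
        by (intro cong_mult_left cong_sym[OF conj_x_mult])
      also have "\<dots> \<simeq>[J] ((\<lambda>\<mu>. r ^ j * conj_x f \<mu>) \<bullet> (\<lambda>\<mu>. r ^ k * conj_x g \<mu>)) l"
        by (rule cong_sym) (rule r_power_quat_mult)
      finally show "r ^ (j + k + 1) * conj_x (f * g) l
        \<simeq>[J] ((\<lambda>\<mu>. r ^ j * conj_x f \<mu>) \<bullet> (\<lambda>\<mu>. r ^ k * conj_x g \<mu>)) l" .
      show "((\<lambda>\<mu>. r ^ j * conj_x f \<mu>) \<bullet> (\<lambda>\<mu>. r ^ k * conj_x g \<mu>)) l \<in> B"
        by (rule quat_mult_mem_B) (use j k in blast)+
    qed
    then show "f * g \<in> ?T" by blast
  next
    fix c f assume "f \<in> ?T"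
    then obtain k where "\<forall>l. r ^ k * conj_x f l \<in> B" by auto
    then have "r ^ k * conj_x (scalar c * f) l \<in> B" for l
      unfolding conj_x_scalar scalar_left_commute[of "r ^ k"] by (intro B_closed(4)) blast
    then show "scalar c * f \<in> ?T" by blast
  next
    fix f assume "f \<in> ?T"
    then obtain k where k: "\<forall>l. r ^ k * conj_x f l \<in> B" by auto
    have r_star: "free_star (r ^ k) = r ^ k"
    proof (induction k)
      case (Suc k)
      have "free_star r = r" by (simp add: norm_sq_def free_star_sum free_star_mult x_star)
      then show ?case using Suc by (simp add: free_star_mult flip: power_commutes)
    qed (simp add: free_star_1)
    have "r ^ k * conj_x (free_star f) l \<in> B" for l
    proof (rule cong_mem_B)
      have "r ^ k * conj_x (free_star f) l \<simeq>[J] conj_x (free_star f) l * r ^ k"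
        using commute_sym[OF r_power_commute] by (simp add: commute_mod_def)
      also have "\<dots> = rs (conj_sign l) * free_star (r ^ k * conj_x f l)"
        by (simp add: conj_x_star free_star_mult r_star mult.assoc)
      finally show "r ^ k * conj_x (free_star f) l \<simeq>[J] rs (conj_sign l) * free_star (r ^ k * conj_x f l)" .
      show "rs (conj_sign l) * free_star (r ^ k * conj_x f l) \<in> B"
        by (intro B_closed(4,5) spec[OF k])
    qed
    then show "free_star f \<in> ?T" by blast
  qed
  moreover have "J \<subseteq> ?T"
    using J J_subset_B by (auto intro!: exI[of _ 0])
  moreover have "\<forall>\<mu>. pair \<mu> \<in> ?T"
    using conj_x_pair_mem_B by (auto intro!: exI[of _ 0])
  moreover have "conj_x r l \<in> B" for l
    using conj_x_central[OF r_commute(2), of l]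
    by (rule cong_mem_B) (auto intro: B_closed quat_scalar_mem_B norm_mem_B)
  then have "r \<in> ?T" by (auto intro!: exI[of _ 0])
  ultimately have "B \<subseteq> ?T" by (rule B_minimal)
  then show ?thesis using assms by blast
qed

abbreviation xprod :: "4 list \<Rightarrow> free" where "xprod I \<equiv> prod_list (map x I)"

text \<open>
  For \<open>w = y\<close> this follows from \<open>r (y b x\<^sup>*) = (y x\<^sup>*)(x b x\<^sup>*)\<close>.
\<close>

lemma generator_mult_x_conj_mem_B:
  assumes "w = x \<or> w = y" "b \<in> B"
  shows "\<exists>k. \<forall>l. r ^ k * (w \<bullet> quat_scalar b \<bullet> z) l \<in> B"
  using assms(1)
proof
  assume "w = x"
  then show ?thesis using conj_x_mem_B[OF assms(2)] by (simp add: conj_x_def)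
next
  assume w: "w = y"
  obtain k where k: "\<forall>l. r ^ k * conj_x b l \<in> B" using conj_x_mem_B[OF assms(2)] by blast
  have "r ^ Suc k * (y \<bullet> quat_scalar b \<bullet> z) l \<in> B" for l
  proof (rule cong_mem_B)
    have "(pair \<bullet> conj_x b) l = (y \<bullet> (z \<bullet> x) \<bullet> (quat_scalar b \<bullet> z)) l"
      by (simp only: conj_x_def quat_mult_assoc)
    also have "\<dots> \<simeq>[J] (y \<bullet> quat_scalar r \<bullet> (quat_scalar b \<bullet> z)) l"
      by (intro cong_quat_mult cong_refl z_mult_x)
    also have "\<dots> \<simeq>[J] (quat_scalar r \<bullet> y \<bullet> (quat_scalar b \<bullet> z)) l"
      unfolding quat_mult_scalar[of _ r] quat_scalar_mult[of r]
      by (intro cong_quat_mult cong_refl) (use r_commute in \<open>simp add: commute_mod_def\<close>)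
    also have "\<dots> = r * (y \<bullet> quat_scalar b \<bullet> z) l"
      unfolding quat_mult_assoc by (simp add: quat_scalar_mult[of r])
    finally have 1: "(pair \<bullet> conj_x b) l \<simeq>[J] r * (y \<bullet> quat_scalar b \<bullet> z) l" .
    have "r ^ Suc k * (y \<bullet> quat_scalar b \<bullet> z) l = r ^ k * (r * (y \<bullet> quat_scalar b \<bullet> z) l)"
      by (simp only: power_Suc2 mult.assoc)
    also have "\<dots> \<simeq>[J] r ^ k * (pair \<bullet> conj_x b) l"
      by (intro cong_mult_left cong_sym[OF 1])
    also have "\<dots> \<simeq>[J] ((\<lambda>\<mu>. r ^ 0 * pair \<mu>) \<bullet> (\<lambda>\<mu>. r ^ k * conj_x b \<mu>)) l"
      using cong_sym[OF r_power_quat_mult[of 0 pair k "conj_x b" l]] by simp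
    finally show "r ^ Suc k * (y \<bullet> quat_scalar b \<bullet> z) l
      \<simeq>[J] ((\<lambda>\<mu>. r ^ 0 * pair \<mu>) \<bullet> (\<lambda>\<mu>. r ^ k * conj_x b \<mu>)) l" .
    show "((\<lambda>\<mu>. r ^ 0 * pair \<mu>) \<bullet> (\<lambda>\<mu>. r ^ k * conj_x b \<mu>)) l \<in> B"
      by (rule quat_mult_mem_B) (use k pair_mem_B in simp_all)
  qed
  then show ?thesis using w by blast
qed

text \<open>
  \<open>w b r = (w b x\<^sup>*) x\<close>, with the entries of \<open>w b x\<^sup>*\<close> in \<open>B\<close> up to a power of \<open>r\<close>.
\<close>

lemma generator_mult_B:
  assumes g: "g \<in> range x \<union> range y" and "b \<in> B"
  shows "\<exists>k \<beta>. (\<forall>\<kappa>. \<beta> \<kappa> \<in> B) \<and> r ^ k * (g * b) \<simeq>[J] (\<Sum>\<kappa>\<in>UNIV. \<beta> \<kappa> * x \<kappa>)"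
proof -
  obtain w \<mu> where w: "w = x \<or> w = y" and g: "g = w \<mu>" using g by blast
  define D where "D = w \<bullet> quat_scalar b \<bullet> z"
  obtain k where k: "\<forall>l. r ^ k * D l \<in> B"
    using generator_mult_x_conj_mem_B[OF w assms(2)] unfolding D_def by blast
  have "(D \<bullet> x) \<mu> \<simeq>[J] (w \<bullet> quat_scalar b \<bullet> quat_scalar r) \<mu>"
    unfolding D_def quat_mult_assoc[of _ z x] by (intro cong_quat_mult cong_refl z_mult_x)
  also have "\<dots> = g * b * r" by (simp add: quat_mult_scalar g)
  also have "\<dots> \<simeq>[J] r * (g * b)"
    using r_commute by (simp add: commute_mod_def)
  finally have 1: "(D \<bullet> x) \<mu> \<simeq>[J] r * (g * b)" .
  have "r ^ Suc k * (g * b) = r ^ k * (r * (g * b))"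
    by (simp only: power_Suc2 mult.assoc)
  also have "\<dots> \<simeq>[J] r ^ k * (D \<bullet> x) \<mu>"
    by (intro cong_mult_left cong_sym[OF 1])
  also have "\<dots> = (\<Sum>\<kappa>\<in>UNIV. r ^ k * (D \<bullet> quat_unit \<kappa>) \<mu> * x \<kappa>)"
    unfolding quat_mult_eq_sum[of D x] by (simp add: sum_mult_distrib_free mult.assoc)
  finally have 2: "r ^ Suc k * (g * b) \<simeq>[J] (\<Sum>\<kappa>\<in>UNIV. r ^ k * (D \<bullet> quat_unit \<kappa>) \<mu> * x \<kappa>)" .
  have "r ^ k * (D \<bullet> quat_unit \<kappa>) \<mu> = (\<Sum>\<nu>\<in>UNIV. rs (quat_coeff \<mu> \<nu> \<kappa>) * (r ^ k * D \<nu>))" for \<kappa>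
    unfolding quat_mult_unit by (simp add: sum_mult_distrib_free scalar_left_commute[of "r ^ k"])
  then have "r ^ k * (D \<bullet> quat_unit \<kappa>) \<mu> \<in> B" for \<kappa>
    using k by (auto intro!: sum_mem_B B_closed(4))
  with 2 show ?thesis
    by (intro exI[of _ "Suc k"] exI[of _ "\<lambda>\<kappa>. r ^ k * (D \<bullet> quat_unit \<kappa>) \<mu>"]) blast
qed

definition x_span :: "nat \<Rightarrow> free set" where
  "x_span n = {f. \<exists>b. (\<forall>I. b I \<in> B) \<and> f \<simeq>[J] (\<Sum>I\<in>words n. b I * xprod I)}"

lemma x_span_cong: "f \<simeq>[J] g \<Longrightarrow> g \<in> x_span n \<Longrightarrow> f \<in> x_span n"
  unfolding x_span_def using cong_trans by blast

lemma x_span_monomial: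
  assumes "\<beta> \<in> B" "length I = n"
  shows "\<beta> * xprod I \<in> x_span n"
proof -
  have "(\<Sum>I'\<in>words n. (if I' = I then \<beta> else 0) * xprod I') = (\<Sum>I'\<in>words n. if I' = I then \<beta> * xprod I' else 0)"
    by (intro sum.cong) auto
  also have "\<dots> = \<beta> * xprod I"
    using assms(2) sum.delta[OF finite_words[of n], of I "\<lambda>I. \<beta> * xprod I"] by (simp add: words_def)
  finally show ?thesis
    using assms(1) zero_mem_B unfolding x_span_def
    by (intro CollectI exI[of _ "\<lambda>I'. if I' = I then \<beta> else 0"]) auto
qed

lemma x_span_add:
  assumes "f \<in> x_span n" "g \<in> x_span n"
  shows "f + g \<in> x_span n"
proof -
  obtain b c where "\<forall>I. b I \<in> B" "f \<simeq>[J] (\<Sum>I\<in>words n. b I * xprod I)"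
    and "\<forall>I. c I \<in> B" "g \<simeq>[J] (\<Sum>I\<in>words n. c I * xprod I)"
    using assms unfolding x_span_def by blast
  then show ?thesis
    unfolding x_span_def using cong_add[of f _ g]
    by (intro CollectI exI[of _ "\<lambda>I. b I + c I"]) (auto simp: distrib_right sum.distrib B_closed)
qed

lemma x_span_0: "0 \<in> x_span n"
  unfolding x_span_def by (intro CollectI exI[of _ "\<lambda>I. 0"]) (simp add: zero_mem_B)

lemma x_span_sum: "(\<And>i. i \<in> A \<Longrightarrow> f i \<in> x_span n) \<Longrightarrow> sum f A \<in> x_span n"
  by (induction A rule: infinite_finite_induct) (auto intro: x_span_0 x_span_add)

lemma x_span_B_mult:
  assumes "c \<in> B" "f \<in> x_span n"
  shows "c * f \<in> x_span n"
proof -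
  obtain b where b: "\<forall>I. b I \<in> B" "f \<simeq>[J] (\<Sum>I\<in>words n. b I * xprod I)"
    using assms(2) unfolding x_span_def by blast
  have "c * f \<simeq>[J] (\<Sum>I\<in>words n. (c * b I) * xprod I)"
    using cong_mult_left[OF b(2), of c] by (simp add: sum_mult_distrib_free mult.assoc)
  then show ?thesis
    unfolding x_span_def using assms(1) b(1)
    by (intro CollectI exI[of _ "\<lambda>I. c * b I"]) (auto intro: B_closed)
qed

lemma x_span_r_power: "f \<in> x_span n \<Longrightarrow> r ^ k * f \<in> x_span n"
  by (intro x_span_B_mult power_mem_B norm_mem_B)

lemma x_span_r_power_mono: "r ^ j * f \<in> x_span n \<Longrightarrow> j \<le> k \<Longrightarrow> r ^ k * f \<in> x_span n"
  using x_span_r_power[of "r ^ j * f" n "k - j"] by (simp flip: mult.assoc power_add)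

text \<open>
  \<open>r\<close> is a sum of words of length two and commutes with the coefficients.
\<close>

lemma x_span_lift:
  assumes "f \<in> x_span n"
  shows "r * f \<in> x_span (Suc (Suc n))"
proof -
  obtain b where b: "\<forall>I. b I \<in> B" "f \<simeq>[J] (\<Sum>I\<in>words n. b I * xprod I)"
    using assms unfolding x_span_def by blast
  have "r * f \<simeq>[J] r * (\<Sum>I\<in>words n. b I * xprod I)"
    by (intro cong_mult_left b(2))
  also have "\<dots> = (\<Sum>I\<in>words n. r * b I * xprod I)"
    by (simp add: sum_mult_distrib_free mult.assoc)
  also have "\<dots> \<simeq>[J] (\<Sum>I\<in>words n. b I * r * xprod I)"
    by (intro cong_sum cong_mult_right) (use r_commute in \<open>simp add: commute_mod_def\<close>)
  also have "\<dots> = (\<Sum>I\<in>words n. \<Sum>\<rho>\<in>UNIV. b I * xprod (\<rho> # \<rho> # I))"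
    unfolding norm_sq_def by (simp add: sum_mult_distrib_free mult.assoc)
  finally show ?thesis
    by (rule x_span_cong) (intro x_span_sum x_span_monomial, use b(1) in \<open>simp_all add: words_def\<close>)
qed

lemma x_span_generator_mult:
  assumes g: "g \<in> range x \<union> range y" and f: "f \<in> x_span n"
  shows "\<exists>k. r ^ k * (g * f) \<in> x_span (Suc n)"
proof -
  obtain b where b: "\<forall>I. b I \<in> B" "f \<simeq>[J] (\<Sum>I\<in>words n. b I * xprod I)"
    using f unfolding x_span_def by blast
  have "\<exists>k. r ^ k * (g * (b I * xprod I)) \<in> x_span (Suc n)" if I: "I \<in> words n" for I
  proof -
    obtain k \<beta> where \<beta>: "\<forall>\<kappa>. \<beta> \<kappa> \<in> B" and k: "r ^ k * (g * b I) \<simeq>[J] (\<Sum>\<kappa>\<in>UNIV. \<beta> \<kappa> * x \<kappa>)"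
      using generator_mult_B[OF g, of "b I"] b(1) by blast
    have "r ^ k * (g * (b I * xprod I)) \<simeq>[J] (\<Sum>\<kappa>\<in>UNIV. \<beta> \<kappa> * xprod (\<kappa> # I))"
      using cong_mult_right[OF k, of "xprod I"] by (simp add: sum_mult_distrib_free mult.assoc)
    moreover have "(\<Sum>\<kappa>\<in>UNIV. \<beta> \<kappa> * xprod (\<kappa> # I)) \<in> x_span (Suc n)"
      by (intro x_span_sum x_span_monomial) (use \<beta> I in \<open>simp_all add: words_def\<close>)
    ultimately show ?thesis using x_span_cong by blast
  qed
  then obtain k where k: "\<And>I. I \<in> words n \<Longrightarrow> r ^ k I * (g * (b I * xprod I)) \<in> x_span (Suc n)"
    by metis
  define m where "m = Max (k ` words n)"
  have "r ^ m * (g * f) \<simeq>[J] r ^ m * (g * (\<Sum>I\<in>words n. b I * xprod I))"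
    by (intro cong_mult_left b(2))
  also have "\<dots> = (\<Sum>I\<in>words n. r ^ m * (g * (b I * xprod I)))"
    by (simp add: sum_mult_distrib_free)
  finally have "r ^ m * (g * f) \<simeq>[J] (\<Sum>I\<in>words n. r ^ m * (g * (b I * xprod I)))" .
  moreover have "(\<Sum>I\<in>words n. r ^ m * (g * (b I * xprod I))) \<in> x_span (Suc n)"
    by (intro x_span_sum x_span_r_power_mono[OF k]) (auto simp: m_def)
  ultimately show ?thesis using x_span_cong by blast
qed

text \<open>
  Multiplication with \<open>r\<close> raises the length of a word by two, so finitely many lengths can be brought to two
  consecutive ones, but not to a single one.
\<close>

definition graded_span :: "nat \<Rightarrow> free set" where
  "graded_span d = {f. \<exists>g\<in>x_span (2 * d). \<exists>h\<in>x_span (2 * d + 1). f \<simeq>[J] g + h}"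

lemma graded_span_r_power: "f \<in> graded_span d \<Longrightarrow> r ^ k * f \<in> graded_span d"
  unfolding graded_span_def
  using cong_mult_left[of f _ "r ^ k"] x_span_r_power distrib_left by (smt (verit, best) mem_Collect_eq)

lemma graded_span_lift:
  assumes "f \<in> graded_span d"
  shows "r ^ k * f \<in> graded_span (d + k)"
proof (induction k)
  case (Suc k)
  then obtain g h where "g \<in> x_span (2 * (d + k))" "h \<in> x_span (2 * (d + k) + 1)" "r ^ k * f \<simeq>[J] g + h"
    unfolding graded_span_def by blast
  then have "r * g \<in> x_span (2 * (d + Suc k))" "r * h \<in> x_span (2 * (d + Suc k) + 1)"
    "r * (r ^ k * f) \<simeq>[J] r * g + r * h"
    using x_span_lift[of g] x_span_lift[of h] cong_mult_left[of "r ^ k * f" "g + h" r]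
    by (simp_all add: distrib_left)
  then show ?case unfolding graded_span_def by (auto simp: mult.assoc)
qed (use assms in simp)

text \<open>
  Surplus powers of \<open>r\<close> are either absorbed by the coefficients or spent on longer words.
\<close>

lemma graded_span_adjust:
  assumes "r ^ N * f \<in> graded_span d"
  shows "r ^ (N + k + e) * f \<in> graded_span (d + e)"
  using graded_span_lift[OF graded_span_r_power[OF assms, of k], of e]
  by (simp add: add.commute add.left_commute flip: mult.assoc power_add)

lemma graded_span_add: "f \<in> graded_span d \<Longrightarrow> g \<in> graded_span d \<Longrightarrow> f + g \<in> graded_span d"
proof -
  assume "f \<in> graded_span d" "g \<in> graded_span d"
  then obtain f0 f1 g0 g1 where "f0 \<in> x_span (2 * d)" "f1 \<in> x_span (2 * d + 1)" "f \<simeq>[J] f0 + f1"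
    "g0 \<in> x_span (2 * d)" "g1 \<in> x_span (2 * d + 1)" "g \<simeq>[J] g0 + g1"
    unfolding graded_span_def by blast
  then have "f0 + g0 \<in> x_span (2 * d)" "f1 + g1 \<in> x_span (2 * d + 1)"
    "f + g \<simeq>[J] (f0 + g0) + (f1 + g1)"
    using cong_add[of f "f0 + f1" g "g0 + g1"] by (auto intro: x_span_add simp: add_ac)
  then show ?thesis unfolding graded_span_def by blast
qed

lemma r_power_mem_graded_span: "\<exists>N d. r ^ N * f \<in> graded_span d"
proof (induction f rule: free_induct)
  case (scalar c)
  have "scalar c * xprod [] \<in> x_span 0"
    by (rule x_span_monomial) (simp_all add: scalar_mem_B)
  then have "r ^ 0 * scalar c \<in> graded_span 0"
    unfolding graded_span_def
    by (intro CollectI bexI[of _ "scalar c"] bexI[of _ 0]) (simp_all add: x_span_0)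
  then show ?case by blast
next
  case (gen_mult i f)
  let ?g = "free_gen i"
  obtain N d f0 f1 where f: "f0 \<in> x_span (2 * d)" "f1 \<in> x_span (2 * d + 1)" "r ^ N * f \<simeq>[J] f0 + f1"
    using gen_mult unfolding graded_span_def by blast
  obtain j k where j: "r ^ j * (?g * f0) \<in> x_span (Suc (2 * d))"
    and k: "r ^ k * (?g * f1) \<in> x_span (Suc (2 * d + 1))"
    using x_span_generator_mult[OF generators] f by blast
  have f0': "r ^ (j + k + 1) * (?g * f0) \<in> x_span (2 * (d + 1) + 1)"
    using x_span_lift[OF x_span_r_power_mono[OF j, of "j + k"]] by (simp add: mult.assoc)
  have f1': "r ^ (j + k + 1) * (?g * f1) \<in> x_span (2 * (d + 1))"
    using x_span_r_power_mono[OF k, of "j + k + 1"] by simp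
  have "r ^ (j + k + 1 + N) * (?g * f) = r ^ (j + k + 1) * (r ^ N * ?g * f)"
    by (simp only: power_add mult.assoc)
  also have "\<dots> \<simeq>[J] r ^ (j + k + 1) * (?g * r ^ N * f)"
    by (rule cong_mult_left, rule cong_mult_right, rule cong_sym)
      (rule r_power_commute[unfolded commute_mod_def])
  also have "\<dots> \<simeq>[J] r ^ (j + k + 1) * (?g * (f0 + f1))"
    unfolding mult.assoc[of ?g] by (rule cong_mult_left, rule cong_mult_left) (rule f(3))
  also have "\<dots> = r ^ (j + k + 1) * (?g * f1) + r ^ (j + k + 1) * (?g * f0)"
    by (simp add: distrib_left)
  finally have "r ^ (j + k + 1 + N) * (?g * f) \<in> graded_span (d + 1)"
    unfolding graded_span_def using f0' f1' by blast
  then show ?case by blast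
next
  case (add f g)
  then obtain N d M e where f: "r ^ N * f \<in> graded_span d" and g: "r ^ M * g \<in> graded_span e" by blast
  have "r ^ (N + (M + d) + e) * f + r ^ (M + (N + e) + d) * g \<in> graded_span (d + e)"
    by (rule graded_span_add)
      (use graded_span_adjust[OF f, of "M + d" e] graded_span_adjust[OF g, of "N + e" d] in
        \<open>simp_all add: add.commute\<close>)
  then have "r ^ (N + M + d + e) * (f + g) \<in> graded_span (d + e)"
    by (simp add: distrib_left add_ac)
  then show ?case by blast
qed

lemma r_power_mem_graded_span_list: "\<exists>N d. \<forall>f\<in>set fs. r ^ N * f \<in> graded_span d"
proof (induction fs)
  case (Cons g fs)
  then obtain N d where fs: "\<forall>f\<in>set fs. r ^ N * f \<in> graded_span d" by blast
  obtain M e where g: "r ^ M * g \<in> graded_span e" using r_power_mem_graded_span by blast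
  have "r ^ (N + M + d + e) * f \<in> graded_span (d + e)" if "f \<in> set (g # fs)" for f
    using that graded_span_adjust[OF g, of "N + e" d] graded_span_adjust[of N f d "M + d" e] fs
    by (auto simp: add_ac)
  then show ?case by blast
qed simp

end

section \<open>Torsion of the kernel of the canonical map\<close>

text \<open>
  \<open>\<tau> p q\<close> stands for \<open>p \<otimes> q\<close> in a group of formal sums, \<open>K\<close> for the relations of the tensor product balanced
  over \<open>B\<close>, and \<open>\<Psi> v\<close> for the canonical map followed by evaluation at \<open>v\<close>.
\<close>

locale quaternion_pair_tensor = quaternion_pair +
  fixes K :: "'g::ab_group_add set" and \<tau> :: "free \<Rightarrow> free \<Rightarrow> 'g" and \<Psi> :: "(4 \<Rightarrow> real) \<Rightarrow> 'g \<Rightarrow> free"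
  assumes K_subgroup: "ab_subgroup K"
    and \<tau>_add_left: "\<tau> (p + p') q \<simeq>[K] \<tau> p q + \<tau> p' q"
    and \<tau>_add_right: "\<tau> p (q + q') \<simeq>[K] \<tau> p q + \<tau> p q'"
    and \<tau>_cong: "p \<simeq>[J] p' \<Longrightarrow> q \<simeq>[J] q' \<Longrightarrow> \<tau> p q \<simeq>[K] \<tau> p' q'"
    and \<tau>_balanced: "b \<in> B \<Longrightarrow> \<tau> (p * b) q \<simeq>[K] \<tau> p (b * q)"
    and \<Psi>_diff: "\<Psi> v (g - h) = \<Psi> v g - \<Psi> v h"
    and \<Psi>_mem: "v \<in> unit_sphere \<Longrightarrow> g \<in> K \<Longrightarrow> \<Psi> v g \<in> J"
    and \<Psi>_\<tau>: "v \<in> unit_sphere \<Longrightarrow> \<Psi> v (\<tau> p q) \<simeq>[J] p * act v q"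
begin

sublocale K: ab_subgroup K by (rule K_subgroup)

lemmas \<tau>_0_left = K.additive_0[of "\<lambda>p. \<tau> p q" for q, OF \<tau>_add_left]
  and \<tau>_sum_left = K.additive_sum[of "\<lambda>p. \<tau> p q" for q, OF \<tau>_add_left]
  and \<tau>_sum_right = K.additive_sum[of "\<tau> p" for p, OF \<tau>_add_right]
  and \<tau>_sum_list_left = K.additive_sum_list[of "\<lambda>p. \<tau> p q" for q, OF \<tau>_add_left]

lemma cong_sum_list_K: "(\<And>i. i \<in> set is \<Longrightarrow> f i \<simeq>[K] g i) \<Longrightarrow> (\<Sum>i\<leftarrow>is. f i) \<simeq>[K] (\<Sum>i\<leftarrow>is. g i)"
  by (induction "is") (auto intro: K.cong_add)

abbreviation ze :: "4 \<Rightarrow> 4 \<Rightarrow> free" where "ze \<kappa> \<equiv> z \<bullet> quat_unit \<kappa>"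

text \<open>
  The element \<open>c (x\<^sup>* \<otimes> x)\<^sup>Q q\<close>, where \<open>x\<^sup>* \<otimes> x\<close> is the product of quaternions with its left entries
  multiplied to \<open>c\<close> from the right and its right entries to \<open>q\<close> from the left. It cannot be obtained
  letter by letter in the balanced tensor product, as the factor next to the tensor sign may only be multiplied by
  \<open>B\<close>; hence the recursion runs over representatives.
\<close>

primrec insert_word :: "4 list \<Rightarrow> free \<Rightarrow> free \<Rightarrow> 'g" where
  "insert_word [] c q = \<tau> c q"
| "insert_word (\<rho> # Q) c q = (\<Sum>\<kappa>\<in>UNIV. insert_word Q (c * ze \<kappa> \<rho>) (x \<kappa> * q))"

lemma insert_word_cong:
  "c \<simeq>[J] c' \<Longrightarrow> q \<simeq>[J] q' \<Longrightarrow> insert_word Q c q \<simeq>[K] insert_word Q c' q'"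
proof (induction Q arbitrary: c c' q q')
  case (Cons \<rho> Q)
  then show ?case
    unfolding insert_word.simps by (intro K.cong_sum Cons.IH cong_mult_left cong_mult_right)
qed (simp add: \<tau>_cong)

lemma insert_word_add: "insert_word Q (c + c') q \<simeq>[K] insert_word Q c q + insert_word Q c' q"
proof (induction Q arbitrary: c c' q)
  case (Cons \<rho> Q)
  show ?case
    unfolding insert_word.simps distrib_right sum.distrib[symmetric] by (intro K.cong_sum Cons.IH)
qed (simp add: \<tau>_add_left)

lemma insert_word_mem:
  assumes "c \<in> J"
  shows "insert_word Q c q \<in> K"
proof -
  have "insert_word Q 0 q \<in> K"
    by (rule K.additive_0[of "\<lambda>c. insert_word Q c q"]) (rule insert_word_add)
  then show ?thesis
    using insert_word_cong[of c 0 q q Q] assms by (auto simp: cong_0 intro: K.cong_mem)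
qed

lemmas insert_word_sum = K.additive_sum[of "\<lambda>c. insert_word Q c q" for Q q, OF insert_word_add]

lemma zeze: "commute_mod (ze \<kappa> \<rho>) (ze \<kappa>' \<sigma>)"
  by (rule commute_quat_mult) (intro commute_sym[OF commute_quat_mult] zz commute_quat_unit, rule commute_quat_unit)

lemma zeze_swap: "c * ze \<kappa> \<rho> * ze \<kappa>' \<sigma> \<simeq>[J] c * ze \<kappa>' \<sigma> * ze \<kappa> \<rho>"
  using commute_swap[OF zeze[of \<kappa> \<rho> \<kappa>' \<sigma>], where a = c and b = 1] by (simp only: mult_1_right)

lemma xx_swap: "x \<mu> * (x \<nu> * q) \<simeq>[J] x \<nu> * (x \<mu> * q)"
  unfolding mult.assoc[symmetric] by (rule cong_mult_right) (rule x_commute)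

lemma insert_word_mset:
  assumes "mset Q = mset Q'"
  shows "insert_word Q c q \<simeq>[K] insert_word Q' c q"
proof -
  have "\<forall>c q. insert_word Q c q \<simeq>[K] insert_word Q' c q"
    using assms
  proof (induction rule: mset_eq_swap_induct)
    case (trans Q Q' Q'')
    then show ?case using K.cong_trans by blast
  next
    case (swap \<rho> \<sigma> Q)
    show ?case
    proof (intro allI)
      fix c q
      show "insert_word (\<rho> # \<sigma> # Q) c q \<simeq>[K] insert_word (\<sigma> # \<rho> # Q) c q"
        unfolding insert_word.simps
        by (subst sum.swap, rule K.cong_sum, rule K.cong_sum, rule insert_word_cong)
          (rule zeze_swap xx_swap)+
    qed
  next
    case (cons \<rho> Q Q')
    then show ?case by (auto intro: K.cong_sum)
  qed auto
  then show ?thesis by blast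
qed

text \<open>
  The coefficient of \<open>v\<^sup>Q\<close> in \<open>(x v)\<^sup>I\<close>.
\<close>

fun translate :: "4 list \<Rightarrow> 4 list \<Rightarrow> free" where
  "translate (\<rho> # Q) (i # I) = xe \<rho> i * translate Q I"
| "translate _ _ = 1"

lemma commute_translate: "(\<And>\<mu>. commute_mod f (x \<mu>)) \<Longrightarrow> commute_mod f (translate Q I)"
  by (induction Q I rule: translate.induct)
    (auto intro: commute_mult commute_quat_mult commute_quat_unit commute_1)

lemma prod_list_translate:
  "prod_list (map (x \<bullet> quat_real v) I)
    = (\<Sum>Q\<in>words (length I). rs (prod_list (map v Q)) * translate Q I)"
proof (induction I)
  case (Cons i I)
  have "prod_list (map (x \<bullet> quat_real v) (i # I))
    = (\<Sum>\<rho>\<in>UNIV. rs (v \<rho>) * xe \<rho> i) * (\<Sum>Q\<in>words (length I). rs (prod_list (map v Q)) * translate Q I)"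
    by (simp only: list.map prod_list.Cons Cons quat_mult_real[of x v i])
  then show ?case
    by (simp add: sum_words_Suc sum_product scalar_mult mult.assoc scalar_left_commute[of "xe \<rho> i" for \<rho>])
qed (simp add: sum_words_0 scalar_1)

text \<open>
  Substituting \<open>x\<^sup>* \<otimes> x\<close> for \<open>v\<close> in \<open>(x v)\<^sup>I\<close> gives \<open>(x x\<^sup>* \<otimes> x)\<^sup>I = (r \<otimes> x)\<^sup>I\<close>. One letter at a time, the
  middle product \<open>\<Sum>\<^sub>\<rho> (x e\<^sub>\<rho>)\<^sup>i (x\<^sup>* e\<^sub>\<kappa>)\<^sup>\<rho> = (x x\<^sup>* e\<^sub>\<kappa>)\<^sup>i\<close> is \<open>r\<close> for \<open>\<kappa> = i\<close> and zero otherwise.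
\<close>

lemma sum_insert_word_translate:
  "(\<Sum>Q\<in>words (length I). insert_word Q (c * translate Q I) q)
    \<simeq>[K] \<tau> (c * r ^ length I) (xprod I * q)"
proof (induction I arbitrary: c q)
  case (Cons i I)
  let ?n = "length I"
  have xe_ze: "(\<Sum>\<rho>\<in>UNIV. xe \<rho> i * ze \<kappa> \<rho>) \<simeq>[J] (if \<kappa> = i then r else 0)" for \<kappa>
  proof -
    have "(\<Sum>\<rho>\<in>UNIV. xe \<rho> i * ze \<kappa> \<rho>) = (x \<bullet> z \<bullet> quat_unit \<kappa>) i"
      unfolding quat_mult_assoc by (rule quat_mult_eq_sum[symmetric])
    also have "\<dots> \<simeq>[J] (quat_scalar r \<bullet> quat_unit \<kappa>) i"
      by (intro cong_quat_mult x_mult_z cong_refl)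
    also have "\<dots> = (if \<kappa> = i then r else 0)"
      by (simp add: quat_scalar_mult quat_unit_def)
    finally show ?thesis .
  qed
  have "(\<Sum>Q\<in>words (length (i # I)). insert_word Q (c * translate Q (i # I)) q)
    = (\<Sum>\<rho>\<in>UNIV. \<Sum>Q\<in>words ?n. \<Sum>\<kappa>\<in>UNIV. insert_word Q (c * xe \<rho> i * translate Q I * ze \<kappa> \<rho>) (x \<kappa> * q))"
    by (simp add: sum_words_Suc mult.assoc)
  also have "\<dots> = (\<Sum>\<kappa>\<in>UNIV. \<Sum>\<rho>\<in>UNIV. \<Sum>Q\<in>words ?n. insert_word Q (c * xe \<rho> i * translate Q I * ze \<kappa> \<rho>) (x \<kappa> * q))"
    by (subst sum.swap[of _ UNIV "words ?n"], subst sum.swap[of _ UNIV UNIV], rule refl)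
  also have "\<dots> \<simeq>[K] (\<Sum>\<kappa>\<in>UNIV. \<Sum>\<rho>\<in>UNIV. \<Sum>Q\<in>words ?n. insert_word Q (c * xe \<rho> i * ze \<kappa> \<rho> * translate Q I) (x \<kappa> * q))"
  proof (intro K.cong_sum insert_word_cong cong_refl)
    fix \<rho> \<kappa> Q
    have "commute_mod (translate Q I) (ze \<kappa> \<rho>)"
      by (intro commute_quat_mult commute_sym[OF commute_translate] zx commute_quat_unit)
    then show "c * xe \<rho> i * translate Q I * ze \<kappa> \<rho> \<simeq>[J] c * xe \<rho> i * ze \<kappa> \<rho> * translate Q I"
      using commute_swap[of _ _ "c * xe \<rho> i" 1] by simp
  qed
  also have "\<dots> \<simeq>[K] (\<Sum>\<kappa>\<in>UNIV. \<Sum>\<rho>\<in>UNIV. \<tau> (c * xe \<rho> i * ze \<kappa> \<rho> * r ^ ?n) (xprod I * (x \<kappa> * q)))"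
    apply (rule K.cong_sum)
    apply (rule K.cong_sum)
    apply (rule Cons.IH)
    done
  also have "\<dots> \<simeq>[K] (\<Sum>\<kappa>\<in>UNIV. \<tau> (\<Sum>\<rho>\<in>UNIV. c * xe \<rho> i * ze \<kappa> \<rho> * r ^ ?n) (xprod I * (x \<kappa> * q)))"
    by (intro K.cong_sum K.cong_sym[OF \<tau>_sum_left])
  also have "\<dots> = (\<Sum>\<kappa>\<in>UNIV. \<tau> (c * (\<Sum>\<rho>\<in>UNIV. xe \<rho> i * ze \<kappa> \<rho>) * r ^ ?n) (xprod I * (x \<kappa> * q)))"
    by (simp add: sum_mult_distrib_free mult.assoc)
  also have "\<dots> \<simeq>[K] (\<Sum>\<kappa>\<in>UNIV. \<tau> (c * (if \<kappa> = i then r else 0) * r ^ ?n) (xprod I * (x \<kappa> * q)))"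
    by (intro K.cong_sum \<tau>_cong cong_refl cong_mult_right cong_mult_left xe_ze)
  also have "\<dots> \<simeq>[K] (\<Sum>\<kappa>\<in>UNIV. if \<kappa> = i then \<tau> (c * r ^ Suc ?n) (xprod I * (x i * q)) else 0)"
    by (intro K.cong_sum) (auto simp: mult.assoc \<tau>_0_left K.cong_0)
  also have "\<dots> = \<tau> (c * r ^ Suc ?n) (xprod I * (x i * q))"
    by simp
  also have "\<dots> \<simeq>[K] \<tau> (c * r ^ Suc ?n) (xprod (i # I) * q)"
  proof (rule \<tau>_cong)
    show "xprod I * (x i * q) \<simeq>[J] xprod (i # I) * q"
      using cong_mult_right[OF prod_list_mset_cong[where z = x and I = "I @ [i]" and I' = "i # I"], of q] xx
      by (simp add: mult.assoc)
  qed simp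
  finally show ?case by simp
qed (simp add: sum_words_0)

lemma vanishing_imp_torsion:
  assumes "\<And>v. v \<in> unit_sphere \<Longrightarrow> (\<Sum>I\<in>words n. a I * prod_list (map (x \<bullet> quat_real v) I)) \<in> J"
  shows "(\<Sum>I\<in>words n. \<tau> (a I * r ^ n) (xprod I)) \<in> K"
proof -
  have "(\<Sum>Q\<in>words n. insert_word Q (\<Sum>I\<in>words n. a I * translate Q I) 1) \<in> K"
  proof (rule sphere_substitution[where \<Phi> = "\<lambda>Q f. insert_word Q f 1"])
    fix v assume v: "v \<in> unit_sphere"
    have "(\<Sum>I\<in>words n. a I * prod_list (map (x \<bullet> quat_real v) I))
      = (\<Sum>I\<in>words n. \<Sum>Q\<in>words n. rs (prod_list (map v Q)) * (a I * translate Q I))"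
      by (intro sum.cong refl)
        (simp add: prod_list_translate words_def sum_mult_distrib_free scalar_left_commute[of "a _"])
    also have "\<dots> = (\<Sum>Q\<in>words n. rs (prod_list (map v Q)) * (\<Sum>I\<in>words n. a I * translate Q I))"
      unfolding sum_mult_distrib_free by (rule sum.swap)
    finally show "(\<Sum>Q\<in>words n. rs (prod_list (map v Q)) * (\<Sum>I\<in>words n. a I * translate Q I)) \<in> J"
      using assms[OF v] by simp
  qed (rule K_subgroup insert_word_add insert_word_mset insert_word_mem | assumption)+
  moreover have "(\<Sum>I\<in>words n. \<tau> (a I * r ^ n) (xprod I))
    \<simeq>[K] (\<Sum>Q\<in>words n. insert_word Q (\<Sum>I\<in>words n. a I * translate Q I) 1)"
  proof -
    have "(\<Sum>I\<in>words n. \<tau> (a I * r ^ n) (xprod I))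
      \<simeq>[K] (\<Sum>I\<in>words n. \<Sum>Q\<in>words n. insert_word Q (a I * translate Q I) 1)"
      using K.cong_sym[OF sum_insert_word_translate[where q = 1]] by (intro K.cong_sum) (auto simp: words_def)
    also have "\<dots> = (\<Sum>Q\<in>words n. \<Sum>I\<in>words n. insert_word Q (a I * translate Q I) 1)"
      by (rule sum.swap)
    also have "\<dots> \<simeq>[K] (\<Sum>Q\<in>words n. insert_word Q (\<Sum>I\<in>words n. a I * translate Q I) 1)"
      by (intro K.cong_sum K.cong_sym[OF insert_word_sum])
    finally show ?thesis .
  qed
  ultimately show ?thesis using K.cong_mem by blast
qed

lemma act_xprod: "act v (xprod I) = prod_list (map (x \<bullet> quat_real v) I)"
  by (induction I) (simp_all add: act_1 act_mult act_x)

text \<open>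
  Replacing \<open>v\<close> by \<open>- v\<close> changes the sign of the part of odd degree only.
\<close>

lemma vanishing_sum_homogeneous:
  assumes vanish: "\<And>v. v \<in> unit_sphere \<Longrightarrow> (\<Sum>I\<in>words (2 * d). a I * act v (xprod I))
      + (\<Sum>I\<in>words (2 * d + 1). b I * act v (xprod I)) \<in> J"
    and v: "v \<in> unit_sphere"
  shows "(\<Sum>I\<in>words (2 * d). a I * act v (xprod I)) \<in> J" (is "?F v \<in> J")
    and "(\<Sum>I\<in>words (2 * d + 1). b I * act v (xprod I)) \<in> J" (is "?G v \<in> J")
proof -
  have neg: "(x \<bullet> quat_real (\<lambda>\<rho>. - v \<rho>)) \<mu> = rs (- 1) * (x \<bullet> quat_real v) \<mu>" for \<mu>
    unfolding quat_mult_real sum_mult_distrib_free by (simp add: scalar_uminus scalar_1)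
  have "prod_list (map (x \<bullet> quat_real (\<lambda>\<rho>. - v \<rho>)) I) = rs ((- 1) ^ length I) * prod_list (map (x \<bullet> quat_real v) I)" for I
  proof (induction I)
    case (Cons i I)
    have "prod_list (map (x \<bullet> quat_real (\<lambda>\<rho>. - v \<rho>)) (i # I))
      = rs (- 1) * ((x \<bullet> quat_real v) i * (rs ((- 1) ^ length I) * prod_list (map (x \<bullet> quat_real v) I)))"
      by (simp only: list.map prod_list.Cons Cons neg mult.assoc)
    also have "\<dots> = rs (- 1 * (- 1) ^ length I) * prod_list (map (x \<bullet> quat_real v) (i # I))"
      unfolding scalar_left_commute[of "(x \<bullet> quat_real v) i"] of_real_mult scalar_mult by (simp add: mult.assoc)
    finally show ?case by simp
  qed (simp add: scalar_1)
  then have act_neg: "act (\<lambda>\<rho>. - v \<rho>) (xprod I) = rs ((- 1) ^ length I) * act v (xprod I)" for I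
    by (simp add: act_xprod)
  have "?F (\<lambda>\<rho>. - v \<rho>) = ?F v"
    by (intro sum.cong refl) (simp add: act_neg words_def scalar_1)
  moreover have "?G (\<lambda>\<rho>. - v \<rho>) = - ?G v"
    unfolding sum_negf[symmetric] by (intro sum.cong refl) (simp add: act_neg words_def scalar_1 scalar_uminus)
  moreover have "(\<lambda>\<rho>. - v \<rho>) \<in> unit_sphere"
    using v by (simp add: unit_sphere_def)
  ultimately have minus: "?F v - ?G v \<in> J"
    using vanish[of "\<lambda>\<rho>. - v \<rho>"] by simp
  have plus: "?F v + ?G v \<in> J" by (rule vanish) (rule v)
  have two: "scalar 2 * f = f + f" for f
    unfolding one_add_one[symmetric] scalar_add scalar_1 distrib_right by simp
  show "?F v \<in> J"
    by (rule scalar_cancel[of 2]) (use add_mem[OF plus minus] in \<open>simp_all add: two del: single_numeral\<close>)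
  show "?G v \<in> J"
    by (rule scalar_cancel[of 2]) (use diff_mem[OF plus minus] in \<open>simp_all add: two del: single_numeral\<close>)
qed

lemma vanishing_imp_torsion_power:
  assumes vanish: "\<And>v. v \<in> unit_sphere \<Longrightarrow> (\<Sum>I\<in>words n. a I * act v (xprod I)) \<in> J"
    and "n \<le> m"
  shows "(\<Sum>I\<in>words n. \<tau> (a I * r ^ m) (xprod I)) \<in> K"
proof -
  have "(\<Sum>I\<in>words n. \<tau> (a I * r ^ (m - n) * r ^ n) (xprod I)) \<in> K"
  proof (rule vanishing_imp_torsion)
    fix v assume v: "v \<in> unit_sphere"
    have "(\<Sum>I\<in>words n. a I * r ^ (m - n) * prod_list (map (x \<bullet> quat_real v) I))
      \<simeq>[J] (\<Sum>I\<in>words n. r ^ (m - n) * a I * prod_list (map (x \<bullet> quat_real v) I))"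
      by (intro cong_sum cong_mult_right) (rule r_power_commute[unfolded commute_mod_def])
    also have "\<dots> = r ^ (m - n) * (\<Sum>I\<in>words n. a I * act v (xprod I))"
      by (simp add: sum_mult_distrib_free mult.assoc act_xprod)
    finally show "(\<Sum>I\<in>words n. a I * r ^ (m - n) * prod_list (map (x \<bullet> quat_real v) I)) \<in> J"
      by (rule cong_mem) (intro left_mem vanish v)
  qed
  then show ?thesis
    using assms(2) by (simp add: mult.assoc flip: power_add)
qed

lemma \<Psi>_0: "\<Psi> v 0 = 0"
  using \<Psi>_diff[of v 0 0] by simp

lemma \<Psi>_add: "\<Psi> v (g + h) = \<Psi> v g + \<Psi> v h"
  using \<Psi>_diff[of v g "- h"] \<Psi>_diff[of v 0 h] by (simp add: \<Psi>_0)

lemma \<Psi>_sum_list: "\<Psi> v (\<Sum>i\<leftarrow>is. f i) = (\<Sum>i\<leftarrow>is. \<Psi> v (f i))"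
  by (induction "is") (simp_all add: \<Psi>_0 \<Psi>_add)

lemma \<Psi>_sum: "\<Psi> v (sum f A) = (\<Sum>i\<in>A. \<Psi> v (f i))"
  by (induction A rule: infinite_finite_induct) (simp_all add: \<Psi>_0 \<Psi>_add)

text \<open>
  After multiplication with \<open>r\<^sup>N\<close> the second factors are combinations of words of length \<open>2 d\<close> and \<open>2 d + 1\<close> with
  coefficients in \<open>B\<close>, which move across the tensor sign. The hypothesis passes to these sums because
  \<open>\<Psi>\<close> respects the relations, and \<open>vanishing_imp_torsion\<close> applies to each of the two lengths.
\<close>

theorem vanishing_imp_r_torsion:
  assumes vanish: "\<And>v. v \<in> unit_sphere \<Longrightarrow> \<Psi> v (\<Sum>(p, q)\<leftarrow>ps. \<tau> p q) \<in> J"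
  shows "\<exists>N. (\<Sum>(p, q)\<leftarrow>ps. \<tau> (r ^ N * p) q) \<in> K"
proof -
  obtain N d where N: "\<forall>q\<in>set (map snd ps). r ^ N * q \<in> graded_span d"
    using r_power_mem_graded_span_list by blast
  have "\<forall>q\<in>snd ` set ps. \<exists>bc. (\<forall>I. fst bc I \<in> B) \<and> (\<forall>I. snd bc I \<in> B) \<and> r ^ N * q \<simeq>[J]
      (\<Sum>I\<in>words (2 * d). fst bc I * xprod I) + (\<Sum>I\<in>words (2 * d + 1). snd bc I * xprod I)"
  proof
    fix q assume "q \<in> snd ` set ps"
    then have "r ^ N * q \<in> graded_span d" using N by auto
    then obtain g h where "g \<in> x_span (2 * d)" "h \<in> x_span (2 * d + 1)" and gh: "r ^ N * q \<simeq>[J] g + h"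
      unfolding graded_span_def by blast
    then obtain b c where b: "\<forall>I. b I \<in> B" "g \<simeq>[J] (\<Sum>I\<in>words (2 * d). b I * xprod I)"
      and c: "\<forall>I. c I \<in> B" "h \<simeq>[J] (\<Sum>I\<in>words (2 * d + 1). c I * xprod I)"
      unfolding x_span_def by blast
    show "\<exists>bc. (\<forall>I. fst bc I \<in> B) \<and> (\<forall>I. snd bc I \<in> B) \<and> r ^ N * q \<simeq>[J]
      (\<Sum>I\<in>words (2 * d). fst bc I * xprod I) + (\<Sum>I\<in>words (2 * d + 1). snd bc I * xprod I)"
      using b(1) c(1) cong_trans[OF gh cong_add[OF b(2) c(2)]] by (intro exI[of _ "(b, c)"]) simp
  qed
  from bchoice[OF this] obtain bc where bc': "\<forall>q\<in>snd ` set ps. (\<forall>I. fst (bc q) I \<in> B) \<and>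
      (\<forall>I. snd (bc q) I \<in> B) \<and> r ^ N * q \<simeq>[J]
      (\<Sum>I\<in>words (2 * d). fst (bc q) I * xprod I) + (\<Sum>I\<in>words (2 * d + 1). snd (bc q) I * xprod I)" ..
  define b c where "b q = fst (bc q)" and "c q = snd (bc q)" for q
  have b: "b q I \<in> B" and c: "c q I \<in> B"
    and bc: "r ^ N * q \<simeq>[J] (\<Sum>I\<in>words (2 * d). b q I * xprod I) + (\<Sum>I\<in>words (2 * d + 1). c q I * xprod I)"
    if "(p, q) \<in> set ps" for p q I
    using bspec[OF bc', of q] that by (force simp: b_def c_def)+
  define a0 where "a0 I = (\<Sum>(p, q)\<leftarrow>ps. p * b q I)" for I
  define a1 where "a1 I = (\<Sum>(p, q)\<leftarrow>ps. p * c q I)" for I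
  have collect: "(\<Sum>(p, q)\<leftarrow>ps. \<Sum>I\<in>words n. \<tau> (p * r ^ m) (\<beta> q I * xprod I))
      \<simeq>[K] (\<Sum>I\<in>words n. \<tau> ((\<Sum>(p, q)\<leftarrow>ps. p * \<beta> q I) * r ^ m) (xprod I))"
    if \<beta>: "\<And>p q I. (p, q) \<in> set ps \<Longrightarrow> \<beta> q I \<in> B" for n m and \<beta> :: "free \<Rightarrow> 4 list \<Rightarrow> free"
  proof -
    have "(\<Sum>(p, q)\<leftarrow>ps. \<Sum>I\<in>words n. \<tau> (p * r ^ m) (\<beta> q I * xprod I))
      \<simeq>[K] (\<Sum>(p, q)\<leftarrow>ps. \<Sum>I\<in>words n. \<tau> (p * \<beta> q I * r ^ m) (xprod I))"
    proof (rule cong_sum_list_K, clarify, rule K.cong_sum)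
      fix p q I assume pq: "(p, q) \<in> set ps"
      have "\<tau> (p * r ^ m) (\<beta> q I * xprod I) \<simeq>[K] \<tau> (p * r ^ m * \<beta> q I) (xprod I)"
        by (rule K.cong_sym, rule \<tau>_balanced) (rule \<beta>[OF pq])
      also have "\<dots> \<simeq>[K] \<tau> (p * \<beta> q I * r ^ m) (xprod I)"
        using commute_swap[OF commute_sym[OF r_power_commute[of "\<beta> q I" m]], where a = p and b = 1]
        by (intro \<tau>_cong cong_refl) (simp only: mult_1_right)
      finally show "\<tau> (p * r ^ m) (\<beta> q I * xprod I) \<simeq>[K] \<tau> (p * \<beta> q I * r ^ m) (xprod I)" .
    qed
    also have "\<dots> = (\<Sum>I\<in>words n. \<Sum>(p, q)\<leftarrow>ps. \<tau> (p * \<beta> q I * r ^ m) (xprod I))"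
      by (induction ps) (auto simp: sum.distrib)
    also have "\<dots> \<simeq>[K] (\<Sum>I\<in>words n. \<tau> (\<Sum>(p, q)\<leftarrow>ps. p * \<beta> q I * r ^ m) (xprod I))"
      using K.cong_sym[OF \<tau>_sum_list_left] by (intro K.cong_sum) (simp add: case_prod_unfold)
    also have "\<dots> = (\<Sum>I\<in>words n. \<tau> ((\<Sum>(p, q)\<leftarrow>ps. p * \<beta> q I) * r ^ m) (xprod I))"
      by (simp add: sum_list_mult_const[symmetric] case_prod_unfold)
    finally show ?thesis .
  qed
  have main: "(\<Sum>(p, q)\<leftarrow>ps. \<tau> (r ^ (m + N) * p) q) \<simeq>[K]
      (\<Sum>I\<in>words (2 * d). \<tau> (a0 I * r ^ m) (xprod I)) + (\<Sum>I\<in>words (2 * d + 1). \<tau> (a1 I * r ^ m) (xprod I))" for m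
  proof -
    have "(\<Sum>(p, q)\<leftarrow>ps. \<tau> (r ^ (m + N) * p) q) \<simeq>[K] (\<Sum>(p, q)\<leftarrow>ps.
      (\<Sum>I\<in>words (2 * d). \<tau> (p * r ^ m) (b q I * xprod I)) + (\<Sum>I\<in>words (2 * d + 1). \<tau> (p * r ^ m) (c q I * xprod I)))"
    proof (rule cong_sum_list_K, clarify)
      fix p q assume pq: "(p, q) \<in> set ps"
      have "\<tau> (r ^ (m + N) * p) q \<simeq>[K] \<tau> (p * r ^ m * r ^ N) q"
        using cong_sym[OF r_power_commute[unfolded commute_mod_def, of p "m + N"]]
        by (intro \<tau>_cong cong_refl) (simp add: power_add mult.assoc)
      also have "\<dots> \<simeq>[K] \<tau> (p * r ^ m) (r ^ N * q)"
        by (intro \<tau>_balanced power_mem_B norm_mem_B)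
      also have "\<dots> \<simeq>[K] \<tau> (p * r ^ m) ((\<Sum>I\<in>words (2 * d). b q I * xprod I) + (\<Sum>I\<in>words (2 * d + 1). c q I * xprod I))"
        by (intro \<tau>_cong cong_refl bc[OF pq])
      also have "\<dots> \<simeq>[K] \<tau> (p * r ^ m) (\<Sum>I\<in>words (2 * d). b q I * xprod I) + \<tau> (p * r ^ m) (\<Sum>I\<in>words (2 * d + 1). c q I * xprod I)"
        by (rule \<tau>_add_right)
      also have "\<dots> \<simeq>[K] (\<Sum>I\<in>words (2 * d). \<tau> (p * r ^ m) (b q I * xprod I)) + (\<Sum>I\<in>words (2 * d + 1). \<tau> (p * r ^ m) (c q I * xprod I))"
        by (intro K.cong_add \<tau>_sum_right)
      finally show "\<tau> (r ^ (m + N) * p) q \<simeq>[K] (\<Sum>I\<in>words (2 * d). \<tau> (p * r ^ m) (b q I * xprod I)) + (\<Sum>I\<in>words (2 * d + 1). \<tau> (p * r ^ m) (c q I * xprod I))" .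
    qed
    also have "\<dots> = (\<Sum>(p, q)\<leftarrow>ps. \<Sum>I\<in>words (2 * d). \<tau> (p * r ^ m) (b q I * xprod I))
        + (\<Sum>(p, q)\<leftarrow>ps. \<Sum>I\<in>words (2 * d + 1). \<tau> (p * r ^ m) (c q I * xprod I))"
      by (simp add: sum_list_addf case_prod_unfold)
    also have "\<dots> \<simeq>[K] (\<Sum>I\<in>words (2 * d). \<tau> (a0 I * r ^ m) (xprod I)) + (\<Sum>I\<in>words (2 * d + 1). \<tau> (a1 I * r ^ m) (xprod I))"
      unfolding a0_def a1_def by (rule K.cong_add) (rule collect, erule b c)+
    finally show ?thesis .
  qed
  have "(\<Sum>I\<in>words (2 * d). a0 I * act v (xprod I)) + (\<Sum>I\<in>words (2 * d + 1). a1 I * act v (xprod I)) \<in> J"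
    (is "?S \<in> J") if v: "v \<in> unit_sphere" for v
  proof -
    let ?t = "\<Sum>(p, q)\<leftarrow>ps. \<tau> (r ^ (0 + N) * p) q"
    let ?g = "(\<Sum>I\<in>words (2 * d). \<tau> (a0 I * r ^ 0) (xprod I)) + (\<Sum>I\<in>words (2 * d + 1). \<tau> (a1 I * r ^ 0) (xprod I))"
    have sum_cong: "(\<Sum>(p, q)\<leftarrow>qs. f p q) \<simeq>[J] (\<Sum>(p, q)\<leftarrow>qs. g p q)"
      if "\<And>p q. f p q \<simeq>[J] g p q" for f g :: "free \<Rightarrow> free \<Rightarrow> free" and qs
      by (induction qs) (auto intro: cong_add that)
    have "\<Psi> v ?t = (\<Sum>(p, q)\<leftarrow>ps. \<Psi> v (\<tau> (r ^ N * p) q))"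
      by (simp add: \<Psi>_sum_list case_prod_unfold)
    also have "\<dots> \<simeq>[J] (\<Sum>(p, q)\<leftarrow>ps. r ^ N * p * act v q)"
      by (rule sum_cong) (rule \<Psi>_\<tau>[OF v])
    also have "\<dots> = r ^ N * (\<Sum>(p, q)\<leftarrow>ps. p * act v q)"
      by (simp add: sum_list_const_mult[symmetric] case_prod_unfold mult.assoc)
    also have "\<dots> \<simeq>[J] r ^ N * (\<Sum>(p, q)\<leftarrow>ps. \<Psi> v (\<tau> p q))"
      by (rule cong_mult_left, rule sum_cong) (rule cong_sym[OF \<Psi>_\<tau>[OF v]])
    also have "\<dots> = r ^ N * \<Psi> v (\<Sum>(p, q)\<leftarrow>ps. \<tau> p q)"
      by (simp add: \<Psi>_sum_list case_prod_unfold)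
    finally have "\<Psi> v ?t \<in> J"
      by (rule cong_mem) (intro left_mem vanish v)
    moreover have "\<Psi> v (?t - ?g) \<in> J"
      by (rule \<Psi>_mem[OF v]) (use main[of 0] in \<open>simp only: cong_mod_def\<close>)
    ultimately have "\<Psi> v ?g \<in> J"
      using diff_mem[of "\<Psi> v ?t" "\<Psi> v (?t - ?g)"] by (simp only: \<Psi>_diff) simp
    have "?S \<simeq>[J] \<Psi> v ?g"
      unfolding \<Psi>_add \<Psi>_sum
      by (intro cong_add cong_sum) (simp_all add: cong_sym[OF \<Psi>_\<tau>[OF v]])
    then show ?thesis using \<open>\<Psi> v ?g \<in> J\<close> by (rule cong_mem)
  qed
  note homogeneous = vanishing_sum_homogeneous[OF this]
  have "(\<Sum>(p, q)\<leftarrow>ps. \<tau> (r ^ (2 * d + 1 + N) * p) q) \<in> K"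
    using main[of "2 * d + 1"]
    by (rule K.cong_mem) (intro K.add_mem vanishing_imp_torsion_power homogeneous; simp)
  then show ?thesis by blast
qed

end

section \<open>Tensor products\<close>


definition frag_ext :: "('k \<Rightarrow> free) \<Rightarrow> ('k \<Rightarrow>\<^sub>0 int) \<Rightarrow> free" where
  "frag_ext g t = (\<Sum>k\<in>Poly_Mapping.keys t. of_int (Poly_Mapping.lookup t k) * g k)"

lemma frag_ext_of [simp]: "frag_ext g (frag_of k) = g k"
  by (simp add: frag_ext_def)

lemma frag_ext_diff: "frag_ext g (s - t) = frag_ext g s - frag_ext g t"
proof -
  let ?K = "Poly_Mapping.keys s \<union> Poly_Mapping.keys t"
  have *: "frag_ext g u = (\<Sum>k\<in>?K. of_int (Poly_Mapping.lookup u k) * g k)"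
    if "Poly_Mapping.keys u \<subseteq> ?K" for u
    unfolding frag_ext_def by (rule sum.mono_neutral_left) (use that in \<open>auto simp: in_keys_iff\<close>)
  show ?thesis
    using keys_diff[of s t] by (simp add: * lookup_minus left_diff_distrib sum_subtractf)
qed

lemma frag_ext_0 [simp]: "frag_ext g 0 = 0"
  by (simp add: frag_ext_def)

lemma frag_ext_minus: "frag_ext g (- t) = - frag_ext g t"
  using frag_ext_diff[of g 0 t] by simp

lemma frag_ext_add: "frag_ext g (s + t) = frag_ext g s + frag_ext g t"
  using frag_ext_diff[of g s "- t"] by (simp add: frag_ext_minus)

text \<open>
  Elements of the tensor product are cosets of formal sums. All statements about them are reduced to
  congruences of formal sums modulo the subgroup generated by the relations.
\<close>

locale balanced_tensor =
  fixes M :: "('a, 'm) ring_scheme" and N :: "('b, 'n) ring_scheme" and S :: "'s set"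
    and r :: "'a \<Rightarrow> 's \<Rightarrow> 'a" and l :: "'s \<Rightarrow> 'b \<Rightarrow> 'b"
  assumes add_M: "\<lbrakk>m \<in> carrier M; m' \<in> carrier M\<rbrakk> \<Longrightarrow> m \<oplus>\<^bsub>M\<^esub> m' \<in> carrier M"
    and add_N: "\<lbrakk>n \<in> carrier N; n' \<in> carrier N\<rbrakk> \<Longrightarrow> n \<oplus>\<^bsub>N\<^esub> n' \<in> carrier N"
    and act_M: "\<lbrakk>m \<in> carrier M; s \<in> S\<rbrakk> \<Longrightarrow> r m s \<in> carrier M"
    and act_N: "\<lbrakk>n \<in> carrier N; s \<in> S\<rbrakk> \<Longrightarrow> l s n \<in> carrier N"
begin

abbreviation "F \<equiv> free_Abelian_group (carrier M \<times> carrier N)"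
abbreviation "K \<equiv> tensor_kernel M N S r l"
abbreviation "tclass \<equiv> tensor_class M N S r l"
abbreviation "T \<equiv> tensor_group M N S r l"
abbreviation "formal \<equiv> {t :: 'a \<times> 'b \<Rightarrow>\<^sub>0 int. Poly_Mapping.keys t \<subseteq> carrier M \<times> carrier N}"

lemma relations_formal: "tensor_relations M N S r l \<subseteq> formal"
  unfolding tensor_relations_def
  by (auto dest!: subsetD[OF keys_diff] simp: keys_frag_of add_M add_N act_M act_N)

lemma formal_diff: "s \<in> formal \<Longrightarrow> t \<in> formal \<Longrightarrow> s - t \<in> formal"
  using keys_diff[of s t] by auto

lemma formal_add: "s \<in> formal \<Longrightarrow> t \<in> formal \<Longrightarrow> s + t \<in> formal"
  using keys_add[of s t] by auto

lemma formal_induct [consumes 1, case_names zero of diff]: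
  assumes "t \<in> formal" "P 0" "\<And>m n. m \<in> carrier M \<Longrightarrow> n \<in> carrier N \<Longrightarrow> P (frag_of (m, n))"
    "\<And>s t. s \<in> formal \<Longrightarrow> t \<in> formal \<Longrightarrow> P s \<Longrightarrow> P t \<Longrightarrow> P (s - t)"
  shows "P t"
  by (rule free_Abelian_group_induct[of t "carrier M \<times> carrier N"]) (use assms in auto)

lemma kernel_subgroup: "subgroup K F"
  unfolding tensor_kernel_def
  by (rule group.generate_is_subgroup) (use relations_formal in auto)

lemma kernel_formal: "K \<subseteq> formal"
  using subgroup.subset[OF kernel_subgroup] by (simp add: free_Abelian_group_def)

sublocale K: ab_subgroup K
proof
  show "0 \<in> K" using subgroup.one_closed[OF kernel_subgroup] by simp
  fix s t assume s: "s \<in> K" and t: "t \<in> K"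
  have "- t \<in> K"
    using subgroup.m_inv_closed[OF kernel_subgroup t] kernel_formal t by auto
  then show "s - t \<in> K"
    using subgroup.m_closed[OF kernel_subgroup s, of "- t"] by simp
qed

text \<open>
  The way to show that an additive map on formal sums descends to the tensor product.
\<close>

lemma kernel_minimal:
  assumes "ab_subgroup L" "tensor_relations M N S r l \<subseteq> L"
  shows "K \<subseteq> L"
proof
  interpret L: ab_subgroup L by fact
  fix t assume "t \<in> K"
  then show "t \<in> L" unfolding tensor_kernel_def
  proof (induction rule: generate.induct)
    case (inv h)
    then have "inv\<^bsub>F\<^esub> h = - h" using relations_formal by auto
    then show ?case using inv assms(2) L.uminus_mem by auto
  qed (use assms(2) in \<open>auto intro: L.zero_mem L.add_mem\<close>)
qed

lemma tensor_add_left: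
  "m \<in> carrier M \<Longrightarrow> m' \<in> carrier M \<Longrightarrow> n \<in> carrier N \<Longrightarrow>
    frag_of (m \<oplus>\<^bsub>M\<^esub> m', n) \<simeq>[K] frag_of (m, n) + frag_of (m', n)"
  unfolding cong_mod_def tensor_kernel_def
  by (rule generate.incl) (auto simp: tensor_relations_def diff_diff_eq[symmetric] simp del: One_nat_def)

lemma tensor_add_right:
  "m \<in> carrier M \<Longrightarrow> n \<in> carrier N \<Longrightarrow> n' \<in> carrier N \<Longrightarrow>
    frag_of (m, n \<oplus>\<^bsub>N\<^esub> n') \<simeq>[K] frag_of (m, n) + frag_of (m, n')"
  unfolding cong_mod_def tensor_kernel_def diff_diff_eq[symmetric]
  by (rule generate.incl) (unfold tensor_relations_def, blast)

lemma tensor_balanced: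
  "m \<in> carrier M \<Longrightarrow> n \<in> carrier N \<Longrightarrow> s \<in> S \<Longrightarrow> frag_of (r m s, n) \<simeq>[K] frag_of (m, l s n)"
  unfolding cong_mod_def tensor_kernel_def
  by (rule generate.incl) (unfold tensor_relations_def, blast)

lemma mem_tclass: "s \<in> tclass t \<longleftrightarrow> s \<simeq>[K] t"
  by (force simp: tensor_class_def r_coset_def cong_mod_def)

lemma tclass_self: "t \<in> tclass t"
  by (simp add: mem_tclass)

lemma tclass_eq_iff: "tclass s = tclass t \<longleftrightarrow> s \<simeq>[K] t"
proof
  assume "tclass s = tclass t"
  then show "s \<simeq>[K] t" using tclass_self[of s] by (simp add: mem_tclass)
next
  assume "s \<simeq>[K] t"
  then show "tclass s = tclass t"
    unfolding set_eq_iff mem_tclass by (blast intro: K.cong_trans K.cong_sym)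
qed

lemma carrier_T: "carrier T = tclass ` formal"
proof -
  have "carrier F = formal" by (simp add: free_Abelian_group_def)
  then show ?thesis
    unfolding tensor_group_def FactGroup_def RCOSETS_def tensor_class_def by auto
qed

lemma mem_tclass_formal: "s \<in> tclass t \<Longrightarrow> t \<in> formal \<Longrightarrow> s \<in> formal"
  using kernel_formal formal_add[of "s - t" t] by (auto simp: mem_tclass cong_mod_def)

lemma tclass_add: "tclass s \<otimes>\<^bsub>T\<^esub> tclass t = tclass (s + t)"
proof -
  have "tclass s \<otimes>\<^bsub>T\<^esub> tclass t = {u + v | u v. u \<in> tclass s \<and> v \<in> tclass t}"
    by (auto simp: tensor_group_def FactGroup_def set_mult_def)
  also have "\<dots> = tclass (s + t)"
  proof (intro equalityI subsetI)
    fix w assume "w \<in> tclass (s + t)"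
    then have "w - t \<in> tclass s"
      by (simp add: mem_tclass cong_mod_def algebra_simps)
    then show "w \<in> {u + v | u v. u \<in> tclass s \<and> v \<in> tclass t}"
      using tclass_self[of t] by (intro CollectI exI[of _ "w - t"] exI[of _ t]) simp
  qed (auto simp: mem_tclass intro: K.cong_add)
  finally show ?thesis .
qed

lemma one_T: "\<one>\<^bsub>T\<^esub> = tclass 0"
  by (auto simp: tensor_group_def FactGroup_def set_eq_iff mem_tclass K.cong_0)

lemma comm_group_T: "comm_group T"
proof (rule comm_groupI)
  fix X assume "X \<in> carrier T"
  then obtain t where t: "t \<in> formal" "X = tclass t" by (auto simp: carrier_T)
  then show "\<exists>Y\<in>carrier T. Y \<otimes>\<^bsub>T\<^esub> X = \<one>\<^bsub>T\<^esub>"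
    using formal_diff[of 0 t] by (intro bexI[of _ "tclass (- t)"]) (auto simp: carrier_T tclass_add one_T)
next
  fix X Y assume "X \<in> carrier T" "Y \<in> carrier T"
  then obtain s t where "s \<in> formal" "t \<in> formal" "X = tclass s" "Y = tclass t"
    by (auto simp: carrier_T)
  then show "X \<otimes>\<^bsub>T\<^esub> Y \<in> carrier T"
    using formal_add[of s t] unfolding carrier_T by (simp only: tclass_add) blast
qed (auto simp: carrier_T tclass_add one_T add_ac)

lemma tensor_zero_left:
  assumes "abelian_group M" "n \<in> carrier N"
  shows "frag_of (\<zero>\<^bsub>M\<^esub>, n) \<in> K"
proof -
  interpret abelian_group M by fact
  show ?thesis
    using K.uminus_mem[of "- frag_of (\<zero>\<^bsub>M\<^esub>, n)"] tensor_add_left[of "\<zero>\<^bsub>M\<^esub>" "\<zero>\<^bsub>M\<^esub>" n] assms(2)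
    by (simp add: cong_mod_def)
qed

lemma tensor_minus_left:
  assumes "abelian_group M" "m \<in> carrier M" "n \<in> carrier N"
  shows "frag_of (\<ominus>\<^bsub>M\<^esub> m, n) \<simeq>[K] - frag_of (m, n)"
proof -
  interpret abelian_group M by fact
  have "0 \<simeq>[K] frag_of (\<zero>\<^bsub>M\<^esub>, n)"
    using tensor_zero_left[OF assms(1,3)] by (simp add: K.cong_sym K.cong_0)
  also have "\<dots> \<simeq>[K] frag_of (\<ominus>\<^bsub>M\<^esub> m, n) + frag_of (m, n)"
    using tensor_add_left[of "\<ominus>\<^bsub>M\<^esub> m" m n] assms by (simp add: l_neg)
  finally have "0 \<simeq>[K] frag_of (\<ominus>\<^bsub>M\<^esub> m, n) + frag_of (m, n)" .
  from K.cong_sym[OF this] show ?thesis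
    by (simp add: cong_mod_def)
qed

lemma formal_cong_sum_list:
  assumes "abelian_group M" "t \<in> formal"
  shows "\<exists>ps. set ps \<subseteq> carrier M \<times> carrier N \<and> t \<simeq>[K] (\<Sum>p\<leftarrow>ps. frag_of p)"
  using assms(2)
proof (induction rule: formal_induct)
  case zero
  show ?case by (intro exI[of _ "[]"]) simp
next
  case (of m n)
  then show ?case by (intro exI[of _ "[(m, n)]"]) simp
next
  case (diff s t)
  then obtain ps qs where ps: "set ps \<subseteq> carrier M \<times> carrier N" "s \<simeq>[K] (\<Sum>p\<leftarrow>ps. frag_of p)"
    and qs: "set qs \<subseteq> carrier M \<times> carrier N" "t \<simeq>[K] (\<Sum>p\<leftarrow>qs. frag_of p)" by blast
  let ?neg = "\<lambda>(m, n). (\<ominus>\<^bsub>M\<^esub> m, n)"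
  interpret abelian_group M by fact
  have neg: "(\<Sum>p\<leftarrow>map ?neg qs. frag_of p) \<simeq>[K] - (\<Sum>p\<leftarrow>qs. frag_of p)"
    using qs(1)
  proof (induction qs)
    case (Cons q qs)
    then show ?case
      using K.cong_add[OF tensor_minus_left[OF assms(1), of "fst q" "snd q"] Cons.IH]
      by (auto simp: case_prod_unfold add.commute)
  qed simp
  have "s - t \<simeq>[K] (\<Sum>p\<leftarrow>ps. frag_of p) + (\<Sum>p\<leftarrow>map ?neg qs. frag_of p)"
    using K.cong_add[OF ps(2) K.cong_trans[OF K.cong_uminus[OF qs(2)] K.cong_sym[OF neg]]] by simp
  then show ?case
    using ps(1) qs(1) by (intro exI[of _ "ps @ map ?neg qs"]) auto
qed

end

section \<open>Tensor products of a presented algebra with an algebra of functions\<close>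

locale presented_star_algebra = star_algebra A for A :: "'a star_alg" (structure) +
  fixes cls :: "free \<Rightarrow> 'a"
  assumes cls_hom: "cls \<in> star_hom free_alg A" and carrier_eq: "carrier A = range cls"
begin

lemma cls_closed [simp, intro]: "cls f \<in> carrier A"
  by (simp add: carrier_eq)

lemma cls_add: "cls (f + g) = cls f \<oplus> cls g"
  and cls_mult: "cls (f * g) = cls f \<otimes> cls g"
  and cls_1: "cls 1 = \<one>"
  and cls_scalar_mult: "cls (scalar c * f) = c \<odot> cls f"
  and cls_star: "cls (free_star f) = star A (cls f)"
  using cls_hom unfolding star_hom_def ring_hom_def mem_Collect_eq free_alg_simps by blast+

lemma cls_0: "cls 0 = \<zero>"
  using cls_add[of 0 0] by (simp add: add.l_cancel_one')

lemma cls_uminus: "cls (- f) = \<ominus> cls f"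
  using cls_add[of "- f" f] by (simp add: cls_0 minus_equality)

lemma cls_diff: "cls (f - g) = cls f \<ominus> cls g"
  using cls_add[of f "- g"] by (simp add: cls_uminus a_minus_def)

lemma cls_scalar: "cls (scalar c) = c \<odot> \<one>"
  using cls_scalar_mult[of c 1] by (simp add: cls_1)

lemma cls_sum: "finite I \<Longrightarrow> cls (sum f I) = (\<Oplus>i\<in>I. cls (f i))"
  by (induction I rule: finite_induct) (simp_all add: cls_0 cls_add)

definition rep :: "'a \<Rightarrow> free" where "rep a = (SOME f. cls f = a)"

lemma cls_rep [simp]: "a \<in> carrier A \<Longrightarrow> cls (rep a) = a"
  unfolding rep_def carrier_eq by (metis (mono_tags) imageE someI)

definition J :: "free set" where "J = {f. cls f = \<zero>}"

sublocale free_ideal J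
  by unfold_locales (auto simp: J_def cls_0 cls_diff cls_mult a_minus_def)

lemma cls_eq_iff: "cls f = cls g \<longleftrightarrow> f \<simeq>[J] g"
proof -
  have "f \<simeq>[J] g \<longleftrightarrow> cls f \<ominus> cls g = \<zero>"
    by (simp add: cong_mod_def J_def cls_diff)
  also have "\<dots> \<longleftrightarrow> cls f = cls g"
    by (metis cls_closed r_right_minus_eq)
  finally show ?thesis ..
qed

end

lemma function_alg_simps [simp]:
  "carrier (function_alg U) = extensional U" "f \<otimes>\<^bsub>function_alg U\<^esub> g = (\<lambda>w\<in>U. f w * g w)"
  "\<one>\<^bsub>function_alg U\<^esub> = (\<lambda>w\<in>U. 1)" "\<zero>\<^bsub>function_alg U\<^esub> = (\<lambda>w\<in>U. 0)"
  "f \<oplus>\<^bsub>function_alg U\<^esub> g = (\<lambda>w\<in>U. f w + g w)" "c \<odot>\<^bsub>function_alg U\<^esub> f = (\<lambda>w\<in>U. c * f w)"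
  "star (function_alg U) f = (\<lambda>w\<in>U. cnj (f w))"
  by (simp_all add: function_alg_def)

text \<open>
  The second factor is an algebra \<open>C\<close> of complex functions on a set \<open>U\<close>, here the polynomial functions on the
  unit quaternions.
\<close>

locale function_tensor = presented_star_algebra A cls for A :: "'a star_alg" (structure) and cls +
  fixes U :: "'x set" and C :: "('x \<Rightarrow> complex) set"
  assumes C_subalgebra: "star_subalgebra C (function_alg U)"
begin

abbreviation "H \<equiv> function_alg U\<lparr>carrier := C\<rparr>"

lemma C_closed:
  "(\<lambda>w\<in>U. 0) \<in> C" "(\<lambda>w\<in>U. 1) \<in> C" "f \<in> C \<Longrightarrow> g \<in> C \<Longrightarrow> (\<lambda>w\<in>U. f w + g w) \<in> C"
  "f \<in> C \<Longrightarrow> g \<in> C \<Longrightarrow> (\<lambda>w\<in>U. f w * g w) \<in> C" "f \<in> C \<Longrightarrow> (\<lambda>w\<in>U. c * f w) \<in> C"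
  "f \<in> C \<Longrightarrow> (\<lambda>w\<in>U. cnj (f w)) \<in> C" "C \<subseteq> extensional U"
  using C_subalgebra subringE[of C "function_alg U"]
  by (auto simp: star_subalgebra_def)

sublocale tens: balanced_tensor A H UNIV "\<lambda>a c. c \<odot> a" "\<lambda>c b. c \<odot>\<^bsub>H\<^esub> b"
  by unfold_locales (simp_all add: C_closed)


definition KC :: "('a \<times> ('x \<Rightarrow> complex) \<Rightarrow>\<^sub>0 int) set" where "KC = tens.K"

sublocale KC: ab_subgroup KC
  unfolding KC_def by (rule tens.K.ab_subgroup_axioms)

lemmas tensor_add_left = tens.tensor_add_left[folded KC_def]
  and tensor_add_right = tens.tensor_add_right[folded KC_def]
  and tensor_balanced = tens.tensor_balanced[folded KC_def]
  and tensor_zero_left = tens.tensor_zero_left[folded KC_def, OF abelian_group_axioms]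
  and formal_cong_sum_list = tens.formal_cong_sum_list[folded KC_def, OF abelian_group_axioms]

abbreviation "TA \<equiv> tensor_alg A H"

definition ev :: "'x \<Rightarrow> ('a \<times> ('x \<Rightarrow> complex) \<Rightarrow>\<^sub>0 int) \<Rightarrow> free" where
  "ev v = frag_ext (\<lambda>(a, h). scalar (h v) * rep a)"

lemma cls_ev_of: "a \<in> carrier A \<Longrightarrow> cls (ev v (frag_of (a, h))) = h v \<odot> a"
  by (simp add: ev_def cls_scalar_mult)

lemma ev_diff: "ev v (s - t) = ev v s - ev v t"
  by (simp add: ev_def frag_ext_diff)

lemma ev_add: "ev v (s + t) = ev v s + ev v t"
  by (simp add: ev_def frag_ext_add)

lemma ev_0: "ev v 0 = 0"
  by (simp add: ev_def)

lemma ev_kernel: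
  assumes "t \<in> KC" "v \<in> U"
  shows "ev v t \<in> J"
proof -
  have cancel: "a \<oplus> (b \<oplus> (\<ominus> a \<oplus> \<ominus> b)) = \<zero>" if "a \<in> carrier A" "b \<in> carrier A" for a b
  proof -
    have "a \<oplus> (b \<oplus> (\<ominus> a \<oplus> \<ominus> b)) = (a \<oplus> b) \<oplus> \<ominus> (a \<oplus> b)"
      using that by (simp add: minus_add a_assoc)
    also have "\<dots> = \<zero>" using that by (simp add: r_neg)
    finally show ?thesis .
  qed
  have "KC \<subseteq> {t. ev v t \<in> J}"
    unfolding KC_def
  proof (rule tens.kernel_minimal)
    show "ab_subgroup {t. ev v t \<in> J}"
      by unfold_locales (auto simp: ev_0 ev_diff zero_mem intro: diff_mem)
    show "tensor_relations A H UNIV (\<lambda>a c. c \<odot> a) (\<lambda>c b. c \<odot>\<^bsub>H\<^esub> b) \<subseteq> {t. ev v t \<in> J}"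
      unfolding tensor_relations_def
      using assms(2)
      by (auto simp: J_def ev_diff cls_diff cls_ev_of smult_add smult_add_scalar smult_smult
          a_minus_def minus_add a_ac r_neg r_neg1 r_neg2 mult.commute cancel)
  qed
  then show ?thesis using assms(1) by blast
qed

lemma ev_cong: "s \<simeq>[KC] t \<Longrightarrow> v \<in> U \<Longrightarrow> cls (ev v s) = cls (ev v t)"
  using ev_kernel[of "s - t" v] by (simp add: cls_eq_iff cong_mod_def ev_diff)

lemma tau_sum_list:
  assumes "h \<in> C"
  shows "frag_of (cls (\<Sum>i\<leftarrow>is. f i), h) \<simeq>[KC] (\<Sum>i\<leftarrow>is. frag_of (cls (f i), h))"
  by (rule KC.additive_sum_list[of "\<lambda>f. frag_of (cls f, h)"])
    (simp add: cls_add tensor_add_left assms)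

text \<open>
  Induction on the number of summands. A summand whose function vanishes identically is zero. Otherwise
  \<open>h(u) \<noteq> 0\<close> for some \<open>u\<close>, the relation at \<open>u\<close> expresses \<open>f\<close> by the other summands, and with this the tensor
  becomes a sum with one summand less, in which the function \<open>k\<close> is replaced by \<open>k - (k(u) / h(u)) h\<close>.
\<close>

lemma sum_list_ev_injective:
  assumes "\<And>f h. (f, h) \<in> set ps \<Longrightarrow> h \<in> C"
    and "\<And>v. v \<in> U \<Longrightarrow> (\<Sum>(f, h)\<leftarrow>ps. scalar (h v) * f) \<in> J"
  shows "(\<Sum>(f, h)\<leftarrow>ps. frag_of (cls f, h)) \<in> KC"
  using assms
proof (induction "length ps" arbitrary: ps)
  case 0
  then show ?case by (simp add: KC.zero_mem)
next
  case (Suc n)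
  then obtain f h qs where ps: "ps = (f, h) # qs" and n: "n = length qs"
    by (metis length_Suc_conv surj_pair)
  have h: "h \<in> C" and qs: "\<And>f h. (f, h) \<in> set qs \<Longrightarrow> h \<in> C"
    using Suc.prems(1) ps by auto
  show ?case
  proof (cases "\<forall>v\<in>U. h v = 0")
    case True
    have "(\<lambda>w\<in>U. 0 * h w) = h"
      using True h C_closed(7) by (auto simp: fun_eq_iff extensional_def)
    then have "frag_of (cls f, h) \<simeq>[KC] frag_of (0 \<odot> cls f, h)"
      using KC.cong_sym[OF tensor_balanced[of "cls f" h 0]] h by simp
    moreover have "0 \<odot> cls f = \<zero>"
      using cls_scalar_mult[of 0 f] by (simp add: cls_0)
    ultimately have "frag_of (cls f, h) \<in> KC"
      using tensor_zero_left h by (auto intro: KC.cong_mem)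
    moreover have "(\<Sum>(f, h)\<leftarrow>qs. frag_of (cls f, h)) \<in> KC"
      using Suc.prems(2) True by (intro Suc.hyps(1)[OF n] qs) (auto simp: ps)
    ultimately show ?thesis by (simp add: ps KC.add_mem)
  next
    case False
    then obtain u where u: "u \<in> U" "h u \<noteq> 0" by blast
    define c where "c k = - (k u / h u)" for k :: "'x \<Rightarrow> complex"
    define qs' where "qs' = map (\<lambda>(g, k). (g, \<lambda>w\<in>U. k w + c k * h w)) qs"
    have *: "scalar (inverse (h u)) * (\<Sum>(f, h)\<leftarrow>ps. scalar (h u) * f) = f - (\<Sum>(g, k)\<leftarrow>qs. scalar (c k) * g)"
    proof -
      have "scalar (inverse (h u)) * (scalar (h u) * f) = f"
        using u(2) by (simp add: scalar_1 flip: mult.assoc scalar_mult)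
      moreover have "scalar (inverse (h u)) * (\<Sum>(g, k)\<leftarrow>qs. scalar (k u) * g) = - (\<Sum>(g, k)\<leftarrow>qs. scalar (c k) * g)"
        by (induction qs)
          (auto simp: c_def scalar_uminus distrib_left divide_inverse mult.commute
            simp flip: mult.assoc scalar_mult)
      ultimately show ?thesis by (simp add: ps distrib_left)
    qed
    have "f \<simeq>[J] (\<Sum>(g, k)\<leftarrow>qs. scalar (c k) * g)"
      unfolding cong_mod_def *[symmetric] by (rule left_mem) (rule Suc.prems(2)[OF u(1)])
    then have "cls f = cls (\<Sum>(g, k)\<leftarrow>qs. scalar (c k) * g)"
      by (simp add: cls_eq_iff)
    then have "frag_of (cls f, h) \<simeq>[KC] (\<Sum>(g, k)\<leftarrow>qs. frag_of (cls (scalar (c k) * g), h))"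
      using tau_sum_list[OF h, of "\<lambda>(g, k). scalar (c k) * g" qs] by (simp add: case_prod_unfold)
    then have "(\<Sum>(f, h)\<leftarrow>ps. frag_of (cls f, h))
      \<simeq>[KC] (\<Sum>(g, k)\<leftarrow>qs. frag_of (cls (scalar (c k) * g), h)) + (\<Sum>(f, h)\<leftarrow>qs. frag_of (cls f, h))"
      by (auto simp: ps intro: KC.cong_add)
    also have "\<dots> \<simeq>[KC] (\<Sum>(f, h)\<leftarrow>qs'. frag_of (cls f, h))"
      using qs unfolding qs'_def
    proof (induction qs)
      case (Cons q qs)
      obtain g k where q: "q = (g, k)" by force
      have k: "k \<in> C" using Cons.prems q by auto
      have "frag_of (cls (scalar (c k) * g), h) + frag_of (cls g, k)
        \<simeq>[KC] frag_of (cls g, \<lambda>w\<in>U. c k * h w) + frag_of (cls g, k)"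
        using tensor_balanced[of "cls g" h "c k"] h
        by (intro KC.cong_add KC.cong_refl) (simp add: cls_scalar_mult)
      also have "\<dots> \<simeq>[KC] frag_of (cls g, \<lambda>w\<in>U. k w + c k * h w)"
      proof -
        have "(\<lambda>w\<in>U. (\<lambda>w\<in>U. c k * h w) w + k w) = (\<lambda>w\<in>U. k w + c k * h w)"
          by (auto simp: fun_eq_iff)
        then show ?thesis
          using KC.cong_sym[OF tensor_add_right[of "cls g" "\<lambda>w\<in>U. c k * h w" k]] k C_closed(5)[OF h]
          by simp
      qed
      finally have "frag_of (cls (scalar (c k) * g), h) + frag_of (cls g, k)
        \<simeq>[KC] frag_of (cls g, \<lambda>w\<in>U. k w + c k * h w)" .
      from KC.cong_add[OF this Cons.IH] Cons.prems(1)[OF list.set_intros(2)] show ?case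
        by (simp add: q add_ac del: restrict_apply)
    qed simp
    also have "(\<Sum>(f, h)\<leftarrow>qs'. frag_of (cls f, h)) \<in> KC"
    proof (rule Suc.hyps(1))
      show "n = length qs'" by (simp add: qs'_def n)
      fix g k assume "(g, k) \<in> set qs'"
      then show "k \<in> C"
        using qs C_closed(3)[OF _ C_closed(5)[OF h]] by (auto simp: qs'_def cong: restrict_cong)
    next
      fix v assume v: "v \<in> U"
      have "(\<Sum>(g, k)\<leftarrow>qs'. scalar (k v) * g)
        = (\<Sum>(g, k)\<leftarrow>qs. scalar (k v) * g) + scalar (h v) * (\<Sum>(g, k)\<leftarrow>qs. scalar (c k) * g)"
      proof -
        have summand: "scalar ((\<lambda>w\<in>U. k w + c k * h w) v) * g = scalar (k v) * g + scalar (h v) * (scalar (c k) * g)" for g k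
          using v by (simp add: scalar_add distrib_right scalar_mult[symmetric] mult.commute flip: mult.assoc)
        show ?thesis
          unfolding qs'_def
          by (induction qs) (simp_all add: case_prod_unfold summand distrib_left add_ac del: restrict_apply)
      qed
      also have "\<dots> = (\<Sum>(f, h)\<leftarrow>ps. scalar (h v) * f) - scalar (h v) * (f - (\<Sum>(g, k)\<leftarrow>qs. scalar (c k) * g))"
        by (simp add: ps algebra_simps)
      also have "\<dots> \<in> J"
        unfolding *[symmetric] by (intro diff_mem left_mem Suc.prems(2) v u)
      finally show "(\<Sum>(g, k)\<leftarrow>qs'. scalar (k v) * g) \<in> J" .
    qed
    ultimately show ?thesis using KC.cong_mem by blast
  qed
qed

lemma ev_injective:
  assumes t: "t \<in> tens.formal" and ev: "\<And>v. v \<in> U \<Longrightarrow> ev v t \<in> J"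
  shows "t \<in> KC"
proof -
  obtain ps where ps: "set ps \<subseteq> carrier A \<times> C" and t_ps: "t \<simeq>[KC] (\<Sum>p\<leftarrow>ps. frag_of p)"
    using formal_cong_sum_list[OF t] by auto
  let ?qs = "map (\<lambda>(a, h). (rep a, h)) ps"
  have eq: "(\<Sum>(f, h)\<leftarrow>?qs. frag_of (cls f, h)) = (\<Sum>p\<leftarrow>ps. frag_of p)"
    using ps by (induction ps) auto
  have "(\<Sum>(f, h)\<leftarrow>?qs. frag_of (cls f, h)) \<in> KC"
  proof (rule sum_list_ev_injective)
    fix v assume v: "v \<in> U"
    have "ev v (\<Sum>p\<leftarrow>ps. frag_of p) = (\<Sum>(f, h)\<leftarrow>?qs. scalar (h v) * f)"
      by (induction ps) (auto simp: ev_0 ev_add, simp add: ev_def)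
    moreover have "cls (ev v (\<Sum>p\<leftarrow>ps. frag_of p)) = cls (ev v t)"
      using ev_cong[OF t_ps v] by simp
    ultimately show "(\<Sum>(f, h)\<leftarrow>?qs. scalar (h v) * f) \<in> J"
      using ev[OF v] by (simp add: J_def)
  qed (use ps in auto)
  then show ?thesis
    unfolding eq using t_ps KC.cong_mem by blast
qed

abbreviation "tcl \<equiv> complex_tensor_class A H"

lemma tcl_eq: "tcl t = tens.tclass t"
  by (simp only: complex_tensor_class_def)

lemma TA_simps:
  "carrier TA = carrier tens.T" "X \<oplus>\<^bsub>TA\<^esub> Y = X \<otimes>\<^bsub>tens.T\<^esub> Y" "\<zero>\<^bsub>TA\<^esub> = \<one>\<^bsub>tens.T\<^esub>"
  by (simp_all only: tensor_alg_def Let_def partial_object.simps monoid.simps ring.simps)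

lemma mem_tcl: "s \<in> tcl t \<longleftrightarrow> s \<simeq>[KC] t"
  by (simp only: tcl_eq tens.mem_tclass KC_def)

lemma tcl_self: "t \<in> tcl t"
  by (simp add: mem_tcl)

lemma mem_tcl_formal: "s \<in> tcl t \<Longrightarrow> t \<in> tens.formal \<Longrightarrow> s \<in> tens.formal"
  unfolding tcl_eq by (rule tens.mem_tclass_formal)

lemma mem_tcl_ev: "s \<in> tcl t \<Longrightarrow> v \<in> U \<Longrightarrow> cls (ev v s) = cls (ev v t)"
  by (simp add: mem_tcl ev_cong)

lemma tcl_eqI:
  assumes "s \<in> tens.formal" "t \<in> tens.formal" "\<And>v. v \<in> U \<Longrightarrow> cls (ev v s) = cls (ev v t)"
  shows "tcl s = tcl t"
proof -
  have "s - t \<in> KC"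
  proof (rule ev_injective)
    show "s - t \<in> tens.formal" using assms(1,2) by (rule tens.formal_diff)
    show "ev v (s - t) \<in> J" if "v \<in> U" for v
      using assms(3)[OF that] by (simp add: cls_eq_iff cong_mod_def ev_diff)
  qed
  then show ?thesis by (simp only: tcl_eq tens.tclass_eq_iff cong_mod_def KC_def)
qed

lemma carrier_TA: "carrier TA = tcl ` tens.formal"
  unfolding TA_simps tens.carrier_T by (simp only: complex_tensor_class_def)

lemma TA_cases:
  assumes "X \<in> carrier TA"
  obtains t where "t \<in> tens.formal" "X = tcl t"
  using assms unfolding carrier_TA by blast

text \<open>
  Evaluation of a class, through an arbitrary representative.
\<close>

definition evc :: "('a \<times> ('x \<Rightarrow> complex) \<Rightarrow>\<^sub>0 int) set \<Rightarrow> 'x \<Rightarrow> 'a" where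
  "evc X v = cls (ev v (SOME t. t \<in> X))"

lemma evc_tcl: "v \<in> U \<Longrightarrow> evc (tcl t) v = cls (ev v t)"
  unfolding evc_def by (rule mem_tcl_ev) (rule someI[of _ t], rule tcl_self)

lemma evc_closed: "evc X v \<in> carrier A"
  by (simp add: evc_def)

text \<open>
  The principle by which all identities in the tensor algebra are proved below.
\<close>

lemma TA_eqI:
  assumes "X \<in> carrier TA" "Y \<in> carrier TA" "\<And>v. v \<in> U \<Longrightarrow> evc X v = evc Y v"
  shows "X = Y"
proof -
  obtain s where s: "s \<in> tens.formal" "X = tcl s" using assms(1) by (rule TA_cases)
  obtain t where t: "t \<in> tens.formal" "Y = tcl t" using assms(2) by (rule TA_cases)
  show ?thesis
    unfolding s(2) t(2) by (rule tcl_eqI[OF s(1) t(1)]) (use assms(3) in \<open>simp add: s(2) t(2) evc_tcl\<close>)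
qed

lemma TA_abelian_group: "abelian_group TA"
proof -
  interpret T: comm_group tens.T by (rule tens.comm_group_T)
  show ?thesis
  proof (rule abelian_groupI)
    show "\<exists>Y\<in>carrier TA. Y \<oplus>\<^bsub>TA\<^esub> X = \<zero>\<^bsub>TA\<^esub>" if "X \<in> carrier TA" for X
      using that unfolding TA_simps by (metis T.inv_closed T.l_inv)
  qed (unfold TA_simps, (rule T.m_closed T.one_closed T.m_assoc T.m_comm T.l_one; assumption)+)
qed

sublocale TA: abelian_group TA by (rule TA_abelian_group)

lemma tcl_add: "tcl s \<oplus>\<^bsub>TA\<^esub> tcl t = tcl (s + t)"
  by (simp only: TA_simps tcl_eq tens.tclass_add)

lemma TA_zero: "\<zero>\<^bsub>TA\<^esub> = tcl 0"
  by (simp only: TA_simps tcl_eq tens.one_T)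

lemma evc_add:
  assumes "X \<in> carrier TA" "Y \<in> carrier TA" "v \<in> U"
  shows "evc (X \<oplus>\<^bsub>TA\<^esub> Y) v = evc X v \<oplus> evc Y v"
proof -
  obtain s t where "X = tcl s" "Y = tcl t" using assms by (metis TA_cases)
  then show ?thesis using assms(3) by (simp only: tcl_add evc_tcl ev_add cls_add)
qed

lemma evc_zero: "v \<in> U \<Longrightarrow> evc \<zero>\<^bsub>TA\<^esub> v = \<zero>"
  by (simp only: TA_zero evc_tcl ev_0 cls_0)

lemma evc_finsum:
  assumes "finite I" "\<And>i. i \<in> I \<Longrightarrow> X i \<in> carrier TA" "v \<in> U"
  shows "evc (\<Oplus>\<^bsub>TA\<^esub>i\<in>I. X i) v = (\<Oplus>i\<in>I. evc (X i) v)"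
  using assms(1,2)
proof (induction I rule: finite_induct)
  case (insert i I)
  have X: "X \<in> I \<rightarrow> carrier TA" "X i \<in> carrier TA" using insert.prems by auto
  then have "evc (\<Oplus>\<^bsub>TA\<^esub>i\<in>insert i I. X i) v = evc (X i) v \<oplus> evc (\<Oplus>\<^bsub>TA\<^esub>i\<in>I. X i) v"
    using insert.hyps TA.finsum_insert[OF insert.hyps X] evc_add[OF X(2) TA.finsum_closed[OF X(1)] assms(3)] by simp
  then show ?case using insert by (simp add: evc_closed)
qed (simp add: evc_zero assms(3))

lemma frag_extend_formal:
  assumes "t \<in> tens.formal" "\<And>a h. a \<in> carrier A \<Longrightarrow> h \<in> C \<Longrightarrow> g (a, h) \<in> tens.formal"
  shows "frag_extend g t \<in> tens.formal"
proof -
  have "Poly_Mapping.keys (frag_extend g t) \<subseteq> (\<Union>k\<in>Poly_Mapping.keys t. Poly_Mapping.keys (g k))"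
    by (rule keys_frag_extend)
  moreover have "Poly_Mapping.keys (g k) \<subseteq> carrier A \<times> C" if k: "k \<in> Poly_Mapping.keys t" for k
  proof -
    obtain a h where "k = (a, h)" "a \<in> carrier A" "h \<in> C"
      using k assms(1) by (cases k) auto
    then show ?thesis using assms(2)[of a h] by simp
  qed
  ultimately show ?thesis by (simp add: UN_subset_iff) blast
qed

lemma frag_of_formal: "a \<in> carrier A \<Longrightarrow> h \<in> C \<Longrightarrow> frag_of (a, h) \<in> tens.formal"
  by (simp add: keys_frag_of)

text \<open>
  A map given on pairs that evaluates to an additive function \<open>\<phi>\<close> of the value of the pair; it is applied to
  the product, the scalar action and the involution.
\<close>

lemma ev_frag_extend:
  assumes "t \<in> tens.formal" "v \<in> U"
    and g: "\<And>a h. a \<in> carrier A \<Longrightarrow> h \<in> C \<Longrightarrow> cls (ev v (g (a, h))) = \<phi> (h v \<odot> a)"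
    and \<phi>0: "\<phi> \<zero> = \<zero>" and \<phi>_diff: "\<And>a b. a \<in> carrier A \<Longrightarrow> b \<in> carrier A \<Longrightarrow> \<phi> (a \<ominus> b) = \<phi> a \<ominus> \<phi> b"
  shows "cls (ev v (frag_extend g t)) = \<phi> (cls (ev v t))"
  using assms(1)
proof (induction rule: tens.formal_induct)
  case (of a h)
  then show ?case using g by (simp add: cls_ev_of)
qed (simp_all add: ev_0 cls_0 \<phi>0 frag_extend_diff ev_diff cls_diff \<phi>_diff)

lemma formal_mult_formal:
  assumes "s \<in> tens.formal" "t \<in> tens.formal"
  shows "formal_mult A H s t \<in> tens.formal"
  unfolding formal_mult_def
  by (intro frag_extend_formal assms) (auto simp: keys_frag_of C_closed intro!: frag_extend_formal[OF assms(2), simplified])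

lemma ev_formal_mult:
  assumes s: "s \<in> tens.formal" and t: "t \<in> tens.formal" and v: "v \<in> U"
  shows "cls (ev v (formal_mult A H s t)) = cls (ev v s) \<otimes> cls (ev v t)"
  unfolding formal_mult_def
proof (rule ev_frag_extend[OF s v, where \<phi> = "\<lambda>a. a \<otimes> cls (ev v t)"])
  fix a h assume a: "a \<in> carrier A" "h \<in> C"
  have "cls (ev v (frag_extend (\<lambda>(a', b'). frag_of (a \<otimes> a', h \<otimes>\<^bsub>H\<^esub> b')) t)) = (h v \<odot> a) \<otimes> cls (ev v t)"
    by (rule ev_frag_extend[OF t v])
      (use a v in \<open>simp_all add: cls_ev_of smult_smult a_minus_def r_distr r_minus mult.commute flip: smult_mult mult_smult\<close>)
  then show "cls (ev v (case (a, h) of (a, b) \<Rightarrow> frag_extend (\<lambda>(a', b'). frag_of (a \<otimes> a', b \<otimes>\<^bsub>H\<^esub> b')) t))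
    = (h v \<odot> a) \<otimes> cls (ev v t)" by simp
qed (simp_all add: a_minus_def l_distr l_minus)

lemma tcl_mult:
  assumes s: "s \<in> tens.formal" and t: "t \<in> tens.formal"
  shows "tcl s \<otimes>\<^bsub>TA\<^esub> tcl t = tcl (formal_mult A H s t)"
proof -
  have eq: "tcl (formal_mult A H s' t') = tcl (formal_mult A H s t)" if "s' \<in> tcl s" "t' \<in> tcl t" for s' t'
  proof (rule tcl_eqI)
    have s't': "s' \<in> tens.formal" "t' \<in> tens.formal" using that s t mem_tcl_formal by blast+
    show "formal_mult A H s' t' \<in> tens.formal" "formal_mult A H s t \<in> tens.formal"
      by (intro formal_mult_formal s't' s t)+
    show "cls (ev v (formal_mult A H s' t')) = cls (ev v (formal_mult A H s t))" if "v \<in> U" for v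
      unfolding ev_formal_mult[OF s't' that] ev_formal_mult[OF s t that]
      using mem_tcl_ev[OF \<open>s' \<in> tcl s\<close> that] mem_tcl_ev[OF \<open>t' \<in> tcl t\<close> that] by simp
  qed
  have "(\<Union>s'\<in>tcl s. \<Union>t'\<in>tcl t. tcl (formal_mult A H s' t')) = (\<Union>t'\<in>tcl t. tcl (formal_mult A H s t'))"
    by (rule UN_const_on[OF tcl_self]) (rule SUP_cong[OF refl], metis eq tcl_self)
  also have "\<dots> = tcl (formal_mult A H s t)"
    by (rule UN_const_on[OF tcl_self]) (rule eq[OF tcl_self])
  finally show ?thesis
    by (simp only: tensor_alg_def Let_def monoid.simps)
qed

lemma TA_mult_closed: "X \<in> carrier TA \<Longrightarrow> Y \<in> carrier TA \<Longrightarrow> X \<otimes>\<^bsub>TA\<^esub> Y \<in> carrier TA"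
  by (elim TA_cases) (simp only: tcl_mult, unfold carrier_TA, intro imageI formal_mult_formal)

lemma evc_mult:
  assumes "X \<in> carrier TA" "Y \<in> carrier TA" "v \<in> U"
  shows "evc (X \<otimes>\<^bsub>TA\<^esub> Y) v = evc X v \<otimes> evc Y v"
  using assms by (elim TA_cases) (simp only: tcl_mult evc_tcl ev_formal_mult)

text \<open>
  The operations are well defined, since evaluation separates classes.
\<close>

lemma UN_frag_extend:
  assumes t: "t \<in> tens.formal"
    and g: "\<And>a h. a \<in> carrier A \<Longrightarrow> h \<in> C \<Longrightarrow> g (a, h) \<in> tens.formal"
      "\<And>a h v. a \<in> carrier A \<Longrightarrow> h \<in> C \<Longrightarrow> v \<in> U \<Longrightarrow> cls (ev v (g (a, h))) = \<phi> (h v \<odot> a)"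
    and \<phi>: "\<phi> \<zero> = \<zero>" "\<And>a b. a \<in> carrier A \<Longrightarrow> b \<in> carrier A \<Longrightarrow> \<phi> (a \<ominus> b) = \<phi> a \<ominus> \<phi> b"
  shows "(\<Union>t'\<in>tcl t. tcl (frag_extend g t')) \<in> carrier TA"
    and "v \<in> U \<Longrightarrow> evc (\<Union>t'\<in>tcl t. tcl (frag_extend g t')) v = \<phi> (evc (tcl t) v)"
proof -
  have "tcl (frag_extend g t') = tcl (frag_extend g t)" if "t' \<in> tcl t" for t'
  proof (rule tcl_eqI)
    have t': "t' \<in> tens.formal" using that t by (rule mem_tcl_formal)
    show "frag_extend g t' \<in> tens.formal" "frag_extend g t \<in> tens.formal"
      using t' t g(1) by (simp_all only: frag_extend_formal)
    show "cls (ev v (frag_extend g t')) = cls (ev v (frag_extend g t))" if v: "v \<in> U" for v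
      using ev_frag_extend[OF t' v g(2)[OF _ _ v] \<phi>] ev_frag_extend[OF t v g(2)[OF _ _ v] \<phi>]
        mem_tcl_ev[OF \<open>t' \<in> tcl t\<close> v] by simp
  qed
  then have *: "(\<Union>t'\<in>tcl t. tcl (frag_extend g t')) = tcl (frag_extend g t)"
    by (rule UN_const_on[OF tcl_self])
  show "(\<Union>t'\<in>tcl t. tcl (frag_extend g t')) \<in> carrier TA"
    unfolding * carrier_TA by (intro imageI frag_extend_formal t g(1))
  show "evc (\<Union>t'\<in>tcl t. tcl (frag_extend g t')) v = \<phi> (evc (tcl t) v)" if v: "v \<in> U"
    unfolding * evc_tcl[OF v] by (rule ev_frag_extend[OF t v g(2)[OF _ _ v] \<phi>])
qed

lemma TA_smult:
  assumes "X \<in> carrier TA"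
  shows "c \<odot>\<^bsub>TA\<^esub> X \<in> carrier TA" and "v \<in> U \<Longrightarrow> evc (c \<odot>\<^bsub>TA\<^esub> X) v = c \<odot> evc X v"
proof -
  obtain t where t: "t \<in> tens.formal" "X = tcl t" using assms by (rule TA_cases)
  let ?g = "\<lambda>(a, b). frag_of (c \<odot> a, b)"
  have g: "?g (a, h) \<in> tens.formal" "cls (ev v (?g (a, h))) = c \<odot> (h v \<odot> a)"
    if "a \<in> carrier A" "h \<in> C" for a h v
    using that by (simp_all add: keys_frag_of cls_ev_of smult_smult mult.commute)
  have \<phi>: "c \<odot> \<zero> = \<zero>" "\<And>a b. a \<in> carrier A \<Longrightarrow> b \<in> carrier A \<Longrightarrow> c \<odot> (a \<ominus> b) = c \<odot> a \<ominus> c \<odot> b"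
    using cls_scalar_mult[of c 0] by (simp_all add: cls_0 a_minus_def smult_add smult_minus)
  have *: "c \<odot>\<^bsub>TA\<^esub> X = (\<Union>t'\<in>tcl t. tcl (frag_extend ?g t'))"
    by (simp only: t(2) tensor_alg_def Let_def module.simps)
  show "c \<odot>\<^bsub>TA\<^esub> X \<in> carrier TA"
    unfolding * by (rule UN_frag_extend(1)[OF t(1) g \<phi>])
  show "v \<in> U \<Longrightarrow> evc (c \<odot>\<^bsub>TA\<^esub> X) v = c \<odot> evc X v"
    unfolding * unfolding t(2) by (rule UN_frag_extend(2)[OF t(1) g \<phi>])
qed

lemma TA_star:
  assumes "X \<in> carrier TA"
  shows "star TA X \<in> carrier TA" and "v \<in> U \<Longrightarrow> evc (star TA X) v = star A (evc X v)"
proof -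
  obtain t where t: "t \<in> tens.formal" "X = tcl t" using assms by (rule TA_cases)
  let ?g = "\<lambda>(a, b). frag_of (star A a, star H b)"
  have g: "?g (a, h) \<in> tens.formal" if "a \<in> carrier A" "h \<in> C" for a h
    using that by (simp add: keys_frag_of C_closed)
  have g': "cls (ev v (?g (a, h))) = star A (h v \<odot> a)" if "a \<in> carrier A" "h \<in> C" "v \<in> U" for a h v
    using that by (simp add: cls_ev_of star_smult)
  have \<phi>: "star A \<zero> = \<zero>" "\<And>a b. a \<in> carrier A \<Longrightarrow> b \<in> carrier A \<Longrightarrow> star A (a \<ominus> b) = star A a \<ominus> star A b"
    by (simp_all add: star_zero a_minus_def star_add star_minus)
  have *: "star TA X = (\<Union>t'\<in>tcl t. tcl (frag_extend ?g t'))"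
    by (simp only: t(2) tensor_alg_def Let_def star_alg.simps)
  show "star TA X \<in> carrier TA"
    unfolding * by (rule UN_frag_extend(1)[OF t(1) g g' \<phi>])
  show "v \<in> U \<Longrightarrow> evc (star TA X) v = star A (evc X v)"
    unfolding * unfolding t(2) by (rule UN_frag_extend(2)[OF t(1) g g' \<phi>])
qed

lemma complex_tensor_TA:
  assumes "a \<in> carrier A" "h \<in> C"
  shows "complex_tensor A H a h \<in> carrier TA"
    and "v \<in> U \<Longrightarrow> evc (complex_tensor A H a h) v = h v \<odot> a"
  using assms
  by (simp_all only: complex_tensor_def evc_tcl cls_ev_of carrier_TA frag_of_formal imageI)

lemma TA_one: "\<one>\<^bsub>TA\<^esub> \<in> carrier TA" and evc_one: "v \<in> U \<Longrightarrow> evc \<one>\<^bsub>TA\<^esub> v = \<one>"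
proof -
  have *: "\<one>\<^bsub>TA\<^esub> = complex_tensor A H \<one> \<one>\<^bsub>H\<^esub>"
    by (simp only: tensor_alg_def Let_def monoid.simps)
  have "\<one>\<^bsub>H\<^esub> \<in> C" by (simp add: C_closed)
  then show "\<one>\<^bsub>TA\<^esub> \<in> carrier TA"
    unfolding * by (rule complex_tensor_TA[OF one_closed])
  show "v \<in> U \<Longrightarrow> evc \<one>\<^bsub>TA\<^esub> v = \<one>"
    unfolding * using complex_tensor_TA(2)[OF one_closed \<open>\<one>\<^bsub>H\<^esub> \<in> C\<close>, of v] by (simp add: smult_one)
qed

end

section \<open>The seven-sphere as a quotient of the free algebra\<close>

context star_algebra
begin

lemma star_subalgebra_carrier: "star_subalgebra (carrier A) A"
  by (simp add: star_subalgebra_def carrier_is_subring)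

lemma star_subalgebra_generated:
  assumes "S \<subseteq> carrier A"
  shows "star_subalgebra (generated_star_subalgebra A S) A"
proof -
  let ?\<T> = "{T. star_subalgebra T A \<and> S \<subseteq> T}"
  have "?\<T> \<noteq> {}" using star_subalgebra_carrier assms by blast
  then have "subring (\<Inter>?\<T>) A"
    by (rule subring_Inter[rotated]) (simp add: star_subalgebra_def)
  then show ?thesis
    by (auto simp: star_subalgebra_def generated_star_subalgebra_def)
qed

end

lemma generated_star_subalgebra_incl: "S \<subseteq> generated_star_subalgebra A S"
  by (auto simp: generated_star_subalgebra_def)

lemma generated_star_subalgebra_minimal:
  "star_subalgebra T A \<Longrightarrow> S \<subseteq> T \<Longrightarrow> generated_star_subalgebra A S \<subseteq> T"
  by (auto simp: generated_star_subalgebra_def)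

lemma star_homD:
  assumes "f \<in> star_hom A B"
  shows "x \<in> carrier A \<Longrightarrow> f x \<in> carrier B"
    and "\<lbrakk>x \<in> carrier A; y \<in> carrier A\<rbrakk> \<Longrightarrow> f (x \<oplus>\<^bsub>A\<^esub> y) = f x \<oplus>\<^bsub>B\<^esub> f y"
    and "\<lbrakk>x \<in> carrier A; y \<in> carrier A\<rbrakk> \<Longrightarrow> f (x \<otimes>\<^bsub>A\<^esub> y) = f x \<otimes>\<^bsub>B\<^esub> f y"
    and "f \<one>\<^bsub>A\<^esub> = \<one>\<^bsub>B\<^esub>"
    and "x \<in> carrier A \<Longrightarrow> f (c \<odot>\<^bsub>A\<^esub> x) = c \<odot>\<^bsub>B\<^esub> f x"
    and "x \<in> carrier A \<Longrightarrow> f (star A x) = star B (f x)"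
  using assms unfolding star_hom_def ring_hom_def by blast+

lemma star_homI:
  assumes "\<And>x. x \<in> carrier A \<Longrightarrow> f x \<in> carrier B"
    and "\<And>x y. \<lbrakk>x \<in> carrier A; y \<in> carrier A\<rbrakk> \<Longrightarrow> f (x \<oplus>\<^bsub>A\<^esub> y) = f x \<oplus>\<^bsub>B\<^esub> f y"
    and "\<And>x y. \<lbrakk>x \<in> carrier A; y \<in> carrier A\<rbrakk> \<Longrightarrow> f (x \<otimes>\<^bsub>A\<^esub> y) = f x \<otimes>\<^bsub>B\<^esub> f y"
    and "f \<one>\<^bsub>A\<^esub> = \<one>\<^bsub>B\<^esub>"
    and "\<And>c x. x \<in> carrier A \<Longrightarrow> f (c \<odot>\<^bsub>A\<^esub> x) = c \<odot>\<^bsub>B\<^esub> f x"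
    and "\<And>x. x \<in> carrier A \<Longrightarrow> f (star A x) = star B (f x)"
  shows "f \<in> star_hom A B"
  using assms unfolding star_hom_def ring_hom_def by blast

lemma star_hom_compose:
  assumes "f \<in> star_hom A B" "g \<in> star_hom B C"
  shows "(\<lambda>x. g (f x)) \<in> star_hom A C"
  by (rule star_homI) (simp_all add: star_homD[OF assms(1)] star_homD[OF assms(2)])

lemma function_alg_star_algebra: "star_algebra (function_alg U)"
proof -
  have "ring (function_alg U)"
  proof (rule ringI)
    show "abelian_group (function_alg U)"
    proof (rule abelian_groupI)
      show "\<exists>g\<in>carrier (function_alg U). g \<oplus>\<^bsub>function_alg U\<^esub> f = \<zero>\<^bsub>function_alg U\<^esub>" for f
        by (rule bexI[of _ "\<lambda>w\<in>U. - f w"]) (simp_all cong: restrict_cong)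
    qed (auto simp: fun_eq_iff extensional_def add_ac)
    show "Group.monoid (function_alg U)"
      by (rule monoidI) (auto simp: fun_eq_iff extensional_def mult.assoc)
  qed (auto simp: fun_eq_iff distrib_left distrib_right)
  then interpret ring "function_alg U" .
  show ?thesis
    by unfold_locales (auto simp: fun_eq_iff extensional_def algebra_simps)
qed

lemma (in presented_star_algebra) sq_norm_cls: "sq_norm A (\<lambda>\<mu>. cls (p \<mu>)) = cls (norm_sq p)"
  by (simp add: sq_norm_def norm_sq_def cls_sum cls_mult)

lemma (in presented_star_algebra) quat_mult_cls:
  "quat_mult A (\<lambda>\<mu>. cls (p \<mu>)) (\<lambda>\<mu>. cls (q \<mu>)) \<mu> = cls ((p \<bullet> q) \<mu>)"
  unfolding quat_mult_def free_quat_mult_def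
  by (simp only: cls_sum finite_class.finite_UNIV cls_scalar_mult) (simp only: cls_mult)

definition deformed_class :: "deformation \<Rightarrow> free \<Rightarrow> free set" where
  "deformed_class R f = deformed_ideal R +>\<^bsub>free_alg\<^esub> f"

definition sphere_class :: "deformation \<Rightarrow> free \<Rightarrow> free set set" where
  "sphere_class R f = sphere_ideal R +>\<^bsub>deformed_alg R\<^esub> deformed_class R f"

text \<open>
  The relations between entries of the same quaternion are anti-hermitian; the two families of exchange
  relations are adjoint to each other.
\<close>

lemma free_star_relations:
  assumes "f \<in> relations R"
  shows "free_star f \<in> relations R"
proof -
  note star = free_star_gen free_star_mult free_star_add free_star_minus free_star_sum
    free_star_scalar
  consider (11) l m where "f = free_gen (X1 l) * free_gen (X1 m) - free_gen (X1 m) * free_gen (X1 l)"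
    | (22) a b where "f = free_gen (X2 a) * free_gen (X2 b) - free_gen (X2 b) * free_gen (X2 a)"
    | (12) l a where "f = free_gen (X1 l) * free_gen (X2 a)
        - (\<Sum>b\<in>UNIV. \<Sum>m\<in>UNIV. scalar (R l a b m) * (free_gen (X2 b) * free_gen (X1 m)))"
    | (21) l a where "f = free_gen (X2 a) * free_gen (X1 l)
        - (\<Sum>b\<in>UNIV. \<Sum>m\<in>UNIV. scalar (cnj (R l a b m)) * (free_gen (X1 m) * free_gen (X2 b)))"
    using assms unfolding relations_def by blast
  then show ?thesis
  proof cases
    case 11
    then have "free_star f = free_gen (X1 m) * free_gen (X1 l) - free_gen (X1 l) * free_gen (X1 m)"
      by (simp only: diff_conv_add_uminus star)
    then show ?thesis unfolding relations_def by blast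
  next
    case 22
    then have "free_star f = free_gen (X2 b) * free_gen (X2 a) - free_gen (X2 a) * free_gen (X2 b)"
      by (simp only: diff_conv_add_uminus star)
    then show ?thesis unfolding relations_def by blast
  next
    case 12
    then have "free_star f = free_gen (X2 a) * free_gen (X1 l)
        - (\<Sum>b\<in>UNIV. \<Sum>m\<in>UNIV. scalar (cnj (R l a b m)) * (free_gen (X1 m) * free_gen (X2 b)))"
      by (simp only: diff_conv_add_uminus star scalar_commute[of "free_gen _ * free_gen _"])
    then show ?thesis unfolding relations_def by blast
  next
    case 21
    then have "free_star f = free_gen (X1 l) * free_gen (X2 a)
        - (\<Sum>b\<in>UNIV. \<Sum>m\<in>UNIV. scalar (R l a b m) * (free_gen (X2 b) * free_gen (X1 m)))"
      by (simp only: diff_conv_add_uminus star complex_cnj_cnj scalar_commute[of "free_gen _ * free_gen _"])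
    then show ?thesis unfolding relations_def by blast
  qed
qed

lemma deformed_ideal: "ideal (deformed_ideal R) free_alg"
  unfolding deformed_ideal_def by (rule free_alg.genideal_ideal) simp

lemma relations_subset: "relations R \<subseteq> deformed_ideal R"
  unfolding deformed_ideal_def by (rule free_alg.genideal_self) simp

lemma deformed_ideal_star: "f \<in> deformed_ideal R \<Longrightarrow> free_star f \<in> deformed_ideal R"
  unfolding deformed_ideal_def
  by (rule free_alg.genideal_star_closed)
    (use free_star_relations relations_subset[unfolded deformed_ideal_def] in auto)

lemma presented_deformed_alg: "presented_star_algebra (deformed_alg R) (deformed_class R)"
proof -
  have eq: "deformed_class R = (+>\<^bsub>free_alg\<^esub>) (deformed_ideal R)"
    by (simp add: deformed_class_def fun_eq_iff)
  note Q = star_quotient_algebra[OF free_alg.star_algebra_axioms deformed_ideal deformed_ideal_star]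
  interpret star_algebra "deformed_alg R"
    unfolding deformed_alg_def by (rule Q(1))
  show ?thesis
    by unfold_locales (use Q(2,3) in \<open>simp_all add: deformed_alg_def eq\<close>)
qed

abbreviation x1 :: "4 \<Rightarrow> free" where "x1 \<equiv> \<lambda>\<mu>. free_gen (X1 \<mu>)"
abbreviation x2 :: "4 \<Rightarrow> free" where "x2 \<equiv> \<lambda>\<mu>. free_gen (X2 \<mu>)"

lemma sq_norm_deformed_gen:
  "sq_norm (deformed_alg R) (\<lambda>l. deformed_gen R (i l)) = deformed_class R (norm_sq (\<lambda>l. free_gen (i l)))"
proof -
  interpret D: presented_star_algebra "deformed_alg R" "deformed_class R"
    by (rule presented_deformed_alg)
  show ?thesis
    using D.sq_norm_cls[of "\<lambda>l. free_gen (i l)"] by (simp add: deformed_gen_def deformed_class_def)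
qed

lemma sphere_ideal_eq:
  "sphere_ideal R = Idl\<^bsub>deformed_alg R\<^esub> {deformed_class R (norm_sq x1 + norm_sq x2 - 1)}"
proof -
  interpret D: presented_star_algebra "deformed_alg R" "deformed_class R"
    by (rule presented_deformed_alg)
  show ?thesis
    unfolding sphere_ideal_def sq_norm_deformed_gen by (simp only: D.cls_add D.cls_diff D.cls_1)
qed

lemma free_star_norm_sq: "(\<And>\<mu>. free_star (p \<mu>) = p \<mu>) \<Longrightarrow> free_star (norm_sq p) = norm_sq p"
  by (simp add: norm_sq_def free_star_sum free_star_mult)

text \<open>
  The generator of the ideal of the sphere is hermitian, so this ideal is closed under the involution.
\<close>

lemma presented_seven_sphere: "presented_star_algebra (seven_sphere R) (sphere_class R)"
  and sphere_relation: "sphere_class R (norm_sq x1 + norm_sq x2) = sphere_class R 1"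
proof -
  interpret D: presented_star_algebra "deformed_alg R" "deformed_class R"
    by (rule presented_deformed_alg)
  let ?s = "deformed_class R (norm_sq x1 + norm_sq x2 - 1)"
  have ideal: "ideal (sphere_ideal R) (deformed_alg R)"
    unfolding sphere_ideal_eq by (rule D.genideal_ideal) simp
  have s: "?s \<in> sphere_ideal R"
    unfolding sphere_ideal_eq by (rule D.genideal_self') simp
  have "star (deformed_alg R) ?s = deformed_class R (free_star (norm_sq x1 + norm_sq x2 - 1))"
    by (simp only: D.cls_star)
  also have "free_star (norm_sq x1 + norm_sq x2 - 1) = norm_sq x1 + norm_sq x2 - 1"
    by (simp only: diff_conv_add_uminus free_star_add free_star_minus free_star_1 free_star_norm_sq free_star_gen)
  finally have star_s: "star (deformed_alg R) ?s = ?s" .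
  have star: "star (deformed_alg R) X \<in> sphere_ideal R" if "X \<in> sphere_ideal R" for X
    using that unfolding sphere_ideal_eq
    by (rule D.genideal_star_closed[rotated 2]) (use s star_s in \<open>auto simp: sphere_ideal_eq[symmetric]\<close>)
  note quotient = star_quotient_algebra[OF D.star_algebra_axioms ideal]
  interpret star_algebra "seven_sphere R"
    unfolding seven_sphere_def by (rule quotient(1)) (rule star)
  have hom: "(+>\<^bsub>deformed_alg R\<^esub>) (sphere_ideal R) \<in> star_hom (deformed_alg R) (seven_sphere R)"
    unfolding seven_sphere_def by (rule quotient(2)) (rule star)
  have carrier: "carrier (seven_sphere R) = (+>\<^bsub>deformed_alg R\<^esub>) (sphere_ideal R) ` carrier (deformed_alg R)"
    unfolding seven_sphere_def by (rule quotient(3)) (rule star)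
  show "presented_star_algebra (seven_sphere R) (sphere_class R)"
  proof
    show "carrier (seven_sphere R) = range (sphere_class R)"
      unfolding carrier D.carrier_eq sphere_class_def image_image by blast
    show "sphere_class R \<in> star_hom free_alg (seven_sphere R)"
      using star_hom_compose[OF D.cls_hom hom] by (simp only: sphere_class_def[abs_def])
  qed
  have "deformed_class R (norm_sq x1 + norm_sq x2) \<ominus>\<^bsub>deformed_alg R\<^esub> deformed_class R 1 \<in> sphere_ideal R"
    using s by (simp only: D.cls_diff)
  then show "sphere_class R (norm_sq x1 + norm_sq x2) = sphere_class R 1"
    unfolding sphere_class_def by (subst coset_eq_iff[OF ideal]) simp_all
qed

lemma sphere_class_deformed:
  "deformed_class R f = deformed_class R g \<Longrightarrow> sphere_class R f = sphere_class R g"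
  by (simp add: sphere_class_def)

lemma sphere_class_relation:
  assumes "f - g \<in> relations R"
  shows "sphere_class R f = sphere_class R g"
proof (rule sphere_class_deformed)
  have "f - g \<in> deformed_ideal R" using relations_subset assms by blast
  then show "deformed_class R f = deformed_class R g"
    unfolding deformed_class_def by (subst coset_eq_iff[OF deformed_ideal]) simp_all
qed

lemma sphere_class_norm_central:
  assumes "admissible R" "i = X1 \<or> i = X2"
  shows "sphere_class R (norm_sq (\<lambda>\<mu>. free_gen (i \<mu>)) * f) = sphere_class R (f * norm_sq (\<lambda>\<mu>. free_gen (i \<mu>)))"
proof (rule sphere_class_deformed)
  interpret D: presented_star_algebra "deformed_alg R" "deformed_class R"
    by (rule presented_deformed_alg)
  have "central (deformed_alg R) (deformed_class R (norm_sq (\<lambda>\<mu>. free_gen (i \<mu>))))"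
    using assms unfolding admissible_def sq_norm_deformed_gen by blast
  then show "deformed_class R (norm_sq (\<lambda>\<mu>. free_gen (i \<mu>)) * f) = deformed_class R (f * norm_sq (\<lambda>\<mu>. free_gen (i \<mu>)))"
    unfolding central_def D.cls_mult by blast
qed

section \<open>The action of the unit quaternions\<close>

text \<open>
  All products \<open>s\<^sup>i t\<^sup>j\<close> lie in \<open>L\<close>, by downward induction: \<open>s\<^sup>i t\<^sup>j = s\<^sup>i (s + t) t\<^sup>j\<close>.
\<close>

lemma (in free_ideal) comaximal_powers:
  assumes sum: "s + t \<simeq>[J] 1" and central: "\<And>f. f * s \<simeq>[J] s * f"
    and L_add: "\<And>f g. f \<in> L \<Longrightarrow> g \<in> L \<Longrightarrow> f + g \<in> L" and L_mult: "\<And>f g. g \<in> L \<Longrightarrow> f * g \<in> L"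
    and L_cong: "\<And>f g. f \<simeq>[J] g \<Longrightarrow> g \<in> L \<Longrightarrow> f \<in> L"
    and s: "s ^ m \<in> L" and t: "t ^ n \<in> L"
  shows "1 \<in> L"
proof -
  have "s ^ i * t ^ j \<in> L" for i j
  proof (induction "(m - i) + (n - j)" arbitrary: i j rule: less_induct)
    case less
    show ?case
    proof (cases "m \<le> i \<or> n \<le> j")
      case True
      then show ?thesis
      proof
        assume "n \<le> j"
        then have "s ^ i * t ^ j = (s ^ i * t ^ (j - n)) * t ^ n"
          by (simp add: mult.assoc flip: power_add)
        then show ?thesis using L_mult[OF t] by simp
      next
        assume i: "m \<le> i"
        have "f * s ^ k \<simeq>[J] s ^ k * f" for f k
        proof (induction k)
          case (Suc k)
          have "f * s ^ Suc k \<simeq>[J] s * f * s ^ k"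
            using cong_mult_right[OF central] by (simp flip: mult.assoc)
          also have "\<dots> \<simeq>[J] s * (s ^ k * f)"
            unfolding mult.assoc by (rule cong_mult_left) (rule Suc)
          finally show ?case by (simp add: mult.assoc)
        qed simp
        from cong_mult_left[OF cong_sym[OF this], of "s ^ (i - m)" m "t ^ j"]
        have "s ^ i * t ^ j \<simeq>[J] s ^ (i - m) * (t ^ j * s ^ m)"
          using i by (simp flip: mult.assoc power_add)
        then show ?thesis by (rule L_cong) (intro L_mult s)
      qed
    next
      case False
      have "s ^ i * t ^ j \<simeq>[J] s ^ i * ((s + t) * t ^ j)"
        using cong_mult_left[OF cong_mult_right[OF cong_sym[OF sum]], of "s ^ i" "t ^ j"] by simp
      also have "\<dots> = s ^ Suc i * t ^ j + s ^ i * t ^ Suc j"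
        by (simp add: distrib_left distrib_right power_commutes flip: mult.assoc)
      finally have split: "s ^ i * t ^ j \<simeq>[J] s ^ Suc i * t ^ j + s ^ i * t ^ Suc j" .
      have "m - Suc i + (n - j) < m - i + (n - j)" "m - i + (n - Suc j) < m - i + (n - j)"
        using False by linarith+
      then show ?thesis by (intro L_cong[OF split] L_add less)
    qed
  qed
  from this[of 0 0] show ?thesis by simp
qed

text \<open>
  A lift of \<open>\<alpha>\<^sub>v\<close> to the free algebra.
\<close>

definition act :: "(4 \<Rightarrow> real) \<Rightarrow> free \<Rightarrow> free" where
  "act v = subst (\<lambda>g. case g of X1 \<mu> \<Rightarrow> (x1 \<bullet> quat_real v) \<mu> | X2 \<mu> \<Rightarrow> (x2 \<bullet> quat_real v) \<mu>)"

lemma act_simps: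
  "act v (f + g) = act v f + act v g" "act v (f * g) = act v f * act v g"
  "act v (scalar c) = scalar c" "act v (x1 \<mu>) = (x1 \<bullet> quat_real v) \<mu>" "act v (x2 \<mu>) = (x2 \<bullet> quat_real v) \<mu>"
  by (simp_all add: act_def subst_add subst_mult)

lemma norm_sq_eq_quat_mult: "norm_sq p = (p \<bullet> quat_conj p) 0"
  by (simp add: norm_sq_def sum_4 quat_mult_components quat_conj_components)

text \<open>
  \<open>(p v)(q v)\<^sup>* = p (v v\<^sup>*) q\<^sup>* = p q\<^sup>*\<close>; for \<open>p = q\<close> the component 0 is the square norm.
\<close>

lemma act_quat_pair:
  assumes v: "v \<in> unit_sphere"
    and "\<And>\<mu>. act v (p \<mu>) = (p \<bullet> quat_real v) \<mu>" "\<And>\<mu>. act v (q \<mu>) = (q \<bullet> quat_real v) \<mu>"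
  shows "act v ((p \<bullet> quat_conj q) \<mu>) = (p \<bullet> quat_conj q) \<mu>"
proof -
  have "act v ((p \<bullet> quat_conj q) \<mu>) = ((p \<bullet> quat_real v) \<bullet> quat_conj (q \<bullet> quat_real v)) \<mu>"
    unfolding free_quat_mult_def[of p "quat_conj q"] free_quat_mult_def[of "p \<bullet> quat_real v"]
    by (simp add: act_def subst_sum subst_mult quat_conj_def assms(2,3)[unfolded act_def])
  also have "(p \<bullet> quat_real v) \<bullet> quat_conj (q \<bullet> quat_real v)
      = p \<bullet> (quat_real v \<bullet> quat_conj (quat_real v)) \<bullet> quat_conj q"
    by (simp only: quat_mult_conj_real quat_mult_assoc)
  also have "\<dots> = p \<bullet> quat_conj q"
    by (simp add: quat_real_conj[OF v] quat_mult_scalar)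
  finally show ?thesis .
qed

lemma free_star_quat_pair:
  assumes "\<And>\<mu>. free_star (p \<mu>) = p \<mu>" "\<And>\<mu>. free_star (q \<mu>) = q \<mu>"
  shows "free_star ((p \<bullet> quat_conj q) \<mu>) = quat_conj (q \<bullet> quat_conj p) \<mu>"
proof -
  have "(\<lambda>\<mu>. free_star ((p \<bullet> quat_conj q) \<mu>)) = quat_conj (q \<bullet> quat_conj p)"
    by (rule quat_eqI)
      (simp_all add: quat_mult_components quat_conj_components diff_conv_add_uminus free_star_add
        free_star_minus free_star_mult assms del: add_uminus_conv_diff)
  then show ?thesis by (simp add: fun_eq_iff)
qed

lemma carrier_U1H: "carrier U1H = unit_sphere"
  by (simp add: U1H_def unit_sphere_def)

locale sphere_action =
  fixes R :: deformation and \<alpha> :: "(4 \<Rightarrow> real) \<Rightarrow> free set set \<Rightarrow> free set set"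
  assumes admissible: "admissible R" and action: "unit_quaternion_action R \<alpha>"
begin

abbreviation "A \<equiv> seven_sphere R"
abbreviation "cls \<equiv> sphere_class R"
abbreviation "B \<equiv> four_sphere R"
abbreviation "poly \<equiv> generated_star_subalgebra (function_alg (carrier U1H)) (range coord)"

sublocale function_tensor A cls "carrier U1H" poly
proof (intro function_tensor.intro presented_seven_sphere function_tensor_axioms.intro)
  interpret F: star_algebra "function_alg (carrier U1H)" by (rule function_alg_star_algebra)
  show "star_subalgebra poly (function_alg (carrier U1H))"
    by (rule F.star_subalgebra_generated) (auto simp: coord_def)
qed

lemma SU2_alg_eq: "SU2_alg = H"
  by (simp only: SU2_alg_def)

lemma \<alpha>_hom: "v \<in> carrier U1H \<Longrightarrow> \<alpha> v \<in> star_hom A A"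
  using action by (simp add: unit_quaternion_action_def)

lemma quat_x_eq: "quat_x R X1 = (\<lambda>\<mu>. cls (x1 \<mu>))" "quat_x R X2 = (\<lambda>\<mu>. cls (x2 \<mu>))"
  by (simp_all add: quat_x_def sphere_gen_def sphere_class_def deformed_gen_def deformed_class_def)

lemma quat_of_real_eq: "quat_of_real A v = (\<lambda>\<mu>. cls (quat_real v \<mu>))"
  by (simp add: quat_of_real_def quat_real_def cls_scalar)

lemma \<alpha>_cls:
  assumes v: "v \<in> carrier U1H"
  shows "\<alpha> v (cls f) = cls (act v f)"
proof (induction f rule: free_induct)
  case (scalar c)
  show ?case
    using star_homD(4,5)[OF \<alpha>_hom[OF v]] by (simp add: act_simps cls_scalar)
next
  case (gen_mult g f)
  have "\<alpha> v (quat_x R X1 \<mu>) = cls (act v (x1 \<mu>))" "\<alpha> v (quat_x R X2 \<mu>) = cls (act v (x2 \<mu>))" for \<mu>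
    using action v unfolding unit_quaternion_action_def
    by (simp_all add: quat_x_eq quat_of_real_eq quat_mult_cls act_simps)
  then have "\<alpha> v (cls (free_gen g)) = cls (act v (free_gen g))"
    by (cases g) (simp_all add: quat_x_eq)
  then show ?case
    using gen_mult star_homD(3)[OF \<alpha>_hom[OF v]] by (simp add: cls_mult act_simps(2))
next
  case (add f g)
  then show ?case
    using star_homD(2)[OF \<alpha>_hom[OF v]] by (simp add: cls_add act_simps(1))
qed

lemma act_mem_J: "v \<in> carrier U1H \<Longrightarrow> f \<in> J \<Longrightarrow> act v f \<in> J"
  using \<alpha>_cls[of v f] \<alpha>_cls[of v 0] by (simp add: J_def cls_0 act_def)

lemma quat_Y_eq: "quat_Y R \<mu> = cls (scalar 2 * (x2 \<bullet> quat_conj x1) \<mu>)"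
proof -
  have "quat_star A (quat_x R X1) = (\<lambda>\<mu>. cls (quat_conj x1 \<mu>))"
    unfolding quat_star_def quat_x_eq
    by (rule ext) (simp add: quat_conj_def conj_sign_def cls_star[symmetric] free_star_gen
        scalar_1 scalar_uminus cls_uminus)
  then show ?thesis
    unfolding quat_Y_def quat_x_eq by (simp only: quat_mult_cls cls_scalar_mult)
qed

lemma last_Y_eq: "last_Y R = cls (norm_sq x2 - norm_sq x1)"
  unfolding last_Y_def quat_x_eq by (simp only: sq_norm_cls cls_diff)

lemma norm_sum: "norm_sq x1 + norm_sq x2 \<simeq>[J] 1"
  using sphere_relation[of R] by (simp only: cls_eq_iff)

lemma norm_central:
  "norm_sq x1 * f \<simeq>[J] f * norm_sq x1" "norm_sq x2 * f \<simeq>[J] f * norm_sq x2"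
  using sphere_class_norm_central[OF admissible, of X1 f] sphere_class_norm_central[OF admissible, of X2 f]
  by (simp_all add: cls_eq_iff)

lemma B_subalgebra: "star_subalgebra B A"
  unfolding four_sphere_def by (rule star_subalgebra_generated) (auto simp: quat_Y_eq last_Y_eq)

lemma B_carrier: "B \<subseteq> carrier A"
  using B_subalgebra subringE(1) by (auto simp: star_subalgebra_def)

lemma Y_mem: "quat_Y R \<mu> \<in> B" "last_Y R \<in> B"
  using generated_star_subalgebra_incl[of "insert (last_Y R) (range (quat_Y R))" A]
  by (simp_all add: four_sphere_def image_subset_iff)

text \<open>
  The preimage of the four-sphere in the free algebra.
\<close>

definition Bf :: "free set" where "Bf = {f. cls f \<in> B}"

lemma Bf_subalgebra: "star_subalgebra Bf free_alg"
proof -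
  have "scalar c * f \<in> Bf" if "f \<in> Bf" for c f
    using B_subalgebra that by (simp add: Bf_def cls_scalar_mult star_subalgebra_def)
  moreover have "free_star f \<in> Bf" if "f \<in> Bf" for f
    using B_subalgebra that by (simp add: Bf_def cls_star star_subalgebra_def)
  ultimately show ?thesis
    using B_subalgebra subringE[of B A] unfolding star_subalgebra_free_alg
    by (simp add: Bf_def star_subalgebra_def cls_1 cls_add cls_mult)
qed

lemma Bf_closed:
  "1 \<in> Bf" "f \<in> Bf \<Longrightarrow> g \<in> Bf \<Longrightarrow> f + g \<in> Bf" "f \<in> Bf \<Longrightarrow> scalar c * f \<in> Bf" "f \<in> Bf \<Longrightarrow> free_star f \<in> Bf"
  using Bf_subalgebra unfolding star_subalgebra_free_alg by blast+

lemma J_subset_Bf: "J \<subseteq> Bf"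
  using B_subalgebra subringE(2)[of B A] by (auto simp: Bf_def J_def star_subalgebra_def)

lemma Bf_cong: "f \<simeq>[J] g \<Longrightarrow> g \<in> Bf \<Longrightarrow> f \<in> Bf"
  by (simp add: Bf_def flip: cls_eq_iff)

lemma conj_sign_cancel: "rs (conj_sign \<mu>) * (rs (conj_sign \<mu>) * f) = f"
  by (simp add: conj_sign_def scalar_1 scalar_uminus)

lemma scalar_half: "scalar (1 / 2) * (scalar 2 * f) = f"
  by (simp add: scalar_1 flip: mult.assoc scalar_mult del: single_numeral)

lemma pair_mem_Bf: "(x2 \<bullet> quat_conj x1) \<mu> \<in> Bf" "(x1 \<bullet> quat_conj x2) \<mu> \<in> Bf"
proof -
  have "scalar 2 * (x2 \<bullet> quat_conj x1) \<mu> \<in> Bf" for \<mu>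
    using Y_mem(1)[of \<mu>] by (simp only: Bf_def quat_Y_eq mem_Collect_eq)
  then show 1: "(x2 \<bullet> quat_conj x1) \<mu> \<in> Bf" for \<mu>
    using Bf_closed(3)[of "scalar 2 * (x2 \<bullet> quat_conj x1) \<mu>" "1 / 2"] by (simp only: scalar_half)
  have "quat_conj (x1 \<bullet> quat_conj x2) \<mu> \<in> Bf"
    using Bf_closed(4)[OF 1] by (simp add: free_star_quat_pair free_star_gen)
  then show "(x1 \<bullet> quat_conj x2) \<mu> \<in> Bf"
    using Bf_closed(3)[of "quat_conj (x1 \<bullet> quat_conj x2) \<mu>" "of_real (conj_sign \<mu>)"]
    by (simp only: quat_conj_def[of "x1 \<bullet> _"] conj_sign_cancel)
qed

text \<open>
  Both square norms are combinations of \<open>Y\<^sup>4\<close> and of their sum 1.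
\<close>

lemma norm_mem_Bf: "norm_sq x1 \<in> Bf" "norm_sq x2 \<in> Bf"
proof -
  have Y4: "norm_sq x2 - norm_sq x1 \<in> Bf"
    using Y_mem(2) by (simp only: Bf_def last_Y_eq mem_Collect_eq)
  have sum: "norm_sq x1 + norm_sq x2 \<in> Bf"
    by (rule Bf_cong[OF norm_sum Bf_closed(1)])
  have two: "scalar 2 * f = f + f" for f
    unfolding one_add_one[symmetric] scalar_add scalar_1 distrib_right by simp
  have "scalar 2 * norm_sq x2 \<in> Bf"
    using Bf_closed(2)[OF sum Y4] by (simp add: two del: single_numeral)
  then show 2: "norm_sq x2 \<in> Bf"
    using Bf_closed(3)[of "scalar 2 * norm_sq x2" "1 / 2"] by (simp only: scalar_half)
  have "scalar (- 1) * (norm_sq x2 - norm_sq x1) + norm_sq x2 \<in> Bf"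
    by (intro Bf_closed(2,3) Y4 2)
  then show "norm_sq x1 \<in> Bf" by (simp add: scalar_uminus scalar_1)
qed

lemma Bf_minimal:
  assumes T: "star_subalgebra T free_alg" and JT: "J \<subseteq> T"
    and pair: "\<And>\<mu>. (x2 \<bullet> quat_conj x1) \<mu> \<in> T" and norms: "norm_sq x1 \<in> T" "norm_sq x2 \<in> T"
  shows "Bf \<subseteq> T"
proof -
  have T_closed: "1 \<in> T" "\<And>f g. f \<in> T \<Longrightarrow> g \<in> T \<Longrightarrow> f + g \<in> T" "\<And>f g. f \<in> T \<Longrightarrow> g \<in> T \<Longrightarrow> f * g \<in> T"
    "\<And>c f. f \<in> T \<Longrightarrow> scalar c * f \<in> T" "\<And>f. f \<in> T \<Longrightarrow> free_star f \<in> T"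
    using T unfolding star_subalgebra_free_alg by blast+
  have minus: "- f \<in> T" if "f \<in> T" for f
    using T_closed(4)[OF that, of "- 1"] by (simp add: scalar_uminus scalar_1)
  have "subring (cls ` T) A"
  proof (rule subringI)
    show "\<one>\<^bsub>A\<^esub> \<in> cls ` T" using T_closed(1) by (metis cls_1 imageI)
    show "\<ominus>\<^bsub>A\<^esub> h \<in> cls ` T" if "h \<in> cls ` T" for h
      using that minus by (metis (no_types, lifting) cls_uminus image_iff)
    show "h1 \<otimes>\<^bsub>A\<^esub> h2 \<in> cls ` T" "h1 \<oplus>\<^bsub>A\<^esub> h2 \<in> cls ` T" if "h1 \<in> cls ` T" "h2 \<in> cls ` T" for h1 h2
      using that T_closed(2,3) by (auto simp flip: cls_mult cls_add)
  qed auto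
  then have "star_subalgebra (cls ` T) A"
    using T_closed(4,5) by (auto simp: star_subalgebra_def simp flip: cls_scalar_mult cls_star)
  moreover have "insert (last_Y R) (range (quat_Y R)) \<subseteq> cls ` T"
    using T_closed(4)[OF pair] T_closed(2)[OF norms(2) minus[OF norms(1)]]
    by (auto simp: quat_Y_eq last_Y_eq simp del: single_numeral)
  ultimately have B_T: "B \<subseteq> cls ` T"
    unfolding four_sphere_def by (rule generated_star_subalgebra_minimal)
  show ?thesis
  proof
    fix f assume "f \<in> Bf"
    then obtain g where g: "g \<in> T" "cls f = cls g" using B_T by (auto simp: Bf_def)
    then have "f - g \<in> T" using JT by (auto simp: cls_eq_iff cong_mod_def)
    then show "f \<in> T" using T_closed(2)[of "f - g" g] g(1) by simp
  qed
qed

lemma relation_cong: "f - g \<in> relations R \<Longrightarrow> f \<simeq>[J] g"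
  using sphere_class_relation by (simp flip: cls_eq_iff)

lemma generators_x1_x2: "free_gen i \<in> range x1 \<union> range x2"
  by (cases i) auto

text \<open>
  The two halves of the seven-sphere. For the second one the exchange relation is the one with the complex
  conjugate coefficients.
\<close>

sublocale P1: quaternion_pair J x1 x2 R Bf act
proof unfold_locales
  show "x1 \<mu> * x1 \<nu> \<simeq>[J] x1 \<nu> * x1 \<mu>" for \<mu> \<nu>
    by (rule relation_cong) (unfold relations_def, blast)
  show "x1 l * x2 a \<simeq>[J] (\<Sum>b\<in>UNIV. \<Sum>m\<in>UNIV. scalar (R l a b m) * (x2 b * x1 m))" for l a
    by (rule relation_cong) (unfold relations_def, blast)
  show "Bf \<subseteq> T" if "star_subalgebra T free_alg" "J \<subseteq> T" "\<forall>\<mu>. (x2 \<bullet> quat_conj x1) \<mu> \<in> T" "norm_sq x1 \<in> T" for T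
  proof (rule Bf_minimal[OF that(1,2)])
    have T: "1 \<in> T" "\<And>f g. f \<in> T \<Longrightarrow> g \<in> T \<Longrightarrow> f + g \<in> T" "\<And>c f. f \<in> T \<Longrightarrow> scalar c * f \<in> T"
      using that(1) unfolding star_subalgebra_free_alg by blast+
    have "norm_sq x1 + norm_sq x2 - 1 \<in> T" using norm_sum that(2) by (auto simp: cong_mod_def)
    from T(2)[OF T(2)[OF this T(1)] T(3)[OF that(4)]]
    have "(norm_sq x1 + norm_sq x2 - 1) + 1 + scalar (- 1) * norm_sq x1 \<in> T" .
    then show "norm_sq x2 \<in> T" by (simp add: scalar_uminus scalar_1)
  qed (use that in auto)
qed (use generators_x1_x2 act_mem_J J_subset_Bf Bf_subalgebra pair_mem_Bf norm_mem_Bf norm_central in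
    \<open>simp_all add: free_star_gen act_simps carrier_U1H\<close>)

sublocale P2: quaternion_pair J x2 x1 "\<lambda>l a b m. cnj (R a l m b)" Bf act
proof unfold_locales
  show "x2 \<mu> * x2 \<nu> \<simeq>[J] x2 \<nu> * x2 \<mu>" for \<mu> \<nu>
    by (rule relation_cong) (unfold relations_def, blast)
  show "x2 l * x1 a \<simeq>[J] (\<Sum>b\<in>UNIV. \<Sum>m\<in>UNIV. scalar (cnj (R a l m b)) * (x1 b * x2 m))" for l a
    by (subst sum.swap, rule relation_cong) (unfold relations_def, blast)
  show "Bf \<subseteq> T" if "star_subalgebra T free_alg" "J \<subseteq> T" "\<forall>\<mu>. (x1 \<bullet> quat_conj x2) \<mu> \<in> T" "norm_sq x2 \<in> T" for T
  proof (rule Bf_minimal[OF that(1,2)])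
    have T: "1 \<in> T" "\<And>f g. f \<in> T \<Longrightarrow> g \<in> T \<Longrightarrow> f + g \<in> T" "\<And>c f. f \<in> T \<Longrightarrow> scalar c * f \<in> T"
      "\<And>f. f \<in> T \<Longrightarrow> free_star f \<in> T"
      using that(1) unfolding star_subalgebra_free_alg by blast+
    have "norm_sq x1 + norm_sq x2 - 1 \<in> T" using norm_sum that(2) by (auto simp: cong_mod_def)
    from T(2)[OF T(2)[OF this T(1)] T(3)[OF that(4)]]
    have "(norm_sq x1 + norm_sq x2 - 1) + 1 + scalar (- 1) * norm_sq x2 \<in> T" .
    then show "norm_sq x1 \<in> T" by (simp add: scalar_uminus scalar_1)
    have "quat_conj (x2 \<bullet> quat_conj x1) \<mu> \<in> T" for \<mu>
      using T(4)[OF spec[OF that(3)]] by (simp add: free_star_quat_pair free_star_gen)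
    then show "(x2 \<bullet> quat_conj x1) \<mu> \<in> T" for \<mu>
      using T(3)[of "quat_conj (x2 \<bullet> quat_conj x1) \<mu>" "of_real (conj_sign \<mu>)"]
      by (simp only: quat_conj_def[of "x2 \<bullet> _"] conj_sign_cancel)
  qed (use that in auto)
qed (use generators_x1_x2 act_mem_J J_subset_Bf Bf_subalgebra pair_mem_Bf norm_mem_Bf norm_central in
    \<open>simp_all add: free_star_gen act_simps carrier_U1H Un_commute\<close>)

section \<open>Injectivity and surjectivity\<close>

lemma act_star: "act v (free_star f) = free_star (act v f)"
proof -
  have star: "free_star ((p \<bullet> quat_real v) \<mu>) = (p \<bullet> quat_real v) \<mu>" if "\<And>\<mu>. free_star (p \<mu>) = p \<mu>" for p \<mu>
    unfolding quat_mult_real quat_mult_unit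
    by (simp add: free_star_sum free_star_mult free_star_scalar that sum_mult_distrib_free
        scalar_commute[of "p _"] scalar_commute[of "scalar _ * p _"])
  show ?thesis
    unfolding act_def by (rule subst_star) (auto split: gen.split simp: star free_star_gen)
qed

lemma act_fixes_Bf:
  assumes v: "v \<in> carrier U1H" and f: "f \<in> Bf"
  shows "act v f \<simeq>[J] f"
proof -
  let ?T = "{f. act v f \<simeq>[J] f}"
  have v': "v \<in> unit_sphere" using v by (simp add: carrier_U1H)
  have "Bf \<subseteq> ?T"
  proof (rule Bf_minimal)
    show "star_subalgebra ?T free_alg"
      unfolding star_subalgebra_free_alg
    proof (intro conjI ballI allI CollectI)
      show "act v 1 \<simeq>[J] 1" by (simp add: act_def)
    next
      fix f g assume "f \<in> ?T" "g \<in> ?T"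
      then show "act v (f + g) \<simeq>[J] f + g" "act v (f * g) \<simeq>[J] f * g"
        by (auto simp: act_simps intro: cong_add cong_mult)
    next
      fix c f assume "f \<in> ?T"
      then show "act v (scalar c * f) \<simeq>[J] scalar c * f"
        by (auto simp: act_simps intro: cong_mult)
    next
      fix f assume "f \<in> ?T"
      then show "act v (free_star f) \<simeq>[J] free_star f"
        by (simp add: act_star cls_star flip: cls_eq_iff)
    qed
    show "J \<subseteq> ?T"
      using act_mem_J[OF v] by (auto simp: cong_mod_def intro: diff_mem)
  qed (simp_all add: norm_sq_eq_quat_mult act_quat_pair[OF v'] act_simps)
  then show ?thesis using f by blast
qed

sublocale BT: balanced_tensor A A B "(\<otimes>\<^bsub>A\<^esub>)" "(\<otimes>\<^bsub>A\<^esub>)"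
  by unfold_locales (use B_carrier in auto)

abbreviation "KB \<equiv> BT.K"

definition \<Psi> :: "(4 \<Rightarrow> real) \<Rightarrow> (free set set \<times> free set set \<Rightarrow>\<^sub>0 int) \<Rightarrow> free" where
  "\<Psi> v = frag_ext (\<lambda>(p, q). rep p * act v (rep q))"

lemma cls_\<Psi>_of:
  "\<lbrakk>p \<in> carrier A; q \<in> carrier A; v \<in> carrier U1H\<rbrakk> \<Longrightarrow> cls (\<Psi> v (frag_of (p, q))) = p \<otimes>\<^bsub>A\<^esub> \<alpha> v q"
  using \<alpha>_cls[of v "rep q"] by (simp add: \<Psi>_def cls_mult)

lemma \<Psi>_diff: "\<Psi> v (s - t) = \<Psi> v s - \<Psi> v t" and \<Psi>_add: "\<Psi> v (s + t) = \<Psi> v s + \<Psi> v t"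
  and \<Psi>_0: "\<Psi> v 0 = 0"
  by (simp_all add: \<Psi>_def frag_ext_diff frag_ext_add)

lemma \<alpha>_closed: "v \<in> carrier U1H \<Longrightarrow> p \<in> carrier A \<Longrightarrow> \<alpha> v p \<in> carrier A"
  using star_homD(1)[OF \<alpha>_hom] .

lemma \<alpha>_fixes_B: "v \<in> carrier U1H \<Longrightarrow> b \<in> B \<Longrightarrow> \<alpha> v b = b"
  using act_fixes_Bf[of v "rep b"] \<alpha>_cls[of v "rep b"] B_carrier
  by (auto simp: Bf_def subset_iff simp flip: cls_eq_iff)

text \<open>
  Balancedness holds because \<open>\<alpha>\<^sub>v\<close> fixes the four-sphere.
\<close>

lemma \<Psi>_kernel:
  assumes "t \<in> KB" and v: "v \<in> carrier U1H"
  shows "\<Psi> v t \<in> J"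
proof -
  let ?L = "{t. \<Psi> v t \<in> J}"
  interpret L: ab_subgroup ?L
    by unfold_locales (auto simp: \<Psi>_0 \<Psi>_diff zero_mem intro: diff_mem)
  have mem: "t - s - s' \<in> ?L" if "cls (\<Psi> v t) = cls (\<Psi> v s) \<oplus>\<^bsub>A\<^esub> cls (\<Psi> v s')" for t s s'
    using that by (simp add: \<Psi>_diff \<Psi>_add cong_mod_def cls_eq_iff diff_diff_eq flip: cls_add)
  have mem': "t - s \<in> ?L" if "cls (\<Psi> v t) = cls (\<Psi> v s)" for t s
    using that by (simp add: \<Psi>_diff cong_mod_def cls_eq_iff)
  have "KB \<subseteq> ?L"
  proof (rule BT.kernel_minimal[OF L.ab_subgroup_axioms])
    show "tensor_relations A A B (\<otimes>\<^bsub>A\<^esub>) (\<otimes>\<^bsub>A\<^esub>) \<subseteq> ?L"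
      unfolding tensor_relations_def
    proof (intro Un_least subsetI; elim CollectE exE conjE; hypsubst)
      fix m m' n assume "m \<in> carrier A" "m' \<in> carrier A" "n \<in> carrier A"
      then show "frag_of (m \<oplus>\<^bsub>A\<^esub> m', n) - frag_of (m, n) - frag_of (m', n) \<in> ?L"
        using v by (intro mem) (simp add: cls_\<Psi>_of \<alpha>_closed l_distr)
    next
      fix m n n' assume "m \<in> carrier A" "n \<in> carrier A" "n' \<in> carrier A"
      then show "frag_of (m, n \<oplus>\<^bsub>A\<^esub> n') - frag_of (m, n) - frag_of (m, n') \<in> ?L"
        using v star_homD(2)[OF \<alpha>_hom[OF v]] by (intro mem) (simp add: cls_\<Psi>_of \<alpha>_closed r_distr)
    next
      fix m s n assume "m \<in> carrier A" "s \<in> B" "n \<in> carrier A"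
      then show "frag_of (m \<otimes>\<^bsub>A\<^esub> s, n) - frag_of (m, s \<otimes>\<^bsub>A\<^esub> n) \<in> ?L"
        using v B_carrier star_homD(3)[OF \<alpha>_hom[OF v]]
        by (intro mem') (simp add: cls_\<Psi>_of \<alpha>_closed m_assoc \<alpha>_fixes_B subset_iff)
    qed
  qed
  then show ?thesis using assms(1) by blast
qed

abbreviation \<tau> :: "free \<Rightarrow> free \<Rightarrow> (free set set \<times> free set set \<Rightarrow>\<^sub>0 int)" where
  "\<tau> p q \<equiv> frag_of (cls p, cls q)"

lemma \<Psi>_\<tau>: "v \<in> carrier U1H \<Longrightarrow> \<Psi> v (\<tau> p q) \<simeq>[J] p * act v q"
  using cls_\<Psi>_of[of "cls p" "cls q" v] \<alpha>_cls[of v q] by (simp add: cls_mult flip: cls_eq_iff)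

lemma tensor_locale_axioms: "quaternion_pair_tensor_axioms J Bf act KB \<tau> \<Psi>"
proof (rule quaternion_pair_tensor_axioms.intro)
  show "ab_subgroup KB" by (rule BT.K.ab_subgroup_axioms)
  show "\<tau> p q \<simeq>[KB] \<tau> p' q'" if "p \<simeq>[J] p'" "q \<simeq>[J] q'" for p p' q q'
    using that by (simp flip: cls_eq_iff)
  show "\<tau> (p * b) q \<simeq>[KB] \<tau> p (b * q)" if "b \<in> Bf" for p b q
    using that BT.tensor_balanced[of "cls p" "cls q" "cls b"] by (simp add: Bf_def cls_mult)
qed (simp_all add: cls_add BT.tensor_add_left BT.tensor_add_right \<Psi>_diff \<Psi>_kernel \<Psi>_\<tau> carrier_U1H[symmetric])

sublocale T1: quaternion_pair_tensor J x1 x2 R Bf act KB \<tau> \<Psi>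
  by (intro quaternion_pair_tensor.intro P1.quaternion_pair_axioms tensor_locale_axioms)

sublocale T2: quaternion_pair_tensor J x2 x1 "\<lambda>l a b m. cnj (R a l m b)" Bf act KB \<tau> \<Psi>
  by (intro quaternion_pair_tensor.intro P2.quaternion_pair_axioms tensor_locale_axioms)

lemma left_mult_kernel:
  assumes c: "c \<in> carrier A" and t: "t \<in> KB"
  shows "frag_extend (\<lambda>(p, q). frag_of (c \<otimes>\<^bsub>A\<^esub> p, q)) t \<in> KB"
proof -
  let ?f = "\<lambda>t. frag_extend (\<lambda>(p, q). frag_of (c \<otimes>\<^bsub>A\<^esub> p, q)) t"
  let ?L = "{t. ?f t \<in> KB}"
  interpret L: ab_subgroup ?L
    by unfold_locales (auto simp: BT.K.zero_mem frag_extend_diff intro: BT.K.diff_mem)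
  have "KB \<subseteq> ?L"
  proof (rule BT.kernel_minimal[OF L.ab_subgroup_axioms])
    show "tensor_relations A A B (\<otimes>\<^bsub>A\<^esub>) (\<otimes>\<^bsub>A\<^esub>) \<subseteq> ?L"
      unfolding tensor_relations_def
    proof (intro Un_least subsetI; elim CollectE exE conjE; hypsubst)
      fix m m' n assume "m \<in> carrier A" "m' \<in> carrier A" "n \<in> carrier A"
      then show "frag_of (m \<oplus>\<^bsub>A\<^esub> m', n) - frag_of (m, n) - frag_of (m', n) \<in> ?L"
        using c BT.tensor_add_left[of "c \<otimes>\<^bsub>A\<^esub> m" "c \<otimes>\<^bsub>A\<^esub> m'" n]
        by (simp add: frag_extend_diff frag_extend_add r_distr cong_mod_def diff_diff_eq)
    next
      fix m n n' assume "m \<in> carrier A" "n \<in> carrier A" "n' \<in> carrier A"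
      then show "frag_of (m, n \<oplus>\<^bsub>A\<^esub> n') - frag_of (m, n) - frag_of (m, n') \<in> ?L"
        using c BT.tensor_add_right[of "c \<otimes>\<^bsub>A\<^esub> m" n n']
        by (simp add: frag_extend_diff frag_extend_add cong_mod_def diff_diff_eq)
    next
      fix m s n assume "m \<in> carrier A" "s \<in> B" "n \<in> carrier A"
      then show "frag_of (m \<otimes>\<^bsub>A\<^esub> s, n) - frag_of (m, s \<otimes>\<^bsub>A\<^esub> n) \<in> ?L"
        using c B_carrier BT.tensor_balanced[of "c \<otimes>\<^bsub>A\<^esub> m" n s]
        by (simp add: frag_extend_diff cong_mod_def m_assoc subset_iff)
    qed
  qed
  then show ?thesis using t by blast
qed

text \<open>
  Let \<open>L\<close> be the left ideal of all \<open>f\<close> that kill the given element by multiplication from the left. It contains a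
  power of \<open>\<parallel>x\<^sub>1\<parallel>\<^sup>2\<close> and a power of \<open>\<parallel>x\<^sub>2\<parallel>\<^sup>2\<close>, which have sum 1.
\<close>

lemma \<Psi>_injective:
  assumes t: "t \<in> BT.formal" and vanish: "\<And>v. v \<in> carrier U1H \<Longrightarrow> \<Psi> v t \<in> J"
  shows "t \<in> KB"
proof -
  obtain ps where ps: "set ps \<subseteq> carrier A \<times> carrier A" "t \<simeq>[KB] (\<Sum>p\<leftarrow>ps. frag_of p)"
    using BT.formal_cong_sum_list[OF abelian_group_axioms t] by blast
  define qs where "qs = map (\<lambda>(p, q). (rep p, rep q)) ps"
  have sum_eq: "(\<Sum>p\<leftarrow>ps. frag_of p) = (\<Sum>(p, q)\<leftarrow>qs. \<tau> p q)"
    using ps(1) unfolding qs_def by (induction ps) auto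
  have vanish': "\<Psi> v (\<Sum>(p, q)\<leftarrow>qs. \<tau> p q) \<in> J" if v: "v \<in> unit_sphere" for v
  proof -
    have "v \<in> carrier U1H" using v by (simp add: carrier_U1H)
    from diff_mem[OF vanish[OF this] \<Psi>_kernel[OF ps(2)[unfolded cong_mod_def] this]]
    show ?thesis by (simp add: \<Psi>_diff sum_eq)
  qed
  define L where "L = {f. (\<Sum>(p, q)\<leftarrow>qs. \<tau> (f * p) q) \<in> KB}"
  obtain m where m: "norm_sq x1 ^ m \<in> L"
    using T1.vanishing_imp_r_torsion[OF vanish'] unfolding L_def by blast
  obtain n where n: "norm_sq x2 ^ n \<in> L"
    using T2.vanishing_imp_r_torsion[OF vanish'] unfolding L_def by blast
  have "1 \<in> L"
  proof (rule comaximal_powers[OF norm_sum _ _ _ _ m n])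
    show "f * norm_sq x1 \<simeq>[J] norm_sq x1 * f" for f
      by (rule cong_sym) (rule norm_central)
    show "f + g \<in> L" if "f \<in> L" "g \<in> L" for f g
    proof -
      have "(\<Sum>(p, q)\<leftarrow>qs. \<tau> ((f + g) * p) q) \<simeq>[KB] (\<Sum>(p, q)\<leftarrow>qs. \<tau> (f * p) q + \<tau> (g * p) q)"
        by (rule T1.cong_sum_list_K) (auto simp: distrib_right T1.\<tau>_add_left)
      also have "\<dots> = (\<Sum>(p, q)\<leftarrow>qs. \<tau> (f * p) q) + (\<Sum>(p, q)\<leftarrow>qs. \<tau> (g * p) q)"
        by (simp add: sum_list_addf case_prod_unfold)
      finally show ?thesis
        using that BT.K.add_mem BT.K.cong_mem unfolding L_def by blast
    qed
    show "f * g \<in> L" if "g \<in> L" for f g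
    proof -
      have "frag_extend (\<lambda>(p, q). frag_of (cls f \<otimes>\<^bsub>A\<^esub> p, q)) (\<Sum>(p, q)\<leftarrow>qs. \<tau> (g * p) q)
        = (\<Sum>(p, q)\<leftarrow>qs. \<tau> (f * g * p) q)"
        by (induction qs) (auto simp: frag_extend_add cls_mult m_assoc)
      then show ?thesis
        using left_mult_kernel[of "cls f"] that unfolding L_def by fastforce
    qed
    show "f \<in> L" if "f \<simeq>[J] g" "g \<in> L" for f g
      using that by (simp add: L_def cls_mult flip: cls_eq_iff)
  qed
  then have "(\<Sum>p\<leftarrow>ps. frag_of p) \<in> KB" by (simp add: L_def sum_eq)
  then show ?thesis using ps(2) BT.K.cong_mem by blast
qed

lemma BT_formal_of: "p \<in> carrier A \<Longrightarrow> q \<in> carrier A \<Longrightarrow> frag_of (p, q) \<in> BT.formal"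
  by (simp add: keys_frag_of)

text \<open>
  The values of the canonical map, regarded as functions on the unit quaternions.
\<close>

definition chi_image :: "((4 \<Rightarrow> real) \<Rightarrow> free set set) \<Rightarrow> bool" where
  "chi_image F \<longleftrightarrow> (\<exists>t\<in>BT.formal. \<forall>v\<in>carrier U1H. cls (\<Psi> v t) = F v)"

lemma chi_image_cong: "chi_image F \<Longrightarrow> (\<And>v. v \<in> carrier U1H \<Longrightarrow> F v = G v) \<Longrightarrow> chi_image G"
  by (simp add: chi_image_def)

lemma chi_image_of: "p \<in> carrier A \<Longrightarrow> q \<in> carrier A \<Longrightarrow> chi_image (\<lambda>v. p \<otimes>\<^bsub>A\<^esub> \<alpha> v q)"
  unfolding chi_image_def by (intro bexI[of _ "frag_of (p, q)"] BT_formal_of) (simp_all add: cls_\<Psi>_of)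

lemma chi_image_zero: "chi_image (\<lambda>v. \<zero>\<^bsub>A\<^esub>)"
  unfolding chi_image_def by (intro bexI[of _ 0]) (simp_all add: \<Psi>_0 cls_0)

lemma chi_image_diff:
  assumes "chi_image F" "chi_image G"
  shows "chi_image (\<lambda>v. F v \<ominus>\<^bsub>A\<^esub> G v)"
proof -
  obtain s t where "s \<in> BT.formal" "t \<in> BT.formal" "\<forall>v\<in>carrier U1H. cls (\<Psi> v s) = F v"
    "\<forall>v\<in>carrier U1H. cls (\<Psi> v t) = G v"
    using assms unfolding chi_image_def by blast
  then show ?thesis
    unfolding chi_image_def by (intro bexI[of _ "s - t"] BT.formal_diff) (simp_all add: \<Psi>_diff cls_diff)
qed

lemma chi_image_add:
  assumes "chi_image F" "chi_image G"
  shows "chi_image (\<lambda>v. F v \<oplus>\<^bsub>A\<^esub> G v)"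
proof -
  obtain s t where "s \<in> BT.formal" "t \<in> BT.formal" "\<forall>v\<in>carrier U1H. cls (\<Psi> v s) = F v"
    "\<forall>v\<in>carrier U1H. cls (\<Psi> v t) = G v"
    using assms unfolding chi_image_def by blast
  then show ?thesis
    unfolding chi_image_def by (intro bexI[of _ "s + t"] BT.formal_add) (simp_all add: \<Psi>_add cls_add)
qed

lemma chi_image_cls_sum:
  assumes "finite I" "\<And>i. i \<in> I \<Longrightarrow> chi_image (\<lambda>v. cls (F i v))"
  shows "chi_image (\<lambda>v. cls (\<Sum>i\<in>I. F i v))"
  using assms
proof (induction I rule: finite_induct)
  case empty
  then show ?case using chi_image_zero by (simp add: cls_0)
next
  case (insert i I)
  then show ?case using chi_image_add[of "\<lambda>v. cls (F i v)"] by (simp add: cls_add)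
qed

lemma chi_image_right_mult:
  assumes "chi_image F" and q: "q \<in> carrier A"
  shows "chi_image (\<lambda>v. F v \<otimes>\<^bsub>A\<^esub> \<alpha> v q)"
proof -
  obtain t where t: "t \<in> BT.formal" "\<forall>v\<in>carrier U1H. cls (\<Psi> v t) = F v"
    using assms(1) unfolding chi_image_def by blast
  have "chi_image (\<lambda>v. cls (\<Psi> v t) \<otimes>\<^bsub>A\<^esub> \<alpha> v q)"
    using t(1)
  proof (induction rule: BT.formal_induct)
    case zero
    show ?case
      by (rule chi_image_cong[OF chi_image_zero]) (simp add: \<Psi>_0 cls_0 \<alpha>_closed q)
  next
    case (of m n)
    show ?case
      by (rule chi_image_cong[OF chi_image_of[of m "n \<otimes>\<^bsub>A\<^esub> q"]])
        (simp_all add: of q cls_\<Psi>_of \<alpha>_closed m_assoc star_homD(3)[OF \<alpha>_hom])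
  next
    case (diff s t)
    show ?case
      by (rule chi_image_cong[OF chi_image_diff[OF diff(3,4)]])
        (simp add: \<Psi>_diff cls_diff a_minus_def l_distr l_minus \<alpha>_closed q)
  qed
  then show ?thesis by (rule chi_image_cong) (simp add: t(2))
qed

definition image_multiplier :: "((4 \<Rightarrow> real) \<Rightarrow> complex) \<Rightarrow> bool" where
  "image_multiplier h \<longleftrightarrow> (\<forall>p\<in>carrier A. chi_image (\<lambda>v. h v \<odot>\<^bsub>A\<^esub> p))"

text \<open>
  \<open>k(v) p = \<Sum> m \<alpha>\<^sub>v(n)\<close> implies \<open>h(v) k(v) p = \<Sum> (h(v) m) \<alpha>\<^sub>v(n)\<close>, and each \<open>h(v) m\<close> has the form
  \<open>\<Sum> m' \<alpha>\<^sub>v(n')\<close>.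
\<close>

lemma image_multiplier_mult:
  assumes "image_multiplier h" "image_multiplier k"
  shows "image_multiplier (\<lambda>v. h v * k v)"
  unfolding image_multiplier_def
proof
  fix p assume p: "p \<in> carrier A"
  then obtain t where t: "t \<in> BT.formal" "\<forall>v\<in>carrier U1H. cls (\<Psi> v t) = k v \<odot>\<^bsub>A\<^esub> p"
    using assms(2) unfolding image_multiplier_def chi_image_def by blast
  have "chi_image (\<lambda>v. h v \<odot>\<^bsub>A\<^esub> cls (\<Psi> v t))"
    using t(1)
  proof (induction rule: BT.formal_induct)
    case zero
    show ?case
      using cls_scalar_mult[of _ 0] by (intro chi_image_cong[OF chi_image_zero]) (simp add: \<Psi>_0 cls_0)
  next
    case (of m n)
    then have "chi_image (\<lambda>v. h v \<odot>\<^bsub>A\<^esub> m \<otimes>\<^bsub>A\<^esub> \<alpha> v n)"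
      using assms(1) by (intro chi_image_right_mult) (auto simp: image_multiplier_def)
    then show ?case
      by (rule chi_image_cong) (simp add: cls_\<Psi>_of of smult_mult \<alpha>_closed)
  next
    case (diff s t)
    show ?case
      by (rule chi_image_cong[OF chi_image_diff[OF diff(3,4)]])
        (simp add: \<Psi>_diff cls_diff a_minus_def smult_add smult_minus)
  qed
  then show "chi_image (\<lambda>v. (h v * k v) \<odot>\<^bsub>A\<^esub> p)"
    by (rule chi_image_cong) (simp add: t(2) smult_smult p)
qed

text \<open>
  \<open>v = (x\<^sub>1\<^sup>* x\<^sub>1 + x\<^sub>2\<^sup>* x\<^sub>2) v = x\<^sub>1\<^sup>* (x\<^sub>1 v) + x\<^sub>2\<^sup>* (x\<^sub>2 v)\<close>, where \<open>x\<^sub>i v = \<alpha>\<^sub>v(x\<^sub>i)\<close>.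
\<close>

lemma image_multiplier_coord: "image_multiplier (\<lambda>v. complex_of_real (v \<rho>))"
  unfolding image_multiplier_def
proof
  fix p assume "p \<in> carrier A"
  then obtain f where p: "p = cls f" by (auto simp: carrier_eq)
  have summand: "chi_image (\<lambda>v. cls (f * (quat_conj w \<bullet> (w \<bullet> quat_real v)) \<rho>))"
    if w: "\<And>v \<mu>. act v (w \<mu>) = (w \<bullet> quat_real v) \<mu>" for w
  proof -
    have "chi_image (\<lambda>v. cls (\<Sum>\<nu>\<in>UNIV. \<Sum>\<kappa>\<in>UNIV. f * (rs (quat_coeff \<rho> \<nu> \<kappa>) * quat_conj w \<nu>) * act v (w \<kappa>)))"
    proof (intro chi_image_cls_sum finite)
      fix \<nu> \<kappa>
      show "chi_image (\<lambda>v. cls (f * (rs (quat_coeff \<rho> \<nu> \<kappa>) * quat_conj w \<nu>) * act v (w \<kappa>)))"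
        using chi_image_of[of "cls (f * (rs (quat_coeff \<rho> \<nu> \<kappa>) * quat_conj w \<nu>))" "cls (w \<kappa>)"]
        by (rule chi_image_cong) (simp_all add: \<alpha>_cls cls_mult)
    qed
    then show ?thesis
      unfolding free_quat_mult_def[of "quat_conj w"] w by (simp add: sum_mult_distrib_free mult.assoc)
  qed
  have "chi_image (\<lambda>v. cls (f * (quat_conj x1 \<bullet> (x1 \<bullet> quat_real v)) \<rho>) \<oplus>\<^bsub>A\<^esub> cls (f * (quat_conj x2 \<bullet> (x2 \<bullet> quat_real v)) \<rho>))"
    by (intro chi_image_add summand) (simp_all add: act_simps)
  then show "chi_image (\<lambda>v. complex_of_real (v \<rho>) \<odot>\<^bsub>A\<^esub> p)"
  proof (rule chi_image_cong)
    fix v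
    have norm: "(quat_conj w \<bullet> (w \<bullet> quat_real v)) \<rho> \<simeq>[J] norm_sq w * rs (v \<rho>)"
      if w: "\<And>\<mu>. (quat_conj w \<bullet> w) \<mu> \<simeq>[J] quat_scalar (norm_sq w) \<mu>" for w
    proof -
      have "(quat_conj w \<bullet> w \<bullet> quat_real v) \<rho> \<simeq>[J] (quat_scalar (norm_sq w) \<bullet> quat_real v) \<rho>"
        by (intro cong_quat_mult w cong_refl)
      then show ?thesis by (simp add: quat_mult_assoc quat_scalar_mult quat_real_def)
    qed
    have "f * (quat_conj x1 \<bullet> (x1 \<bullet> quat_real v)) \<rho> + f * (quat_conj x2 \<bullet> (x2 \<bullet> quat_real v)) \<rho>
      \<simeq>[J] f * (norm_sq x1 * rs (v \<rho>)) + f * (norm_sq x2 * rs (v \<rho>))"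
      by (intro cong_add cong_mult_left norm P1.z_mult_x P2.z_mult_x)
    also have "\<dots> = f * ((norm_sq x1 + norm_sq x2) * rs (v \<rho>))"
      by (simp add: distrib_left distrib_right)
    also have "\<dots> \<simeq>[J] f * (1 * rs (v \<rho>))"
      by (intro cong_mult_left cong_mult_right norm_sum)
    also have "\<dots> = rs (v \<rho>) * f"
      by (simp add: scalar_commute)
    finally show "cls (f * (quat_conj x1 \<bullet> (x1 \<bullet> quat_real v)) \<rho>) \<oplus>\<^bsub>A\<^esub> cls (f * (quat_conj x2 \<bullet> (x2 \<bullet> quat_real v)) \<rho>)
      = complex_of_real (v \<rho>) \<odot>\<^bsub>A\<^esub> p"
      by (simp only: p cls_add[symmetric] cls_scalar_mult[symmetric] cls_eq_iff)
  qed
qed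

lemma image_multiplier_poly:
  assumes "h \<in> poly"
  shows "image_multiplier h"
proof -
  interpret F: star_algebra "function_alg (carrier U1H)" by (rule function_alg_star_algebra)
  \<comment> \<open>the adjoint reverses the order of the factors in the image, so closedness under conjugation is built in\<close>
  let ?T = "{h \<in> extensional (carrier U1H). image_multiplier h \<and> image_multiplier (\<lambda>v. cnj (h v))}"
  have cong: "image_multiplier k" if "image_multiplier h" "\<And>v. v \<in> carrier U1H \<Longrightarrow> h v = k v" for h k
    using that unfolding image_multiplier_def by (auto elim!: chi_image_cong)
  have const: "image_multiplier (\<lambda>v. c)" for c
    unfolding image_multiplier_def
  proof
    fix p assume p: "p \<in> carrier A"
    have "chi_image (\<lambda>v. c \<odot>\<^bsub>A\<^esub> p \<otimes>\<^bsub>A\<^esub> \<alpha> v \<one>\<^bsub>A\<^esub>)" by (intro chi_image_of smult_closed p one_closed)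
    then show "chi_image (\<lambda>v. c \<odot>\<^bsub>A\<^esub> p)"
      by (rule chi_image_cong) (simp add: p star_homD(4)[OF \<alpha>_hom])
  qed
  have add: "image_multiplier (\<lambda>v. h v + k v)" if "image_multiplier h" "image_multiplier k" for h k
    using that chi_image_add unfolding image_multiplier_def by (auto simp: smult_add_scalar)
  have T_I: "(\<lambda>w\<in>carrier U1H. h w) \<in> ?T"
    if "image_multiplier h" "image_multiplier (\<lambda>v. cnj (h v))" for h
    using cong[OF that(1), of "\<lambda>w\<in>carrier U1H. h w"]
      cong[OF that(2), of "\<lambda>v. cnj ((\<lambda>w\<in>carrier U1H. h w) v)"] by simp
  have T_mult: "(\<lambda>w\<in>carrier U1H. h w * k w) \<in> ?T" if "h \<in> ?T" "k \<in> ?T" for h k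
    using that by (intro T_I) (auto intro: image_multiplier_mult)
  have T_const: "(\<lambda>w\<in>carrier U1H. c) \<in> ?T" for c
    by (intro T_I const)
  have T_smult: "(\<lambda>w\<in>carrier U1H. c * h w) \<in> ?T" if "h \<in> ?T" for c h
  proof -
    have "(\<lambda>w\<in>carrier U1H. (\<lambda>w\<in>carrier U1H. c) w * h w) \<in> ?T"
      by (rule T_mult[OF T_const that])
    then show ?thesis by (simp cong: restrict_cong)
  qed
  have T_add: "(\<lambda>w\<in>carrier U1H. h w + k w) \<in> ?T" if "h \<in> ?T" "k \<in> ?T" for h k
    using that by (intro T_I) (auto intro: add)
  have T_star: "(\<lambda>w\<in>carrier U1H. cnj (h w)) \<in> ?T" if "h \<in> ?T" for h
    using that by (intro T_I) auto
  have "subring ?T (function_alg (carrier U1H))"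
  proof (rule F.subringI)
    show "\<one>\<^bsub>function_alg (carrier U1H)\<^esub> \<in> ?T"
      unfolding function_alg_simps by (rule T_const)
    show "\<ominus>\<^bsub>function_alg (carrier U1H)\<^esub> h \<in> ?T" if h: "h \<in> ?T" for h
    proof -
      have "h \<in> carrier (function_alg (carrier U1H))" using h by simp
      moreover have "(\<lambda>w\<in>carrier U1H. - 1 * h w) \<oplus>\<^bsub>function_alg (carrier U1H)\<^esub> h = \<zero>\<^bsub>function_alg (carrier U1H)\<^esub>"
        by (simp cong: restrict_cong)
      ultimately have "\<ominus>\<^bsub>function_alg (carrier U1H)\<^esub> h = (\<lambda>w\<in>carrier U1H. - 1 * h w)"
        by (intro F.minus_equality) simp_all
      then show ?thesis using T_smult[OF h, of "- 1"] by simp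
    qed
    show "h \<otimes>\<^bsub>function_alg (carrier U1H)\<^esub> k \<in> ?T" "h \<oplus>\<^bsub>function_alg (carrier U1H)\<^esub> k \<in> ?T"
      if "h \<in> ?T" "k \<in> ?T" for h k
      unfolding function_alg_simps by (intro T_mult T_add that)+
  qed simp
  then have "star_subalgebra ?T (function_alg (carrier U1H))"
    unfolding star_subalgebra_def function_alg_simps using T_smult T_star by blast
  moreover have "range coord \<subseteq> ?T"
    using T_I[of "\<lambda>w. complex_of_real (w _)"] image_multiplier_coord by (auto simp: coord_def)
  ultimately have "poly \<subseteq> ?T" by (rule generated_star_subalgebra_minimal)
  then show ?thesis using assms by blast
qed

lemma \<Psi>_surjective:
  assumes "t \<in> tens.formal"
  shows "\<exists>s\<in>BT.formal. \<forall>v\<in>carrier U1H. cls (\<Psi> v s) = cls (ev v t)"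
proof -
  have "chi_image (\<lambda>v. cls (ev v t))"
    using assms
  proof (induction rule: tens.formal_induct)
    case zero
    show ?case by (rule chi_image_cong[OF chi_image_zero]) (simp add: ev_0 cls_0)
  next
    case (of a h)
    then show ?case using image_multiplier_poly[of h] by (simp add: image_multiplier_def cls_ev_of)
  next
    case (diff s t)
    show ?case by (rule chi_image_cong[OF chi_image_diff[OF diff(3,4)]]) (simp add: ev_diff cls_diff)
  qed
  then show ?thesis by (simp add: chi_image_def)
qed

section \<open>The coaction and the canonical map\<close>

lemma coord_mem: "coord \<rho> \<in> poly"
  using generated_star_subalgebra_incl by (rule subsetD) simp


definition coaction_gen :: "(4 \<Rightarrow> gen) \<Rightarrow> 4 \<Rightarrow> (free set set \<times> ((4 \<Rightarrow> real) \<Rightarrow> complex) \<Rightarrow>\<^sub>0 int) set" where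
  "coaction_gen i \<mu> = (\<Oplus>\<^bsub>TA\<^esub>\<nu>\<in>UNIV. \<Oplus>\<^bsub>TA\<^esub>\<rho>\<in>UNIV.
     complex_of_real (quat_coeff \<mu> \<nu> \<rho>) \<odot>\<^bsub>TA\<^esub> complex_tensor A H (quat_x R i \<nu>) (coord \<rho>))"

lemma coaction_gen:
  assumes i: "i = X1 \<or> i = X2"
  shows "coaction_gen i \<mu> \<in> carrier TA"
    and "v \<in> carrier U1H \<Longrightarrow> evc (coaction_gen i \<mu>) v = \<alpha> v (quat_x R i \<mu>)"
proof -
  have x: "quat_x R i = (\<lambda>\<mu>. cls (free_gen (i \<mu>)))"
    using i quat_x_eq by blast
  have summand: "c \<odot>\<^bsub>TA\<^esub> complex_tensor A H (quat_x R i \<nu>) (coord \<rho>) \<in> carrier TA" for c \<nu> \<rho>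
    by (intro TA_smult complex_tensor_TA coord_mem) (simp add: x)
  have inner: "(\<Oplus>\<^bsub>TA\<^esub>\<rho>\<in>UNIV. complex_of_real (quat_coeff \<mu> \<nu> \<rho>) \<odot>\<^bsub>TA\<^esub>
      complex_tensor A H (quat_x R i \<nu>) (coord \<rho>)) \<in> carrier TA" for \<nu>
    by (rule TA.finsum_closed) (use summand in blast)
  show "coaction_gen i \<mu> \<in> carrier TA"
    unfolding coaction_gen_def by (rule TA.finsum_closed) (use inner in blast)
  assume v: "v \<in> carrier U1H"
  have "evc (c \<odot>\<^bsub>TA\<^esub> complex_tensor A H (quat_x R i \<nu>) (coord \<rho>)) v
      = cls (scalar c * (rs (v \<rho>) * free_gen (i \<nu>)))" for c \<nu> \<rho>
    using v TA_smult(2)[OF complex_tensor_TA(1)[OF _ coord_mem] v, of "quat_x R i \<nu>"]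
      complex_tensor_TA(2)[OF _ coord_mem v, of "quat_x R i \<nu>"]
    by (simp add: x coord_def cls_scalar_mult[symmetric] del: restrict_apply) (simp add: restrict_apply)
  then have "evc (coaction_gen i \<mu>) v
      = cls (\<Sum>\<nu>\<in>UNIV. \<Sum>\<rho>\<in>UNIV. rs (quat_coeff \<mu> \<nu> \<rho>) * (rs (v \<rho>) * free_gen (i \<nu>)))"
    unfolding coaction_gen_def
    by (simp only: evc_finsum[OF finite inner v] evc_finsum[OF finite summand v] cls_sum[OF finite])
  also have "\<dots> = cls (act v (free_gen (i \<mu>)))"
    using i by (auto simp: act_simps free_quat_mult_def quat_real_def scalar_commute)
  finally show "evc (coaction_gen i \<mu>) v = \<alpha> v (quat_x R i \<mu>)"
    by (simp add: x \<alpha>_cls v)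
qed

lemma polynomial_orbits:
  assumes "p \<in> carrier A"
  shows "\<exists>X\<in>carrier TA. \<forall>v\<in>carrier U1H. evc X v = \<alpha> v p"
proof -
  obtain f where p: "p = cls f" using assms by (auto simp: carrier_eq)
  show ?thesis unfolding p
  proof (induction f rule: free_induct)
    case (scalar c)
    show ?case
      by (intro bexI[of _ "c \<odot>\<^bsub>TA\<^esub> \<one>\<^bsub>TA\<^esub>"])
        (auto simp: TA_smult TA_one evc_one cls_scalar star_homD(4,5)[OF \<alpha>_hom])
  next
    case (gen_mult g f)
    then obtain X where X: "X \<in> carrier TA" "\<forall>v\<in>carrier U1H. evc X v = \<alpha> v (cls f)" by blast
    obtain i \<mu> where i: "i = X1 \<or> i = X2" and g: "g = i \<mu>" by (cases g) auto
    have "quat_x R i \<mu> = cls (free_gen g)" using i g quat_x_eq by auto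
    then show ?case
      using X coaction_gen[OF i]
      by (intro bexI[of _ "coaction_gen i \<mu> \<otimes>\<^bsub>TA\<^esub> X"])
        (auto simp: evc_mult TA_mult_closed cls_mult star_homD(3)[OF \<alpha>_hom])
  next
    case (add f g)
    then obtain X Y where "X \<in> carrier TA" "\<forall>v\<in>carrier U1H. evc X v = \<alpha> v (cls f)"
      "Y \<in> carrier TA" "\<forall>v\<in>carrier U1H. evc Y v = \<alpha> v (cls g)" by blast
    then show ?case
      by (intro bexI[of _ "X \<oplus>\<^bsub>TA\<^esub> Y"]) (auto simp: evc_add cls_add star_homD(2)[OF \<alpha>_hom])
  qed
qed

lemma coaction_iff:
  "coaction R \<delta> \<longleftrightarrow> \<delta> \<in> star_hom A TA \<and> (\<forall>i\<in>{X1, X2}. \<forall>\<mu>. \<delta> (quat_x R i \<mu>) = coaction_gen i \<mu>)"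
  by (simp only: coaction_def SU2_alg_eq coaction_gen_def)

lemma coaction_exists: "\<exists>\<delta>. coaction R \<delta>"
proof -
  have "\<forall>p\<in>carrier A. \<exists>X. X \<in> carrier TA \<and> (\<forall>v\<in>carrier U1H. evc X v = \<alpha> v p)"
    using polynomial_orbits by blast
  from bchoice[OF this] obtain \<delta>
    where \<delta>: "\<And>p. p \<in> carrier A \<Longrightarrow> \<delta> p \<in> carrier TA"
      and ev\<delta>: "\<And>p v. p \<in> carrier A \<Longrightarrow> v \<in> carrier U1H \<Longrightarrow> evc (\<delta> p) v = \<alpha> v p" by blast
  have "\<delta> \<in> star_hom A TA"
  proof (rule star_homI)
    fix p q assume p: "p \<in> carrier A" and q: "q \<in> carrier A"
    show "\<delta> (p \<oplus>\<^bsub>A\<^esub> q) = \<delta> p \<oplus>\<^bsub>TA\<^esub> \<delta> q"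
      by (rule TA_eqI) (simp_all add: p q \<delta> ev\<delta> evc_add star_homD(2)[OF \<alpha>_hom])
    show "\<delta> (p \<otimes>\<^bsub>A\<^esub> q) = \<delta> p \<otimes>\<^bsub>TA\<^esub> \<delta> q"
      by (rule TA_eqI) (simp_all add: p q \<delta> ev\<delta> evc_mult TA_mult_closed star_homD(3)[OF \<alpha>_hom])
  next
    show "\<delta> \<one>\<^bsub>A\<^esub> = \<one>\<^bsub>TA\<^esub>"
      by (rule TA_eqI) (simp_all add: \<delta> ev\<delta> TA_one evc_one star_homD(4)[OF \<alpha>_hom])
  next
    fix c p assume p: "p \<in> carrier A"
    show "\<delta> (c \<odot>\<^bsub>A\<^esub> p) = c \<odot>\<^bsub>TA\<^esub> \<delta> p"
      by (rule TA_eqI) (simp_all add: p \<delta> ev\<delta> TA_smult star_homD(5)[OF \<alpha>_hom])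
  next
    fix p assume p: "p \<in> carrier A"
    show "\<delta> (star A p) = star TA (\<delta> p)"
      by (rule TA_eqI) (simp_all add: p \<delta> ev\<delta> TA_star star_homD(6)[OF \<alpha>_hom])
  qed (rule \<delta>)
  moreover have "\<delta> (quat_x R i \<mu>) = coaction_gen i \<mu>" if "i \<in> {X1, X2}" for i \<mu>
  proof -
    have i: "i = X1 \<or> i = X2" using that by blast
    then have "quat_x R i \<mu> \<in> carrier A" using quat_x_eq by auto
    then show ?thesis
      by (intro TA_eqI) (simp_all add: \<delta> ev\<delta> coaction_gen[OF i])
  qed
  ultimately show ?thesis by (auto simp: coaction_iff)
qed

text \<open>
  Both sides are homomorphisms that agree on the generators, so a coaction is unique.
\<close>

lemma evc_coaction:
  assumes \<delta>: "coaction R \<delta>" and p: "p \<in> carrier A" and v: "v \<in> carrier U1H"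
  shows "evc (\<delta> p) v = \<alpha> v p"
proof -
  have hom: "\<delta> \<in> star_hom A TA" and gen: "\<And>i \<mu>. i = X1 \<or> i = X2 \<Longrightarrow> \<delta> (quat_x R i \<mu>) = coaction_gen i \<mu>"
    using \<delta> by (auto simp: coaction_iff)
  obtain f where f: "p = cls f" using p by (auto simp: carrier_eq)
  show ?thesis unfolding f
  proof (induction f rule: free_induct)
    case (scalar c)
    show ?case
      using v by (simp add: cls_scalar star_homD(4,5)[OF hom] star_homD(4,5)[OF \<alpha>_hom] TA_smult TA_one evc_one)
  next
    case (gen_mult g f)
    obtain i \<mu> where i: "i = X1 \<or> i = X2" and g: "g = i \<mu>" by (cases g) auto
    then have "quat_x R i \<mu> = cls (free_gen g)" using quat_x_eq by auto
    then have "evc (\<delta> (cls (free_gen g))) v = \<alpha> v (cls (free_gen g))"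
      using gen[OF i, of \<mu>] coaction_gen(2)[OF i v, of \<mu>] by simp
    then show ?case
      using gen_mult v by (simp add: cls_mult star_homD(1,3)[OF hom] star_homD(3)[OF \<alpha>_hom] evc_mult)
  next
    case (add f g)
    then show ?case
      using v by (simp add: cls_add star_homD(1,2)[OF hom] star_homD(2)[OF \<alpha>_hom] evc_add)
  qed
qed

lemma canonical_map_iff:
  "canonical_map R \<delta> \<chi> \<longleftrightarrow> \<chi> \<in> hom BT.T (add_monoid TA) \<and>
     (\<forall>p'\<in>carrier A. \<forall>p\<in>carrier A. \<chi> (BT.tclass (frag_of (p', p))) =
        complex_tensor A H p' \<one>\<^bsub>H\<^esub> \<otimes>\<^bsub>TA\<^esub> \<delta> p)"
  by (simp only: canonical_map_def subring_tensor_group_def subring_tensor_def SU2_alg_eq)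

lemma evc_canonical_of:
  assumes \<delta>: "coaction R \<delta>" and "p' \<in> carrier A" "p \<in> carrier A"
  shows "complex_tensor A H p' \<one>\<^bsub>H\<^esub> \<otimes>\<^bsub>TA\<^esub> \<delta> p \<in> carrier TA"
    and "v \<in> carrier U1H \<Longrightarrow> evc (complex_tensor A H p' \<one>\<^bsub>H\<^esub> \<otimes>\<^bsub>TA\<^esub> \<delta> p) v = cls (\<Psi> v (frag_of (p', p)))"
proof -
  have "\<one>\<^bsub>H\<^esub> \<in> poly" by (simp add: C_closed)
  then have 1: "complex_tensor A H p' \<one>\<^bsub>H\<^esub> \<in> carrier TA"
    and ev: "v \<in> carrier U1H \<Longrightarrow> evc (complex_tensor A H p' \<one>\<^bsub>H\<^esub>) v = \<one>\<^bsub>H\<^esub> v \<odot>\<^bsub>A\<^esub> p'" for v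
    by (rule complex_tensor_TA[OF assms(2)])+
  have \<delta>p: "\<delta> p \<in> carrier TA"
    by (rule star_homD(1)[OF _ assms(3)]) (use \<delta> in \<open>simp add: coaction_iff\<close>)
  show "complex_tensor A H p' \<one>\<^bsub>H\<^esub> \<otimes>\<^bsub>TA\<^esub> \<delta> p \<in> carrier TA"
    by (rule TA_mult_closed[OF 1 \<delta>p])
  show "evc (complex_tensor A H p' \<one>\<^bsub>H\<^esub> \<otimes>\<^bsub>TA\<^esub> \<delta> p) v = cls (\<Psi> v (frag_of (p', p)))" if v: "v \<in> carrier U1H"
    unfolding evc_mult[OF 1 \<delta>p v] ev[OF v] evc_coaction[OF \<delta> assms(3) v] cls_\<Psi>_of[OF assms(2,3) v]
    using v assms(2) by (simp add: smult_one)
qed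

lemma evc_minus:
  assumes "X \<in> carrier TA" "v \<in> carrier U1H"
  shows "evc (\<ominus>\<^bsub>TA\<^esub> X) v = \<ominus>\<^bsub>A\<^esub> evc X v"
proof -
  have "evc (\<ominus>\<^bsub>TA\<^esub> X) v \<oplus>\<^bsub>A\<^esub> evc X v = \<zero>\<^bsub>A\<^esub>"
    using evc_add[of "\<ominus>\<^bsub>TA\<^esub> X" X v] assms by (simp add: TA.l_neg evc_zero)
  then show ?thesis by (intro minus_equality[symmetric] evc_closed)
qed

lemma canonical_value_exists:
  assumes \<delta>: "coaction R \<delta>" and t: "t \<in> BT.formal"
  shows "\<exists>X. X \<in> carrier TA \<and> (\<forall>v\<in>carrier U1H. evc X v = cls (\<Psi> v t))"
  using t
proof (induction rule: BT.formal_induct)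
  case zero
  show ?case by (intro exI[of _ "\<zero>\<^bsub>TA\<^esub>"]) (simp add: evc_zero \<Psi>_0 cls_0)
next
  case (of p' p)
  from evc_canonical_of(1)[OF \<delta> this] evc_canonical_of(2)[OF \<delta> this] show ?case by blast
next
  case (diff s t)
  then obtain X Y where "X \<in> carrier TA" "\<forall>v\<in>carrier U1H. evc X v = cls (\<Psi> v s)"
    "Y \<in> carrier TA" "\<forall>v\<in>carrier U1H. evc Y v = cls (\<Psi> v t)" by blast
  then show ?case
    by (intro exI[of _ "X \<oplus>\<^bsub>TA\<^esub> \<ominus>\<^bsub>TA\<^esub> Y"])
      (simp add: evc_add evc_minus \<Psi>_diff cls_diff a_minus_def)
qed

lemma canonical_map_exists:
  assumes \<delta>: "coaction R \<delta>"
  shows "\<exists>\<chi>. canonical_map R \<delta> \<chi>"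
proof -
  define \<chi> where "\<chi> Y = (SOME X. X \<in> carrier TA \<and> (\<forall>v\<in>carrier U1H. evc X v = cls (\<Psi> v (SOME t. t \<in> Y))))" for Y
  have \<chi>: "\<chi> (BT.tclass t) \<in> carrier TA"
    and ev\<chi>: "v \<in> carrier U1H \<Longrightarrow> evc (\<chi> (BT.tclass t)) v = cls (\<Psi> v t)" if t: "t \<in> BT.formal" for t v
  proof -
    define s where "s = (SOME s. s \<in> BT.tclass t)"
    have s: "s \<in> BT.tclass t" unfolding s_def by (rule someI) (rule BT.tclass_self)
    have "\<chi> (BT.tclass t) \<in> carrier TA \<and> (\<forall>v\<in>carrier U1H. evc (\<chi> (BT.tclass t)) v = cls (\<Psi> v s))"
      unfolding \<chi>_def s_def[symmetric]
      by (rule someI_ex) (rule canonical_value_exists[OF \<delta> BT.mem_tclass_formal[OF s t]])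
    moreover have "cls (\<Psi> v s) = cls (\<Psi> v t)" if "v \<in> carrier U1H" for v
      using \<Psi>_kernel[of "s - t" v] s that by (simp add: BT.mem_tclass cls_eq_iff cong_mod_def \<Psi>_diff)
    ultimately show "\<chi> (BT.tclass t) \<in> carrier TA"
      "v \<in> carrier U1H \<Longrightarrow> evc (\<chi> (BT.tclass t)) v = cls (\<Psi> v t)" by auto
  qed
  have "\<chi> \<in> hom BT.T (add_monoid TA)"
  proof (rule homI)
    show "\<chi> X \<in> carrier (add_monoid TA)" if "X \<in> carrier BT.T" for X
      using that \<chi> unfolding BT.carrier_T by auto
    fix X Y assume "X \<in> carrier BT.T" "Y \<in> carrier BT.T"
    then obtain s t where st: "s \<in> BT.formal" "t \<in> BT.formal" "X = BT.tclass s" "Y = BT.tclass t"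
      unfolding BT.carrier_T by blast
    have st_add: "s + t \<in> BT.formal" by (rule BT.formal_add[OF st(1,2)])
    have "\<chi> (BT.tclass (s + t)) = \<chi> (BT.tclass s) \<oplus>\<^bsub>TA\<^esub> \<chi> (BT.tclass t)"
      by (rule TA_eqI)
        (simp_all only: \<chi>[OF st_add] \<chi>[OF st(1)] \<chi>[OF st(2)] TA.add.m_closed evc_add
          ev\<chi>[OF st_add] ev\<chi>[OF st(1)] ev\<chi>[OF st(2)] \<Psi>_add cls_add)
    then show "\<chi> (X \<otimes>\<^bsub>BT.T\<^esub> Y) = \<chi> X \<otimes>\<^bsub>add_monoid TA\<^esub> \<chi> Y"
      unfolding st(3,4) BT.tclass_add by simp
  qed
  moreover have "\<chi> (BT.tclass (frag_of (p', p))) = complex_tensor A H p' \<one>\<^bsub>H\<^esub> \<otimes>\<^bsub>TA\<^esub> \<delta> p"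
    if "p' \<in> carrier A" "p \<in> carrier A" for p' p
    by (rule TA_eqI)
      (simp_all only: \<chi>[OF BT_formal_of[OF that]] ev\<chi>[OF BT_formal_of[OF that]] evc_canonical_of[OF \<delta> that])
  ultimately show ?thesis unfolding canonical_map_iff by blast
qed

lemma evc_canonical_map:
  assumes \<delta>: "coaction R \<delta>" and \<chi>: "canonical_map R \<delta> \<chi>" and t: "t \<in> BT.formal" and v: "v \<in> carrier U1H"
  shows "\<chi> (BT.tclass t) \<in> carrier TA" and "evc (\<chi> (BT.tclass t)) v = cls (\<Psi> v t)"
proof -
  have hom: "\<chi> \<in> hom BT.T (add_monoid TA)"
    and \<chi>_of: "\<And>p' p. p' \<in> carrier A \<Longrightarrow> p \<in> carrier A \<Longrightarrow>
      \<chi> (BT.tclass (frag_of (p', p))) = complex_tensor A H p' \<one>\<^bsub>H\<^esub> \<otimes>\<^bsub>TA\<^esub> \<delta> p"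
    using \<chi> unfolding canonical_map_iff by blast+
  have closed: "\<chi> (BT.tclass t) \<in> carrier TA" if "t \<in> BT.formal" for t
    using hom_in_carrier[OF hom] that unfolding BT.carrier_T by simp
  have add: "evc (\<chi> (BT.tclass (s + t))) v = evc (\<chi> (BT.tclass s)) v \<oplus>\<^bsub>A\<^esub> evc (\<chi> (BT.tclass t)) v"
    if "s \<in> BT.formal" "t \<in> BT.formal" for s t
  proof -
    have "\<chi> (BT.tclass (s + t)) = \<chi> (BT.tclass s) \<oplus>\<^bsub>TA\<^esub> \<chi> (BT.tclass t)"
      using hom_mult[OF hom, of "BT.tclass s" "BT.tclass t"] that unfolding BT.carrier_T BT.tclass_add by simp
    then show ?thesis by (simp only: evc_add[OF closed[OF that(1)] closed[OF that(2)] v])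
  qed
  show "\<chi> (BT.tclass t) \<in> carrier TA" by (rule closed[OF t])
  show "evc (\<chi> (BT.tclass t)) v = cls (\<Psi> v t)"
    using t
  proof (induction rule: BT.formal_induct)
    case zero
    have "evc (\<chi> (BT.tclass 0)) v = evc (\<chi> (BT.tclass 0)) v \<oplus>\<^bsub>A\<^esub> evc (\<chi> (BT.tclass 0)) v"
      using add[of 0 0] by simp
    then have "evc (\<chi> (BT.tclass 0)) v = \<zero>\<^bsub>A\<^esub>"
      using add.l_cancel_one'[OF evc_closed evc_closed] by metis
    then show ?case by (simp add: \<Psi>_0 cls_0)
  next
    case (of p' p)
    then show ?case by (simp only: \<chi>_of evc_canonical_of(2)[OF \<delta> _ _ v])
  next
    case (diff s t)
    have "evc (\<chi> (BT.tclass (s - t))) v \<oplus>\<^bsub>A\<^esub> cls (\<Psi> v t) = cls (\<Psi> v s)"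
      using add[OF BT.formal_diff[OF diff(1,2)] diff(2)] diff(3,4) by simp
    then have "evc (\<chi> (BT.tclass (s - t))) v = cls (\<Psi> v s) \<ominus>\<^bsub>A\<^esub> cls (\<Psi> v t)"
      by (simp add: a_minus_def evc_closed add.inv_solve_right)
    then show ?case by (simp only: \<Psi>_diff cls_diff)
  qed
qed

text \<open>
  Evaluation turns the two conditions into \<open>\<Psi>_injective\<close> and \<open>\<Psi>_surjective\<close>.
\<close>

lemma canonical_map_bij:
  assumes \<delta>: "coaction R \<delta>" and \<chi>: "canonical_map R \<delta> \<chi>"
  shows "bij_betw \<chi> (carrier BT.T) (carrier TA)"
proof -
  note ev\<chi> = evc_canonical_map[OF \<delta> \<chi>]
  have unit: "(\<lambda>\<mu>. of_bool (\<mu> = 0)) \<in> carrier U1H"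
    by (simp add: carrier_U1H unit_sphere_def sum_4)
  have "inj_on \<chi> (carrier BT.T)"
  proof (rule inj_onI)
    fix X Y assume "X \<in> carrier BT.T" "Y \<in> carrier BT.T" and eq: "\<chi> X = \<chi> Y"
    then obtain s t where st: "s \<in> BT.formal" "t \<in> BT.formal" "X = BT.tclass s" "Y = BT.tclass t"
      unfolding BT.carrier_T by blast
    have "s - t \<in> KB"
    proof (rule \<Psi>_injective)
      fix v assume v: "v \<in> carrier U1H"
      have "cls (\<Psi> v s) = cls (\<Psi> v t)"
        using ev\<chi>(2)[OF st(1) v] ev\<chi>(2)[OF st(2) v] eq st(3,4) by simp
      then show "\<Psi> v (s - t) \<in> J" by (simp add: cls_eq_iff cong_mod_def \<Psi>_diff)
    qed (rule BT.formal_diff[OF st(1,2)])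
    then show "X = Y" unfolding st(3,4) BT.tclass_eq_iff cong_mod_def .
  qed
  moreover have "\<chi> ` carrier BT.T = carrier TA"
  proof (intro equalityI subsetI)
    fix Z assume "Z \<in> \<chi> ` carrier BT.T"
    then show "Z \<in> carrier TA"
      using ev\<chi>(1)[OF _ unit] unfolding BT.carrier_T by blast
  next
    fix Z assume Z: "Z \<in> carrier TA"
    then obtain t where t: "t \<in> tens.formal" "Z = tcl t" by (rule TA_cases)
    then obtain s where s: "s \<in> BT.formal" "\<forall>v\<in>carrier U1H. cls (\<Psi> v s) = cls (ev v t)"
      using \<Psi>_surjective by blast
    have "\<chi> (BT.tclass s) = Z"
    proof (rule TA_eqI[OF ev\<chi>(1)[OF s(1) unit] Z])
      fix v assume v: "v \<in> carrier U1H"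
      show "evc (\<chi> (BT.tclass s)) v = evc Z v"
        using s(2) v by (simp only: ev\<chi>(2)[OF s(1) v] t(2) evc_tcl)
    qed
    then show "Z \<in> \<chi> ` carrier BT.T"
      using s(1) unfolding BT.carrier_T by blast
  qed
  ultimately show ?thesis by (simp only: bij_betw_def)
qed

end

theorem proposition3p3:
  fixes R :: "4 \<Rightarrow> 4 \<Rightarrow> 4 \<Rightarrow> 4 \<Rightarrow> complex"
    and \<alpha> :: "(4 \<Rightarrow> real) \<Rightarrow> free set set \<Rightarrow> free set set"
  assumes "admissible R"
    and "unit_quaternion_action R \<alpha>"
  shows "(\<exists>\<delta>. coaction R \<delta>) \<and>
    (\<forall>\<delta>. coaction R \<delta> \<longrightarrow>
      (\<exists>\<chi>. canonical_map R \<delta> \<chi>) \<and>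
      (\<forall>\<chi>. canonical_map R \<delta> \<chi> \<longrightarrow>
        bij_betw \<chi> (carrier (subring_tensor_group (seven_sphere R) (four_sphere R)))
                   (carrier (tensor_alg (seven_sphere R) SU2_alg))))"
proof -
  interpret sphere_action R \<alpha> by unfold_locales (fact assms)+
  show ?thesis
    using coaction_exists canonical_map_exists canonical_map_bij
    unfolding subring_tensor_group_def SU2_alg_eq by blast
qed

end
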